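(* Let $D$ be a positive squarefree integer with $N(\varepsilon)=-1$. The Dirichlet series $Z_D^{\mathrm{even}}(s)$ (convergent for $\operatorname{Re}s>0$) has meromorphic continuation to $\mathbb{C}$, described as follows. For $1<\operatorname{Re}s<2$, \[ \begin{aligned} Z_D^{\mathrm{even}}(s)={}&\frac{q^{s/2}\zeta(s)}{(4\log\varepsilon)^s}+\frac{q^{s/2}\Gamma(1-s)\Gamma(\frac s2)}{4\,\Gamma(1-\frac s2)\log\varepsilon}\\ &+q^{s/2}\sum_{m\ne0}\left(\frac{\Gamma(1-s)\Gamma\big(\frac s2-\frac{\pi i m}{2\log\varepsilon}\big)}{4\,\Gamma\big(1-\frac s2-\frac{\pi i m}{2\log\varepsilon}\big)\log\varepsilon}-\frac{\Gamma(1-s)\,e^{\frac{\pi i}{2}(1-s)\operatorname{sgn}(m)}}{(2\pi|m|)^{1-s}(4\log\varepsilon)^s}\right), \] and the right-hand side converges absolutely away from its poles for all $\operatorname{Re}s<2$, giving the continuation there. For $\operatorname{Re}s<0$ the continuation equals \[ Z_D^{\mathrm{even}}(s)=\frac{q^{s/2}\Gamma(1-s)}{4\log\varepsilon}\sum_{m\in\mathbb{Z}}\frac{\Gamma\big(\frac s2-\frac{\pi i m}{2\log\varepsilon}\big)}{\Gamma\big(1-\frac s2-\frac{\pi i m}{2\log\varepsilon}\big)}. \] $Z_D^{\mathrm{even}}$ has simple poles at $s=\frac{\pi i m}{\log\varepsilon}-2k$ for all $m\in\mathbb{Z}$ and integers $k\ge0$.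
   Context: $D$ positive squarefree, $\mathcal{O}_D$ the ring of integers of $\mathbb{Q}(\sqrt D)\subset\mathbb{R}$, $\varepsilon>1$ its fundamental unit, $\overline{\varepsilon}$ its conjugate, $N$ the norm. $q=D$ if $D\equiv1\bmod4$, else $q=4D$. $F_D(n)=(\varepsilon^n-\overline{\varepsilon}^{\,n})/\sqrt q$, and $Z_D^{\mathrm{even}}(s)=\sum_{n\ge1}F_D(2n)^{-s}$ for $\operatorname{Re}s>0$. $\zeta$ is the Riemann zeta function and $\operatorname{sgn}(m)=\pm1$ is the sign of $m\neq0$. *)

theory Defs
  imports "HOL-Complex_Analysis.Complex_Analysis" "HOL-Computational_Algebra.Squarefree"
begin

definition omegaD :: "int \<Rightarrow> real" where
  "omegaD D = (if D mod 4 = 1 then (1 + sqrt (real_of_int D)) / 2 else sqrt (real_of_int D))"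

definition omegaD_conj :: "int \<Rightarrow> real" where
  "omegaD_conj D = (if D mod 4 = 1 then (1 - sqrt (real_of_int D)) / 2 else - sqrt (real_of_int D))"

text \<open>Membership in O_D (viewed inside R via the embedding sqrt D > 0).\<close>
definition in_OD :: "int \<Rightarrow> real \<Rightarrow> bool" where
  "in_OD D u \<longleftrightarrow> (\<exists>a b :: int. u = of_int a + of_int b * omegaD D)"

definition OD_conj :: "int \<Rightarrow> real \<Rightarrow> real" where
  "OD_conj D u = (THE v. \<exists>a b :: int. u = of_int a + of_int b * omegaD D
                                    \<and> v = of_int a + of_int b * omegaD_conj D)"

definition OD_norm :: "int \<Rightarrow> real \<Rightarrow> real" where
  "OD_norm D u = u * OD_conj D u"

definition OD_unit :: "int \<Rightarrow> real \<Rightarrow> bool" where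
  "OD_unit D u \<longleftrightarrow> in_OD D u \<and> u \<noteq> 0 \<and> in_OD D (1 / u)"

definition fund_unit :: "int \<Rightarrow> real" where
  "fund_unit D = (THE e. 1 < e \<and> OD_unit D e \<and> (\<forall>u. OD_unit D u \<and> 1 < u \<longrightarrow> e \<le> u))"

definition qD :: "int \<Rightarrow> int" where
  "qD D = (if D mod 4 = 1 then D else 4 * D)"

definition FD :: "int \<Rightarrow> nat \<Rightarrow> real" where
  "FD D n = (fund_unit D ^ n - OD_conj D (fund_unit D) ^ n) / sqrt (real_of_int (qD D))"

definition ZevenTerm :: "int \<Rightarrow> complex \<Rightarrow> nat \<Rightarrow> complex" where
  "ZevenTerm D s n = complex_of_real (FD D (2 * (n + 1))) powr (- s)"

definition Zeven :: "int \<Rightarrow> complex \<Rightarrow> complex" where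
  "Zeven D s = (\<Sum>n. ZevenTerm D s n)"

text \<open>The Riemann zeta function: the holomorphic function on C - {1} that agrees with
  sum_{n>=1} n^(-s) for Re s > 1 (value at the pole s = 1 fixed to 0 by convention).\<close>
definition riemann_zeta :: "complex \<Rightarrow> complex" where
  "riemann_zeta = (THE f. f holomorphic_on (UNIV - {1}) \<and> f 1 = 0 \<and>
      (\<forall>s. 1 < Re s \<longrightarrow> f s = (\<Sum>n. complex_of_real (real (Suc n)) powr (- s))))"

definition sgn_int :: "int \<Rightarrow> complex" where
  "sgn_int m = (if m > 0 then 1 else -1)"

definition poleSet :: "int \<Rightarrow> complex set" where
  "poleSet D = {\<i> * complex_of_real (pi * real_of_int m / ln (fund_unit D)) - 2 * of_nat k
                 | m k. True}"

definition term1 :: "int \<Rightarrow> complex \<Rightarrow> int \<Rightarrow> complex" where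
  "term1 D s m =
     (let L = ln (fund_unit D); t = \<i> * complex_of_real (pi * real_of_int m / (2 * L)) in
      Gamma (1 - s) * Gamma (s / 2 - t) / (4 * Gamma (1 - s / 2 - t) * complex_of_real L)
      - Gamma (1 - s) * exp (complex_of_real (pi / 2) * \<i> * (1 - s) * sgn_int m)
        / (complex_of_real (2 * pi * \<bar>real_of_int m\<bar>) powr (1 - s)
           * complex_of_real (4 * L) powr s))"

definition rhs1 :: "int \<Rightarrow> complex \<Rightarrow> complex" where
  "rhs1 D s =
     (let L = ln (fund_unit D); Q = complex_of_real (real_of_int (qD D)) powr (s / 2) in
      Q * riemann_zeta s / complex_of_real (4 * L) powr s
      + Q * Gamma (1 - s) * Gamma (s / 2) / (4 * Gamma (1 - s / 2) * complex_of_real L)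
      + Q * infsum (term1 D s) (UNIV - {0}))"

definition term2 :: "int \<Rightarrow> complex \<Rightarrow> int \<Rightarrow> complex" where
  "term2 D s m =
     (let L = ln (fund_unit D); t = \<i> * complex_of_real (pi * real_of_int m / (2 * L)) in
      Gamma (s / 2 - t) / Gamma (1 - s / 2 - t))"

definition rhs2 :: "int \<Rightarrow> complex \<Rightarrow> complex" where
  "rhs2 D s =
     complex_of_real (real_of_int (qD D)) powr (s / 2) * Gamma (1 - s)
       / (4 * complex_of_real (ln (fund_unit D))) * infsum (term2 D s) UNIV"

end

theory Submission
  imports Defs
begin

text \<open>Write \<open>L = ln \<epsilon>\<close>. As \<open>N(\<epsilon>) = -1\<close>, the even terms are \<open>F(2n) = 2 sinh(2nL) / sqrt q\<close>, and the binomial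
  expansion of \<open>(1 - exp(-4nL))\<close> to the power \<open>-s\<close> turns the Dirichlet series into \<open>q\<close> to the power \<open>s/2\<close> times
  \<open>A(s) = sum over k of (s)_k / k! / (exp(2L(s+2k)) - 1)\<close>. This converges everywhere off the pole set and
  exhibits the simple poles. For \<open>Re s < 0\<close>, the partial fractions of \<open>1 / (exp w - 1)\<close> and
  \<open>sum over k of (s)_k / k! / (z + k) = B(z, 1 - s)\<close> turn it into the series of Gamma quotients
  \<open>\<Gamma>(s/2 - iy) / \<Gamma>(1 - s/2 - iy)\<close>. Such a quotient is \<open>(-iy)\<close> to the power \<open>s-1\<close>, up to a factor \<open>1 + O(1/y^2)\<close>,
  so after subtracting these powers the series converges for \<open>Re s < 2\<close>. The subtracted part, multiplied by \<open>(4L)\<close> to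
  the power \<open>s\<close>, does not depend on \<open>L\<close>; hence neither does its continuation to \<open>Re s < 2\<close>, and letting
  \<open>L\<close> tend to 0 for \<open>1 < Re s < 2\<close> identifies it with the Riemann zeta function. This
  proves the continuation of zeta at the same time.\<close>

section \<open>The fundamental unit\<close>

text \<open>Both \<open>fund_unit\<close> and \<open>riemann_zeta\<close> are definite descriptions,
  about which nothing can be said before the described objects are shown to exist uniquely. Hence
  the proof that a least unit above 1 exists, which gives L > 0, and the construction of zeta from
  scratch. The latter is cheap because one scaling serves two purposes: 2 sinh(2nL)/(4L) tends to n,
  and (-iy)^(s-1) at y = pi m/(2L) turns into (-2 pi i m)^(s-1) when multiplied by (4L)^(s-1). The
  obstacle is that \<open>zeta_via L\<close> is controlled only off its pole set. A point of the
  strip 0 <= Re s <= 1 other than 0 and 1 is kept off it by a small L. The even integers -2k lie in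
  every pole set: the negative ones are covered by \<open>zeta_left\<close>, and at 0 two residues
  must be seen to cancel. The error O(1/y^2) for the Gamma quotients is due to the symmetry of the
  arguments: their real shifts s/2 and 1 - s/2 add up to 1, and this kills the term of order
  1/y.\<close>

lemma sqrt_lin_indep:
  fixes D a b :: int
  assumes "D > 1" "squarefree D" and eq: "of_int a + of_int b * sqrt (of_int D) = (0::real)"
  shows "a = 0" "b = 0"
proof -
  have "b = 0"
  proof (rule ccontr)
    assume b: "b \<noteq> 0"
    have "(of_int a)\<^sup>2 = (of_int b * sqrt (of_int D) :: real)\<^sup>2"
      using eq by (simp add: add_eq_0_iff)
    hence "of_int (a\<^sup>2) = (of_int (b\<^sup>2 * D) :: real)"
      using assms(1) by (simp add: power_mult_distrib)
    hence ab: "a\<^sup>2 = b\<^sup>2 * D" by linarith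
    hence "b\<^sup>2 dvd a\<^sup>2" by simp
    hence "b dvd a" by simp
    then obtain c where "a = b * c" by (elim dvdE)
    with ab b have "c\<^sup>2 = D" by (simp add: power_mult_distrib)
    moreover from this have "is_unit c" using assms(2) by (auto simp: squarefree_def)
    ultimately show False using assms(1) by (auto simp: zdvd1_eq power2_eq_square abs_if split: if_splits)
  qed
  with eq show "a = 0" "b = 0" by auto
qed

lemma sqrt_not_Rats:
  fixes D :: int
  assumes "D > 1" "squarefree D"
  shows "sqrt (of_int D) \<notin> \<rat>"
proof
  assume "sqrt (of_int D) \<in> \<rat>"
  then obtain a b :: int where "b > 0" "sqrt (of_int D) = of_int a / of_int b"
    by (elim Rats_cases')
  hence "of_int (-a) + of_int b * sqrt (of_int D) = 0" by simp
  from sqrt_lin_indep(2)[OF assms this] \<open>b > 0\<close> show False by simp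
qed

lemma in_OD_sqrt: "in_OD D (of_int a + of_int b * sqrt (of_int D))"
proof (cases "D mod 4 = 1")
  case True
  have "of_int a + of_int b * sqrt (of_int D) = of_int (a - b) + of_int (2 * b) * omegaD D"
    by (simp add: omegaD_def True field_simps)
  thus ?thesis unfolding in_OD_def by blast
next
  case False
  thus ?thesis unfolding in_OD_def omegaD_def by auto
qed

text \<open>Pell's argument: the infinitely many good approximations p/q of sqrt D give elements p +
  q sqrt D of bounded norm. By pigeonhole two distinct ones share their norm k and both coordinates
  modulo |k|, and then each is a multiple of the other in Z[sqrt D]. Their quotient or its inverse
  exceeds 1.\<close>

lemma ex_OD_unit_gt_1:
  fixes D :: int
  assumes D: "D > 1" "squarefree D"
  shows "\<exists>u > 1. OD_unit D u"
proof -
  define r where "r = sqrt (real_of_int D)"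
  have r: "r > 1" "r\<^sup>2 = of_int D" using D by (auto simp: r_def)
  define S where "S = approx_set r"
  have inf: "infinite S"
    unfolding S_def using sqrt_not_Rats[OF D] rational_iff_finite_approx_set r_def by blast
  \<comment> \<open>The bound 2r + 1 comes from p^2 - D q^2 = q^2 (p/q - r)(p/q + r), where |p/q -
    r| < 1/q^2 and p/q <= r + 1.\<close>
  define M where "M = \<lceil>2 * r + 1\<rceil>"
  define nrm where "nrm = (\<lambda>(p::int,q::int). p\<^sup>2 - D * q\<^sup>2)"
  define g where "g = (\<lambda>x. (nrm x, fst x mod \<bar>nrm x\<bar>, snd x mod \<bar>nrm x\<bar>))"
  have S: "q > 0 \<and> p > 0 \<and> \<bar>nrm (p, q)\<bar> \<le> M \<and> nrm (p, q) \<noteq> 0" if "(p, q) \<in> S" for p q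
  proof -
    from that have q: "q > 0" and pq: "\<bar>r - of_int p / of_int q\<bar> < 1 / (of_int q)\<^sup>2"
      by (auto simp: S_def approx_set_def)
    have q1: "1 / (real_of_int q)\<^sup>2 \<le> 1" using q
      by (simp add: divide_simps power2_eq_square) (metis mult_mono' of_int_1_le_iff int_one_le_iff_zero_less mult.right_neutral zero_le_one)
    with pq r have "of_int p / real_of_int q > 0" "\<bar>of_int p / real_of_int q\<bar> \<le> r + 1" by linarith+
    hence p: "p > 0" using q by (simp add: zero_less_divide_iff)
    have "of_int (nrm (p,q)) = (of_int q)\<^sup>2 * ((of_int p / of_int q - r) * (of_int p / of_int q + r))"
      using q r by (simp add: nrm_def field_simps power2_eq_square)
    hence "\<bar>of_int (nrm (p,q))\<bar> = (of_int q)\<^sup>2 * (\<bar>r - of_int p / of_int q\<bar> * \<bar>of_int p / of_int q + r\<bar>)"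
      by (simp add: abs_mult abs_minus_commute)
    also have "\<dots> \<le> (of_int q)\<^sup>2 * (1 / (of_int q)\<^sup>2 * (2 * r + 1))"
      using pq abs_triangle_ineq[of "of_int p / real_of_int q" r]
        \<open>\<bar>of_int p / real_of_int q\<bar> \<le> r + 1\<close> r(1)
      by (intro mult_left_mono mult_mono) (auto simp del: abs_divide)
    also have "\<dots> = 2 * r + 1" using q by simp
    finally have "\<bar>nrm (p, q)\<bar> \<le> M" unfolding M_def by linarith
    moreover have "nrm (p, q) \<noteq> 0"
    proof
      assume "nrm (p, q) = 0"
      hence "real_of_int (p\<^sup>2) = of_int (D * q\<^sup>2)" by (simp add: nrm_def)
      hence "(real_of_int p)\<^sup>2 = (of_int q * r)\<^sup>2" using r by (simp add: power_mult_distrib)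
      hence "real_of_int p = of_int q * r"
        using p q r by (subst (asm) power2_eq_iff_nonneg) auto
      hence "of_int p + of_int (-q) * sqrt (of_int D) = 0" by (simp add: r_def)
      from sqrt_lin_indep(2)[OF D this] q show False by simp
    qed
    ultimately show ?thesis using p q by auto
  qed
  have "g ` S \<subseteq> {-M..M} \<times> {0..M} \<times> {0..M}"
  proof
    fix y assume "y \<in> g ` S"
    then obtain p q where pq: "(p, q) \<in> S" "y = g (p, q)" by auto
    from S[OF pq(1)] have "\<bar>nrm (p, q)\<bar> > 0" "\<bar>nrm (p, q)\<bar> \<le> M" by auto
    moreover from this have "p mod \<bar>nrm (p, q)\<bar> \<le> M" "q mod \<bar>nrm (p, q)\<bar> \<le> M"
      by (meson less_imp_le order.trans pos_mod_bound)+
    ultimately show "y \<in> {-M..M} \<times> {0..M} \<times> {0..M}"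
      by (auto simp: g_def pq(2))
  qed
  hence "finite (g ` S)" by (rule finite_subset) auto
  from pigeonhole_infinite[OF inf this] obtain x0 where T: "infinite {a \<in> S. g a = g x0}" by blast
  from infinite_imp_nonempty[OF T] obtain x1 where x1: "x1 \<in> S" "g x1 = g x0" by blast
  have "infinite ({a \<in> S. g a = g x0} - {x1})" using T by simp
  from infinite_imp_nonempty[OF this] obtain x2 where x2: "x2 \<in> S" "g x2 = g x0" "x2 \<noteq> x1" by blast
  define val where "val = (\<lambda>(p::int,q::int). of_int p + of_int q * r)"
  have unit: "in_OD D (val x / val y)"
    if xy: "x \<in> S" "y \<in> S" "g x = g y" for x y
  proof -
    obtain a b where x: "x = (a, b)" by force
    obtain c d where y: "y = (c, d)" by force
    define k where "k = nrm (a, b)"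
    have k: "nrm (c, d) = k" and "a mod \<bar>k\<bar> = c mod \<bar>k\<bar>" "b mod \<bar>k\<bar> = d mod \<bar>k\<bar>"
      using xy(3) by (auto simp: x y g_def k_def)
    hence dvd: "k dvd a - c" "k dvd b - d"
      by (simp_all add: mod_eq_dvd_iff)
    have k0: "k \<noteq> 0" using S xy(1) by (auto simp: x k_def)
    \<comment> \<open>The coordinates of (a + b r)(c - d r), the numerator of the quotient. Modulo k
      the pair (c, d) may be replaced by (a, b), so they are congruent to the norm of (a, b), which
      is k, and to 0.\<close>
    have "a * c - D * (b * d) = k - a * (a - c) + D * b * (b - d)"
      by (simp add: k_def nrm_def algebra_simps power2_eq_square)
    hence "k dvd a * c - D * (b * d)" using dvd by simp
    then obtain e where e: "a * c - D * (b * d) = k * e" by (elim dvdE)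
    have "b * c - a * d = a * (b - d) - b * (a - c)" by (simp add: algebra_simps)
    hence "k dvd b * c - a * d" using dvd by simp
    then obtain f where f: "b * c - a * d = k * f" by (elim dvdE)
    have pos: "val y > 0" using S[of c d] xy y r(1) by (auto simp: val_def intro!: add_pos_pos)
    have kk: "(of_int c - of_int d * r) * (of_int c + of_int d * r) = of_int k"
      using r(2) unfolding k[symmetric] by (simp add: nrm_def algebra_simps power2_eq_square)
    have "of_int k * (of_int e + of_int f * r) = of_int (a * c - D * (b * d)) + of_int (b * c - a * d) * r"
      by (simp add: e f algebra_simps)
    also have "\<dots> = (of_int a + of_int b * r) * (of_int c - of_int d * r)"
      using r(2) by (simp add: algebra_simps power2_eq_square)
    finally have "of_int k * (of_int e + of_int f * r) * val y = of_int k * val x"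
      using kk by (simp add: val_def x y mult.assoc)
    hence "(of_int e + of_int f * r) * val y = val x" using k0 by (simp only: mult.assoc) simp
    hence "val x / val y = of_int e + of_int f * r" using pos by (simp add: field_simps)
    thus ?thesis using in_OD_sqrt[of D e f] by (simp add: r_def)
  qed
  have vpos: "val x > 0" if "x \<in> S" for x
    using S[of "fst x" "snd x"] that r(1) by (auto simp: val_def case_prod_unfold intro!: add_pos_pos)
  have "val x1 \<noteq> val x2"
  proof
    assume "val x1 = val x2"
    hence "of_int (fst x1 - fst x2) + of_int (snd x1 - snd x2) * sqrt (of_int D) = 0"
      by (simp add: val_def case_prod_unfold r_def algebra_simps)
    from sqrt_lin_indep[OF D this] x2(3) show False by (simp add: prod_eq_iff)
  qed
  moreover have "OD_unit D (val x1 / val x2)" "OD_unit D (val x2 / val x1)"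
    using unit[of x1 x2] unit[of x2 x1] x1 x2 vpos[of x1] vpos[of x2]
    by (auto simp: OD_unit_def)
  moreover have "val x1 / val x2 > 1 \<or> val x2 / val x1 > 1"
    using calculation(1) vpos[OF x1(1)] vpos[OF x2(1)] by auto
  ultimately show ?thesis by blast
qed

text \<open>The content is that the description defining \<open>fund_unit\<close> denotes. A unit in
  (1, B] has norm 1 or -1, so its conjugate is at most 1 in absolute value; this bounds both integer
  coordinates. Hence only finitely many units lie in (1, B], and a least one exists.\<close>

lemma fund_unit_gt_1:
  fixes D :: int
  assumes D: "D > 1" "squarefree D"
  shows "fund_unit D > 1"
proof -
  define r where "r = sqrt (real_of_int D)"
  have r: "r > 1" "r\<^sup>2 = of_int D" using D by (auto simp: r_def)
  define w where "w = omegaD D"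
  define w' where "w' = omegaD_conj D"
  have ww': "w - w' \<ge> 1" using r by (auto simp: w_def w'_def omegaD_def omegaD_conj_def r_def[symmetric] field_simps)
  obtain t n :: int where tn: "w + w' = of_int t" "w * w' = of_int n"
  proof (cases "D mod 4 = 1")
    case True
    hence "4 dvd (1 - D)" by presburger
    then obtain n where n: "1 - D = 4 * n" by (elim dvdE)
    have "of_int (1 - D) = (4 * of_int n :: real)" by (simp add: n)
    hence "w * w' = of_int n"
      using True r(2) by (simp add: w_def w'_def omegaD_def omegaD_conj_def r_def[symmetric] field_simps power2_eq_square)
    moreover have "w + w' = of_int 1"
      using True by (simp add: w_def w'_def omegaD_def omegaD_conj_def field_simps)
    ultimately show ?thesis using that by blast
  next
    case False
    thus ?thesis using that[of 0 "-D"] r(2)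
      by (simp add: w_def w'_def omegaD_def omegaD_conj_def r_def[symmetric] power2_eq_square)
  qed
  have indep: "a = 0 \<and> b = 0" if "of_int a + of_int b * w = 0" for a b :: int
  proof (cases "D mod 4 = 1")
    case True
    have "of_int (2 * a + b) + of_int b * sqrt (of_int D) = 2 * (of_int a + of_int b * w)"
      using True by (simp add: w_def omegaD_def field_simps)
    also have "\<dots> = 0" using that by simp
    finally have "of_int (2 * a + b) + of_int b * sqrt (of_int D) = (0::real)" .
    from sqrt_lin_indep[OF D this] show ?thesis by simp
  next
    case False
    thus ?thesis using that sqrt_lin_indep[OF D, of a b] by (simp add: w_def omegaD_def)
  qed
  have sq: "w\<^sup>2 = of_int t * w - of_int n" "w'\<^sup>2 = of_int t * w' - of_int n"
    by (simp_all flip: tn add: algebra_simps power2_eq_square)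
  define U where "U = {u. OD_unit D u \<and> 1 < u}"
  have fin: "finite (U \<inter> {..B})" for B
  proof -
    define K where "K = \<lceil>B + 1\<rceil>"
    define K' where "K' = \<lceil>B + of_int K * \<bar>w\<bar>\<rceil>"
    have "U \<inter> {..B} \<subseteq> (\<lambda>(a,b). of_int a + of_int b * w) ` ({-K'..K'} \<times> {-K..K})"
    proof
      fix u assume u: "u \<in> U \<inter> {..B}"
      then obtain a b c d where ab: "u = of_int a + of_int b * w" and cd: "1 / u = of_int c + of_int d * w"
        by (auto simp: U_def OD_unit_def in_OD_def w_def)
      from u have u1: "u > 1" "u \<le> B" by (auto simp: U_def)
      \<comment> \<open>The conjugates are formed from the chosen coordinates, without the
        description \<open>OD_conj\<close>. That they multiply to 1 follows from the quadratic
        equation shared by \<open>w\<close> and \<open>w'\<close> and the independence of 1 and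
        \<open>w\<close>.\<close>
      define u' where "u' = of_int a + of_int b * w'"
      define v' where "v' = of_int c + of_int d * w'"
      have "(of_int a + of_int b * w) * (of_int c + of_int d * w) = 1"
        using u1 by (simp flip: ab cd)
      moreover have "(of_int a + of_int b * w) * (of_int c + of_int d * w) =
          of_int (a * c - b * d * n) + of_int (a * d + b * c + b * d * t) * w"
        using sq(1) unfolding of_int_add of_int_diff of_int_mult by algebra
      ultimately have "of_int (a * c - b * d * n - 1) + of_int (a * d + b * c + b * d * t) * w = 0"
        by simp
      from indep[OF this] have z: "a * c - b * d * n = 1" "a * d + b * c + b * d * t = 0" by auto
      have "u' * v' = of_int (a * c - b * d * n) + of_int (a * d + b * c + b * d * t) * w'"
        using sq(2) unfolding u'_def v'_def of_int_add of_int_diff of_int_mult by algebra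
      hence uv': "u' * v' = 1" unfolding z by simp
      define N1 where "N1 = a * a + a * b * t + b * b * n"
      define N2 where "N2 = c * c + c * d * t + d * d * n"
      have "u * u' = of_int N1" unfolding ab u'_def N1_def
        unfolding of_int_add of_int_mult tn[symmetric] by (simp add: algebra_simps)
      moreover have "(1 / u) * v' = of_int N2" unfolding cd v'_def N2_def
        unfolding of_int_add of_int_mult tn[symmetric] by (simp add: algebra_simps)
      ultimately have "of_int (N1 * N2) = (u * u') * ((1 / u) * v')" by (simp only: of_int_mult)
      also have "\<dots> = (u * (1 / u)) * (u' * v')" by (simp only: mult_ac)
      also have "\<dots> = 1" using uv' u1 by simp
      finally have "N1 * N2 = 1" by linarith
      hence "\<bar>N1\<bar> = 1" by (auto simp: zmult_eq_1_iff)
      hence "\<bar>u * u'\<bar> = 1" using \<open>u * u' = of_int N1\<close> by simp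
      hence "\<bar>u'\<bar> * u = 1" using u1 by (simp add: abs_mult mult.commute)
      hence "\<bar>u'\<bar> = 1 / u" using u1 by (simp add: field_simps)
      hence u'1: "\<bar>u'\<bar> \<le> 1" using u1 by simp
      \<comment> \<open>Subtracting the conjugate isolates b, and w - w' >= 1 turns a bound on u -
        u' into one on b.\<close>
      have "of_int b * (w - w') = u - u'" by (simp add: ab u'_def algebra_simps)
      moreover have "\<bar>real_of_int b\<bar> * (w - w') = \<bar>of_int b * (w - w')\<bar>" using ww' by (simp add: abs_mult)
      ultimately have "\<bar>real_of_int b\<bar> * (w - w') = \<bar>u - u'\<bar>" by simp
      also have "\<dots> \<le> B + 1" using u1 u'1 by linarith
      finally have "\<bar>real_of_int b\<bar> \<le> B + 1" using mult_left_mono[OF ww', of "\<bar>real_of_int b\<bar>"] by simp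
      hence b: "\<bar>b\<bar> \<le> K" unfolding K_def by linarith
      have "\<bar>real_of_int a\<bar> = \<bar>u - of_int b * w\<bar>" by (simp add: ab)
      also have "\<dots> \<le> B + \<bar>of_int b\<bar> * \<bar>w\<bar>" using u1 abs_triangle_ineq4[of u "of_int b * w"] by (simp add: abs_mult)
      also have "\<dots> \<le> B + of_int K * \<bar>w\<bar>" using b by (intro add_left_mono mult_right_mono) linarith+
      finally have "\<bar>a\<bar> \<le> K'" unfolding K'_def by linarith
      thus "u \<in> (\<lambda>(a,b). of_int a + of_int b * w) ` ({-K'..K'} \<times> {-K..K})"
        using ab b by (intro image_eqI[of _ _ "(a, b)"]) (auto simp: abs_le_iff)
    qed
    thus ?thesis by (rule finite_subset) auto
  qed
  obtain u0 where u0: "u0 \<in> U" using ex_OD_unit_gt_1[OF D] by (auto simp: U_def)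
  define e where "e = Min (U \<inter> {..u0})"
  have "e \<in> U \<inter> {..u0}" unfolding e_def using u0 by (intro Min_in fin) auto
  moreover have "e \<le> u" if "u \<in> U" for u
  proof (cases "u \<le> u0")
    case True
    thus ?thesis unfolding e_def using that by (intro Min_le fin) auto
  next
    case False
    have "e \<le> u0" using calculation by simp
    thus ?thesis using False by linarith
  qed
  ultimately have e: "1 < e \<and> OD_unit D e \<and> (\<forall>u. OD_unit D u \<and> 1 < u \<longrightarrow> e \<le> u)"
    by (auto simp: U_def)
  have "1 < fund_unit D \<and> OD_unit D (fund_unit D) \<and> (\<forall>u. OD_unit D u \<and> 1 < u \<longrightarrow> fund_unit D \<le> u)"
    unfolding fund_unit_def by (rule theI, rule e) (use e in \<open>auto intro: antisym\<close>)
  thus ?thesis by blast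
qed

section \<open>Partial fractions of the cotangent\<close>

text \<open>The logarithmic derivative of the reflection formula gives Digamma(1-z) - Digamma(z) =
  pi cot(pi z), and the limit formula for Digamma turns the left side into the series.\<close>

lemma cot_pfd_complex:
  fixes z :: complex
  assumes z: "z \<notin> \<int>"
  shows "(\<lambda>n. 2 * z / (z\<^sup>2 - of_nat (Suc n) ^ 2)) sums (pi * cot (pi * z) - 1 / z)"
proof -
  have nz: "z + of_nat n \<noteq> 0" "1 - z + of_nat n \<noteq> 0" for n
  proof -
    show "z + of_nat n \<noteq> 0"
    proof
      assume "z + of_nat n = 0"
      hence "z = - of_nat n" by (simp add: add_eq_0_iff2)
      thus False using z by auto
    qed
    show "1 - z + of_nat n \<noteq> 0"
    proof
      assume "1 - z + of_nat n = 0"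
      hence "z = of_nat (Suc n)" by (simp add: algebra_simps)
      thus False using z by auto
    qed
  qed
  have z0: "z \<noteq> 0" "1 - z \<noteq> 0" using nz[of 0] by auto
  have nonpos: "z \<notin> \<int>\<^sub>\<le>\<^sub>0" "1 - z \<notin> \<int>\<^sub>\<le>\<^sub>0"
    using z Ints_diff[of 1 "1 - z"] by (auto dest: nonpos_Ints_Int)
  have sin0: "sin (of_real pi * z) \<noteq> 0" using z by (auto simp: sin_eq_0 Ints_def mult.commute)
  have "((\<lambda>z. Gamma z * Gamma (1 - z)) has_field_derivative
      Gamma z * Gamma (1 - z) * (Digamma z - Digamma (1 - z))) (at z)"
    using nonpos by (auto intro!: derivative_eq_intros simp: algebra_simps)
  moreover have "((\<lambda>z. of_real pi / sin (of_real pi * z)) has_field_derivative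
      - (of_real pi / sin (of_real pi * z)) * (of_real pi * cot (of_real pi * z))) (at z)"
    using sin0 by (auto intro!: derivative_eq_intros simp: cot_def field_simps)
  ultimately have "Gamma z * Gamma (1 - z) * (Digamma z - Digamma (1 - z)) =
      - (of_real pi / sin (of_real pi * z)) * (of_real pi * cot (of_real pi * z))"
    unfolding Gamma_reflection_complex by (rule DERIV_unique)
  moreover have "of_real pi / sin (of_real pi * z) \<noteq> 0" using sin0 by simp
  moreover have "A * (X + C) = 0" if "A * X = - A * C" for A X C :: complex
    using that by (simp add: algebra_simps)
  ultimately have "Digamma z - Digamma (1 - z) + of_real pi * cot (of_real pi * z) = 0"
    unfolding Gamma_reflection_complex using mult_eq_0_iff by blast
  hence Dig: "Digamma (1 - z) - Digamma z = of_real pi * cot (of_real pi * z)"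
    by (simp add: algebra_simps)
  have lim0: "(\<lambda>m. inverse (z + of_nat m)) \<longlonglongrightarrow> 0"
    by (intro filterlim_compose[OF tendsto_inverse_0] tendsto_add_filterlim_at_infinity[OF tendsto_const] tendsto_of_nat)
  \<comment> \<open>The extra summand 1/(z+m) - 1/z shifts the range of the sum of 1/(z+n) from
    0..m-1 to 1..m, so that z+n+1 is paired with n+1-z.\<close>
  have "(\<lambda>m. (of_real (ln (real m)) - (\<Sum>n<m. inverse (1 - z + of_nat n)))
      - (of_real (ln (real m)) - (\<Sum>n<m. inverse (z + of_nat n))) + (inverse (z + of_nat m) - 1 / z))
      \<longlonglongrightarrow> Digamma (1 - z) - Digamma z + (0 - 1 / z)"
    by (intro tendsto_intros Digamma_LIMSEQ z0 lim0)
  moreover have "(of_real (ln (real m)) - (\<Sum>n<m. inverse (1 - z + of_nat n)))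
      - (of_real (ln (real m)) - (\<Sum>n<m. inverse (z + of_nat n))) + (inverse (z + of_nat m) - 1 / z)
      = (\<Sum>n<m. 2 * z / (z\<^sup>2 - of_nat (Suc n) ^ 2))" for m
  proof (induction m)
    case (Suc m)
    have "2 * z / (z\<^sup>2 - of_nat (Suc m) ^ 2) = inverse (z + of_nat (Suc m)) - inverse (1 - z + of_nat m)"
    proof -
      define a b where "a = z + of_nat (Suc m)" and "b = 1 - z + of_nat m"
      have "z\<^sup>2 - of_nat (Suc m) ^ 2 = - (a * b)" "2 * z = a - b"
        by (simp_all add: a_def b_def power2_eq_square algebra_simps)
      moreover have "a \<noteq> 0" "b \<noteq> 0" using nz[of "Suc m"] nz(2)[of m] by (simp_all add: a_def b_def)
      hence "(a - b) / - (a * b) = inverse a - inverse b" by (simp add: field_simps)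
      ultimately show ?thesis by (simp only: a_def b_def)
    qed
    thus ?case unfolding sum.lessThan_Suc Suc[symmetric] by (simp del: of_nat_Suc)
  qed (simp add: inverse_eq_divide)
  ultimately show ?thesis unfolding sums_def Dig by simp
qed

text \<open>At z = iw/(2 pi) the cotangent becomes hyperbolic, and coth(w/2)/2 = 1/(exp w - 1) +
  1/2. The constant 1/2 and the polar term 1/w stay in the statement and are disposed of after
  summation over k.\<close>

lemma inverse_exp_minus_1_pfd:
  fixes w :: real
  assumes w: "w \<noteq> 0"
  shows "(\<lambda>n. 2 * w / (w\<^sup>2 + 4 * pi\<^sup>2 * real (Suc n) ^ 2)) sums (1 / (exp w - 1) + 1 / 2 - 1 / w)"
proof -
  define z where "z = \<i> * of_real (w / (2 * pi))"
  have "z \<notin> \<int>" using w by (auto simp: z_def complex_is_Int_iff)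
  from cot_pfd_complex[OF this]
  have "(\<lambda>n. 2 * z / (z\<^sup>2 - of_nat (Suc n) ^ 2)) sums (pi * cot (pi * z) - 1 / z)" .
  from sums_mult[OF this, of "\<i> / (2 * of_real pi)"]
  have sums: "(\<lambda>n. \<i> / (2 * of_real pi) * (2 * z / (z\<^sup>2 - of_nat (Suc n) ^ 2))) sums
    (\<i> / (2 * of_real pi) * (pi * cot (pi * z) - 1 / z))" .
  have 1: "\<i> / (2 * of_real pi) * (2 * z / (z\<^sup>2 - of_nat (Suc n) ^ 2)) =
     of_real (2 * w / (w\<^sup>2 + 4 * pi\<^sup>2 * real (Suc n) ^ 2))" for n
  proof -
    have "(w\<^sup>2 + 4 * pi\<^sup>2 * real (Suc n) ^ 2) > 0" by (intro add_nonneg_pos) (auto simp del: of_nat_Suc)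
    hence nz: "of_real (w\<^sup>2 + 4 * pi\<^sup>2 * real (Suc n) ^ 2) \<noteq> (0::complex)" by (subst of_real_eq_0_iff) simp
    have "z\<^sup>2 - of_nat (Suc n) ^ 2 = - of_real (w\<^sup>2 + 4 * pi\<^sup>2 * real (Suc n) ^ 2) / (4 * of_real (pi\<^sup>2))"
      by (simp add: z_def power_mult_distrib field_simps power2_eq_square del: of_nat_Suc)
    thus ?thesis using nz by (simp add: z_def divide_simps del: of_nat_Suc of_real_add) (simp add: power2_eq_square)
  qed
  have 2: "\<i> / (2 * of_real pi) * (pi * cot (pi * z) - 1 / z) = of_real (1 / (exp w - 1) + 1 / 2 - 1 / w)"
  proof -
    define e where "e = exp (w / 2)"
    have e: "e > 0" "e\<^sup>2 \<noteq> 1" "exp w = e\<^sup>2" "inverse e = exp (- w / 2)"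
      using w by (auto simp: e_def simp flip: exp_double exp_minus)
    have pz: "of_real pi * z = \<i> * of_real (w / 2)" by (simp add: z_def)
    have E: "exp (\<i> * (of_real pi * z)) = of_real (inverse e)" "exp (- (\<i> * (of_real pi * z))) = of_real e"
      unfolding pz e by (simp_all add: e_def exp_of_real[symmetric])
    define X where "X = (inverse e + e) / (inverse e - e)"
    have cot: "cot (of_real pi * z) = \<i> * of_real X"
      unfolding cot_def cos_exp_eq sin_exp_eq E X_def
      using e by (simp add: divide_simps)
    have "\<i> / (2 * of_real pi) * (pi * cot (pi * z) - 1 / z) = of_real (- X / 2 - 1 / w)"
      unfolding cot using w by (simp add: z_def field_simps)
    also have "- X / 2 = 1 / (exp w - 1) + 1 / 2"
    proof -
      have "inverse e - e = (1 - e\<^sup>2) / e" "inverse e + e = (1 + e\<^sup>2) / e"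
        using e by (simp_all add: field_simps power2_eq_square)
      thus ?thesis using e by (simp add: X_def divide_simps) (simp add: algebra_simps)
    qed
    finally show ?thesis by simp
  qed
  show ?thesis using sums unfolding 1 2 sums_of_real_iff .
qed

section \<open>Asymptotics of Gamma quotients\<close>

text \<open>The function is odd, so no quadratic term occurs: its derivative is 2z^2/(1 - z^2), at
  most 3|w|^2 on the disc of radius |w|. The cubic bound is what makes the error in the Gamma
  quotient of order 1/y^2.\<close>

lemma norm_Ln_diff_cubic:
  fixes w :: complex
  assumes "norm w \<le> 1/2"
  shows "norm (Ln (1 + w) - Ln (1 - w) - 2 * w) \<le> 3 * norm w ^ 3"
proof -
  let ?f = "\<lambda>w. Ln (1 + w) - Ln (1 - w) - 2 * w"
  have "norm (?f w - ?f 0) \<le> (3 * norm w ^ 2) * norm (w - 0)"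
  proof (rule field_differentiable_bound[where S = "cball 0 (norm w)"
        and f' = "\<lambda>w. 1 / (1 + w) + 1 / (1 - w) - 2"])
    fix z :: complex assume "z \<in> cball 0 (norm w)"
    hence z: "norm z \<le> norm w" "norm z \<le> 1/2" using assms by auto
    have Re: "Re (1 + z) > 0" "Re (1 - z) > 0"
      using abs_Re_le_cmod[of z] z by auto
    hence "1 + z \<notin> \<real>\<^sub>\<le>\<^sub>0" "1 - z \<notin> \<real>\<^sub>\<le>\<^sub>0"
      by (auto simp: complex_nonpos_Reals_iff)
    thus "(?f has_field_derivative 1 / (1 + z) + 1 / (1 - z) - 2) (at z within cball 0 (norm w))"
      by (auto intro!: derivative_eq_intros simp: divide_simps)
    have nz: "1 + z \<noteq> 0" "1 - z \<noteq> 0"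
      using Re by (auto simp: complex_eq_iff)
    have sq: "1 - z\<^sup>2 = (1 + z) * (1 - z)" by (simp add: power2_eq_square algebra_simps)
    have "1 / (1 + z) + 1 / (1 - z) - 2 = 2 * z\<^sup>2 / (1 - z\<^sup>2)"
      using nz unfolding sq by (simp add: divide_simps) (simp add: power2_eq_square algebra_simps)
    also have "norm \<dots> = 2 * norm z ^ 2 / norm (1 - z\<^sup>2)" by (simp add: norm_divide norm_mult norm_power)
    also have "\<dots> \<le> 2 * norm w ^ 2 / (3 / 4)"
    proof (intro frac_le mult_left_mono power_mono z)
      have "norm (z\<^sup>2) \<le> (1/2)\<^sup>2" unfolding norm_power using z by (intro power_mono) auto
      thus "3 / 4 \<le> norm (1 - z\<^sup>2)" using norm_triangle_ineq2[of 1 "z\<^sup>2"] by (simp add: power2_eq_square)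
    qed auto
    also have "\<dots> \<le> 3 * norm w ^ 2" by simp
    finally show "norm (1 / (1 + z) + 1 / (1 - z) - 2) \<le> 3 * norm w ^ 2" .
  qed auto
  thus ?thesis by (simp add: power2_eq_square power3_eq_cube mult.assoc)
qed

lemma norm_exp_minus_1_le:
  fixes z :: complex
  assumes "norm z \<le> 1"
  shows "norm (exp z - 1) \<le> 3 * norm z"
proof -
  have "norm (exp z - exp 0) \<le> 3 * norm (z - 0)"
  proof (rule field_differentiable_bound[where S = "cball 0 1" and f' = exp])
    fix w :: complex assume "w \<in> cball 0 1"
    hence "norm (exp w) \<le> exp 1" using complex_Re_le_cmod[of w] by simp
    thus "norm (exp w) \<le> 3" by (rule order.trans[OF _ exp_le])
  qed (use assms in \<open>auto intro!: derivative_eq_intros\<close>)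
  thus ?thesis by simp
qed

text \<open>For b = (s-1)/2 the two arguments are s/2 - iy and 1 - s/2 - iy. The product of
  \<open>Gamma_series\<close> and \<open>rGamma_series\<close> is written as the exponential of a
  finite sum, up to a factor tending to 1. The summands are O(1/|v_j|^3) uniformly for |b| <= R, so
  the sums stay O(1/y^2) in the limit.\<close>

lemma Gamma_ratio_asymp:
  fixes R :: real
  assumes R: "R \<ge> 1"
  shows "\<exists>C>0. \<exists>Y\<ge>1. \<forall>(b::complex) (y::real). norm b \<le> R \<longrightarrow> \<bar>y\<bar> \<ge> Y \<longrightarrow>
    norm (Gamma (1/2 + b - \<i> * of_real y) * rGamma (1/2 - b - \<i> * of_real y)
       * exp (- 2 * b * Ln (- \<i> * of_real y)) - 1) \<le> C / y\<^sup>2"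
proof -
  \<comment> \<open>64 = 4 * 16: each \<open>u j\<close> contributes 4 R^3, and the sum of
    |v_j|^(-3) is at most 16/y^2. As threshold for |y| the same K ensures K/y^2 <= 1, the range of
    \<open>norm_exp_minus_1_le\<close>.\<close>
  define K where "K = 64 * R ^ 3"
  have R3: "R \<le> R ^ 3" using R self_le_power[of R 3] by simp
  have K: "K \<ge> 64" using R3 R by (simp add: K_def)
  have main: "norm (Gamma (1/2 + b - \<i> * of_real y) * rGamma (1/2 - b - \<i> * of_real y)
       * exp (- 2 * b * Ln (- \<i> * of_real y)) - 1) \<le> 3 * K / y\<^sup>2"
    if b: "norm b \<le> R" and y: "\<bar>y\<bar> \<ge> K" for b y
  proof -
    define q :: complex where "q = - \<i> * of_real y"
    have y1: "\<bar>y\<bar> \<ge> 64" "\<bar>y\<bar> \<ge> 2 * R" using y K R R3 by (auto simp: K_def)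
    \<comment> \<open>The midpoint of q+j and q+j+1. With it the two rising factorials have the
      factors v_j + b and v_j - b, and the increments of Ln(q+j) also take the odd form Ln(1+x) -
      Ln(1-x), so one cubic bound serves for both.\<close>
    define v where "v = (\<lambda>j::nat. q + of_nat j + 1/2)"
    have Re_v: "Re (v j) = j + 1/2" and Im_v: "Im (v j) = -y" for j by (auto simp: v_def q_def)
    have v_y: "norm (v j) \<ge> \<bar>y\<bar>" for j using abs_Im_le_cmod[of "v j"] by (simp add: Im_v)
    have v0: "v j \<noteq> 0" for j using v_y[of j] y1 by auto
    have v_lower: "norm (v j) \<ge> (real j + 1/2 + \<bar>y\<bar>) / 2" for j
      using abs_Im_le_cmod[of "v j"] abs_Re_le_cmod[of "v j"] unfolding Re_v Im_v by simp
    define u where "u = (\<lambda>j. Ln (1 - b / v j) - Ln (1 + b / v j)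
       + 2 * b * (Ln (1 + 1 / (2 * v j)) - Ln (1 - 1 / (2 * v j))))"
    have small1: "norm (b / v j) \<le> 1/2" for j
      using v_y[of j] y1 b by (simp add: norm_divide divide_simps)
    have small2: "norm (1 / (2 * v j)) \<le> 1/2" for j
      using v_y[of j] y1 by (simp add: norm_divide norm_mult divide_simps)
    have u_bound: "norm (u j) \<le> 4 * R ^ 3 / norm (v j) ^ 3" for j
    proof -
      define \<beta> where "\<beta> = b / v j"
      define \<delta> where "\<delta> = 1 / (2 * v j)"
      have "u j = - (Ln (1 + \<beta>) - Ln (1 - \<beta>) - 2 * \<beta>) + 2 * b * (Ln (1 + \<delta>) - Ln (1 - \<delta>) - 2 * \<delta>)"
        using v0[of j] by (simp add: u_def \<beta>_def \<delta>_def field_simps)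
      also have "norm \<dots> \<le> norm (Ln (1 + \<beta>) - Ln (1 - \<beta>) - 2 * \<beta>)
          + 2 * norm b * norm (Ln (1 + \<delta>) - Ln (1 - \<delta>) - 2 * \<delta>)"
        by (rule order.trans[OF norm_triangle_ineq]) (simp add: norm_mult norm_minus_commute)
      also have "\<dots> \<le> 3 * norm \<beta> ^ 3 + 2 * R * (3 * norm \<delta> ^ 3)"
        using small1[of j] small2[of j] b R unfolding \<beta>_def[symmetric] \<delta>_def[symmetric]
        by (intro add_mono mult_mono norm_Ln_diff_cubic) auto
      also have "\<dots> = (3 * norm b ^ 3 + 3 / 4 * R) / norm (v j) ^ 3"
        using v0[of j] by (simp add: \<beta>_def \<delta>_def norm_divide norm_mult field_simps)
      also have "\<dots> \<le> 4 * R ^ 3 / norm (v j) ^ 3"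
      proof (rule divide_right_mono)
        have "norm b ^ 3 \<le> R ^ 3" by (intro power_mono b) auto
        thus "3 * norm b ^ 3 + 3 / 4 * R \<le> 4 * R ^ 3" using R3 R by linarith
      qed auto
      finally show ?thesis .
    qed
    \<comment> \<open>With x = j + 1/2 + |y|, the estimate x^3 >= |y| (x-1) x gives a telescoping
      bound and keeps one factor 1/|y| in front.\<close>
    have inv_v: "1 / norm (v j) ^ 3 \<le> 8 / \<bar>y\<bar> * (1 / (real j - 1/2 + \<bar>y\<bar>) - 1 / (real (Suc j) - 1/2 + \<bar>y\<bar>))" for j
    proof -
      define x where "x = real j + 1/2 + \<bar>y\<bar>"
      have x: "x \<ge> \<bar>y\<bar>" "x > 1" using y1 by (auto simp: x_def)
      have "1 / norm (v j) ^ 3 \<le> 1 / (x / 2) ^ 3"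
        using v_lower[of j] x by (intro frac_le power_mono) (auto simp: x_def)
      also have "\<dots> = 8 / (x * (x * x))" by (simp add: field_simps power3_eq_cube)
      also have "\<dots> \<le> 8 / (\<bar>y\<bar> * ((x - 1) * x))"
        using x y1 by (intro divide_left_mono mult_mono) auto
      also have "\<dots> = 8 / \<bar>y\<bar> * (1 / (x - 1) - 1 / x)" using x y1 by (simp add: field_simps)
      finally show ?thesis by (simp add: x_def algebra_simps)
    qed
    have sum_inv: "(\<Sum>j<N. 1 / norm (v j) ^ 3) \<le> 16 / y\<^sup>2" for N
    proof -
      have "(\<Sum>j<N. 1 / norm (v j) ^ 3) \<le> (\<Sum>j<N. 8 / \<bar>y\<bar> * (1 / (real j - 1/2 + \<bar>y\<bar>) - 1 / (real (Suc j) - 1/2 + \<bar>y\<bar>)))"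
        by (intro sum_mono inv_v)
      also have "\<dots> = 8 / \<bar>y\<bar> * (1 / (real 0 - 1/2 + \<bar>y\<bar>) - 1 / (real N - 1/2 + \<bar>y\<bar>))"
        unfolding sum_distrib_left[symmetric] by (subst sum_lessThan_telescope') simp
      also have "\<dots> \<le> 8 / \<bar>y\<bar> * (1 / (\<bar>y\<bar> / 2))"
      proof (rule mult_left_mono)
        have "1 / (real 0 - 1/2 + \<bar>y\<bar>) \<le> 1 / (\<bar>y\<bar> / 2)" using y1 by (intro frac_le) auto
        moreover have "1 / (real N - 1/2 + \<bar>y\<bar>) \<ge> 0" using y1 by simp
        ultimately show "1 / (real 0 - 1/2 + \<bar>y\<bar>) - 1 / (real N - 1/2 + \<bar>y\<bar>) \<le> 1 / (\<bar>y\<bar> / 2)"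
          by linarith
      qed auto
      also have "\<dots> = 16 / y\<^sup>2" using y1 by (simp add: power2_eq_square field_simps)
      finally show ?thesis .
    qed
    have Ksmall: "K / y\<^sup>2 \<le> 1"
    proof -
      have "K * 1 \<le> \<bar>y\<bar> * \<bar>y\<bar>" using y y1 K by (intro mult_mono) auto
      thus ?thesis using y1 by (simp add: power2_eq_square divide_simps)
    qed
    have sum_u: "norm (\<Sum>j<N. u j) \<le> K / y\<^sup>2" for N
    proof -
      have "norm (\<Sum>j<N. u j) \<le> (\<Sum>j<N. 4 * R ^ 3 * (1 / norm (v j) ^ 3))"
        using u_bound by (intro sum_norm_le) auto
      also have "\<dots> \<le> 4 * R ^ 3 * (16 / y\<^sup>2)" unfolding sum_distrib_left[symmetric]
        using R by (intro mult_left_mono sum_inv) auto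
      finally show ?thesis by (simp add: K_def)
    qed
    \<comment> \<open>The numbers v_j, 1+d and 1-d lie in the right half plane, so their arguments
      are below pi/2 in size and the principal logarithms add without a branch correction.\<close>
    have Lnv: "Ln (1 + 1 / (2 * v j)) - Ln (1 - 1 / (2 * v j)) = Ln (q + of_nat (Suc j)) - Ln (q + of_nat j)" for j
    proof -
      define d where "d = 1 / (2 * v j)"
      have Re: "Re (1 + d) > 0" "Re (1 - d) > 0"
        using abs_Re_le_cmod[of d] small2[of j] unfolding d_def[symmetric] by auto
      have nz: "1 + d \<noteq> 0" "1 - d \<noteq> 0" using Re by (auto simp: complex_eq_iff)
      have L: "\<bar>Im (Ln (v j))\<bar> < pi / 2" "\<bar>Im (Ln (1 + d))\<bar> < pi / 2" "\<bar>Im (Ln (1 - d))\<bar> < pi / 2"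
        using Re Re_v[of j] nz v0[of j] by (subst Re_Ln_pos_lt; simp)+
      have "Ln (v j * (1 + d)) = Ln (v j) + Ln (1 + d)" "Ln (v j * (1 - d)) = Ln (v j) + Ln (1 - d)"
        using L nz v0[of j] by (auto intro!: Ln_times_simple)
      moreover have vd: "v j * d = 1/2" using v0[of j] by (simp add: d_def)
      have "v j * (1 + d) = q + of_nat (Suc j)" "v j * (1 - d) = q + of_nat j"
        unfolding distrib_left right_diff_distrib vd by (simp_all add: v_def)
      ultimately show ?thesis by (simp add: d_def)
    qed
    have exp_u: "exp (u j) = (v j - b) / (v j + b) * exp (2 * b * (Ln (q + of_nat (Suc j)) - Ln (q + of_nat j)))" for j
    proof -
      have "b / v j \<noteq> 1" "b / v j \<noteq> -1" using small1[of j] by auto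
      hence "1 - b / v j \<noteq> 0" "1 + b / v j \<noteq> 0" by (auto simp: add_eq_0_iff)
      hence "exp (Ln (1 - b / v j) - Ln (1 + b / v j)) = (v j - b) / (v j + b)"
        using v0[of j] by (simp add: exp_diff divide_simps) 
      thus ?thesis unfolding u_def exp_add Lnv by simp
    qed
    have v_ne: "v j + b \<noteq> 0" for j
    proof
      assume "v j + b = 0"
      hence "norm b = norm (v j)" by (metis add_eq_0_iff norm_minus_cancel)
      thus False using v_y[of j] y1 b R by simp
    qed
    have prod: "exp (\<Sum>j<N+1. u j) = Gamma_series (1/2 + b + q) N * rGamma_series (1/2 - b + q) N *
        exp (2 * b * (Ln (q + of_nat (N+1)) - of_real (ln (real N)))) * exp (- 2 * b * Ln q)" for N
    proof -
      have "exp (\<Sum>j<M. u j) = (\<Prod>j<M. (v j - b) / (v j + b)) *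
          exp (2 * b * (\<Sum>j<M. Ln (q + of_nat (Suc j)) - Ln (q + of_nat j)))" for M
        unfolding sum_distrib_left exp_sum[OF finite_lessThan] exp_u prod.distrib ..
      hence "exp (\<Sum>j<N+1. u j) = (\<Prod>j<N+1. (v j - b) / (v j + b)) *
          exp (2 * b * (\<Sum>j<N+1. Ln (q + of_nat (Suc j)) - Ln (q + of_nat j)))" by blast
      also have "(\<Sum>j<N+1. Ln (q + of_nat (Suc j)) - Ln (q + of_nat j)) = Ln (q + of_nat (N+1)) - Ln q"
        by (subst sum_lessThan_telescope) simp
      also have "(\<Prod>j<N+1. (v j - b) / (v j + b)) = pochhammer (1/2 - b + q) (N+1) / pochhammer (1/2 + b + q) (N+1)"
        by (simp add: pochhammer_prod prod_dividef v_def add_ac diff_add_eq atLeast0LessThan algebra_simps)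
      finally have eq: "exp (\<Sum>j<N+1. u j) = pochhammer (1/2 - b + q) (N+1) / pochhammer (1/2 + b + q) (N+1) *
        exp (2 * b * (Ln (q + of_nat (N+1)) - Ln q))" .
      define l where "l = complex_of_real (ln (real N))"
      define X where "X = Ln (q + of_nat (N+1))"
      define E1 where "E1 = exp ((1/2 - b + q) * l)"
      define E2 where "E2 = exp (2 * b * l)"
      have 1: "exp ((1/2 + b + q) * l) = E1 * E2"
        by (simp add: E1_def E2_def algebra_simps flip: exp_add)
      have 2: "exp (2 * b * (X - Ln q)) = exp (2 * b * X) * exp (- 2 * b * Ln q)"
        by (simp add: algebra_simps flip: exp_add)
      have 3: "exp (2 * b * (X - l)) = exp (2 * b * X) / E2"
        by (simp add: E2_def algebra_simps flip: exp_diff)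
      have nz: "E1 \<noteq> 0" "E2 \<noteq> 0" by (auto simp: E1_def E2_def)
      show ?thesis
        unfolding eq Gamma_series_def rGamma_series_def of_real_of_nat_eq l_def[symmetric] X_def[symmetric] 1 2 3
          E1_def[symmetric]
        using nz by simp
    qed
    have "(\<lambda>N. Ln ((q + of_nat (N+1)) / of_real (real N))) \<longlonglongrightarrow> Ln 1"
    proof (intro tendsto_Ln)
      have "(\<lambda>N. (q + 1) / of_nat N + 1) \<longlonglongrightarrow> 0 + 1"
        by (intro tendsto_add lim_const_over_n tendsto_const)
      moreover have "eventually (\<lambda>N. (q + 1) / of_nat N + 1 = (q + of_nat (N+1)) / of_real (real N)) sequentially"
        using eventually_gt_at_top[of 0] by eventually_elim (auto simp: field_simps)
      ultimately show "(\<lambda>N. (q + of_nat (N+1)) / of_real (real N)) \<longlonglongrightarrow> 1"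
        by (auto intro: Lim_transform_eventually)
    qed auto
    moreover have "eventually (\<lambda>N. Ln ((q + of_nat (N+1)) / of_real (real N)) = Ln (q + of_nat (N+1)) - of_real (ln (real N))) sequentially"
      using eventually_gt_at_top[of 0]
    proof eventually_elim
      case (elim N)
      have "q + of_nat (N + 1) \<noteq> 0" using y1 by (auto simp: q_def complex_eq_iff)
      thus ?case using elim by (intro Ln_divide_of_real) auto
    qed
    ultimately have lim: "(\<lambda>N. Ln (q + of_nat (N+1)) - of_real (ln (real N))) \<longlonglongrightarrow> 0"
      by (auto intro: Lim_transform_eventually)
    have "(\<lambda>N. exp (\<Sum>j<N+1. u j)) \<longlonglongrightarrow> Gamma (1/2 + b + q) * rGamma (1/2 - b + q) *
        exp (2 * b * 0) * exp (- 2 * b * Ln q)"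
      unfolding prod by (intro tendsto_intros lim)
    hence "(\<lambda>N. norm (exp (\<Sum>j<N+1. u j) - 1)) \<longlonglongrightarrow> norm (Gamma (1/2 + b + q) * rGamma (1/2 - b + q) *
        exp (2 * b * 0) * exp (- 2 * b * Ln q) - 1)"
      by (intro tendsto_intros)
    moreover have "norm (exp (\<Sum>j<N+1. u j) - 1) \<le> 3 * K / y\<^sup>2" for N
    proof -
      have "norm (exp (\<Sum>j<N+1. u j) - 1) \<le> 3 * norm (\<Sum>j<N+1. u j)"
        by (intro norm_exp_minus_1_le order.trans[OF sum_u Ksmall])
      also have "\<dots> \<le> 3 * (K / y\<^sup>2)" by (intro mult_left_mono sum_u) auto
      finally show ?thesis by simp
    qed
    ultimately have "norm (Gamma (1/2 + b + q) * rGamma (1/2 - b + q) *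
        exp (2 * b * 0) * exp (- 2 * b * Ln q) - 1) \<le> 3 * K / y\<^sup>2"
      by (intro LIMSEQ_le_const2) auto
    thus ?thesis by (simp add: q_def algebra_simps)
  qed
  show ?thesis
    by (rule exI[of _ "3 * K"], rule conjI, use K in simp, rule exI[of _ K])
       (use K main in auto)
qed

section \<open>The cosecant series and its poles\<close>

text \<open>Weierstrass majorants are required only locally. The finite set F, which may depend on
  the point, absorbs the terms for which no such bound is available.\<close>

lemma holomorphic_on_infsum:
  fixes f :: "'i \<Rightarrow> complex \<Rightarrow> complex"
  assumes "open S" and hol: "\<And>i. i \<in> I \<Longrightarrow> f i holomorphic_on S"
    and bound: "\<And>z. z \<in> S \<Longrightarrow> \<exists>r>0. \<exists>F M. cball z r \<subseteq> S \<and> finite F \<and> M summable_on (I - F) \<and>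
      (\<forall>i\<in>I - F. \<forall>s\<in>cball z r. norm (f i s) \<le> M i)"
  shows "(\<lambda>s. \<Sum>\<^sub>\<infinity>i\<in>I. f i s) holomorphic_on S"
    and "\<And>s. s \<in> S \<Longrightarrow> (\<lambda>i. f i s) summable_on I"
proof -
  have *: "(\<lambda>s. \<Sum>\<^sub>\<infinity>i\<in>I. f i s) holomorphic_on ball z r \<and> (\<lambda>i. f i z) summable_on I"
    if z: "z \<in> S" and r: "r > 0" and F: "cball z r \<subseteq> S" "finite F" "M summable_on (I - F)"
      "\<And>i s. i \<in> I - F \<Longrightarrow> s \<in> cball z r \<Longrightarrow> norm (f i s) \<le> M i" for z r F M
  proof -
    have sub: "ball z r \<subseteq> S" using F(1) by auto
    have s1: "(\<lambda>i. f i s) summable_on (I - F)" if "s \<in> cball z r" for s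
      by (rule abs_summable_summable, rule Infinite_Sum.abs_summable_on_comparison_test'[OF F(3)]) (use F(4) that in auto)
    have s2: "(\<lambda>i. f i s) summable_on (I \<inter> F)" for s using F(2) by (intro summable_on_finite) auto
    have split: "I = (I - F) \<union> (I \<inter> F)" by auto
    have eq: "(\<Sum>\<^sub>\<infinity>i\<in>I. f i s) = (\<Sum>\<^sub>\<infinity>i\<in>I-F. f i s) + (\<Sum>i\<in>I\<inter>F. f i s)" if "s \<in> cball z r" for s
      using F(2) by (subst split, subst infsum_Un_disjoint[OF s1[OF that] s2]) (auto simp: infsum_finite)
    have "uniform_limit (cball z r) (\<lambda>X s. \<Sum>i\<in>X. f i s) (\<lambda>s. \<Sum>\<^sub>\<infinity>i\<in>I-F. f i s) (finite_subsets_at_top (I - F))"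
      by (rule Weierstrass_m_test_general[OF F(4) F(3)])
    hence "(\<lambda>s. \<Sum>\<^sub>\<infinity>i\<in>I-F. f i s) holomorphic_on ball z r"
    proof (rule holomorphic_uniform_limit[rotated])
      have "continuous_on (cball z r) (\<lambda>s. \<Sum>i\<in>X. f i s) \<and> (\<lambda>s. \<Sum>i\<in>X. f i s) holomorphic_on ball z r"
        if "X \<subseteq> I - F" for X
        using that sub F(1)
        by (auto intro!: holomorphic_on_imp_continuous_on holomorphic_on_sum holomorphic_on_subset[OF hol])
      thus "\<forall>\<^sub>F X in finite_subsets_at_top (I - F). continuous_on (cball z r) (\<lambda>s. \<Sum>i\<in>X. f i s)
          \<and> (\<lambda>s. \<Sum>i\<in>X. f i s) holomorphic_on ball z r"
        by (intro eventually_finite_subsets_at_top_weakI) auto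
    qed auto
    moreover have "(\<lambda>s. \<Sum>i\<in>I\<inter>F. f i s) holomorphic_on ball z r"
      using sub by (auto intro!: holomorphic_on_sum holomorphic_on_subset[OF hol])
    ultimately have "(\<lambda>s. (\<Sum>\<^sub>\<infinity>i\<in>I-F. f i s) + (\<Sum>i\<in>I\<inter>F. f i s)) holomorphic_on ball z r"
      by (rule holomorphic_on_add)
    moreover have "(\<lambda>i. f i z) summable_on I"
      using r by (subst split) (intro summable_on_Un_disjoint s1 s2, auto)
    moreover have "(\<lambda>s. \<Sum>\<^sub>\<infinity>i\<in>I. f i s) holomorphic_on ball z r"
      by (rule holomorphic_transform[OF calculation(1)]) (use eq in auto)
    ultimately show ?thesis by blast
  qed
  have **: "\<exists>r>0. (\<lambda>s. \<Sum>\<^sub>\<infinity>i\<in>I. f i s) holomorphic_on ball z r \<and> (\<lambda>i. f i z) summable_on I" if "z \<in> S" for z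
    using bound[OF that] *[OF that] by meson
  show "(\<lambda>i. f i s) summable_on I" if "s \<in> S" for s using **[OF that] by blast
  have "(\<lambda>s. \<Sum>\<^sub>\<infinity>i\<in>I. f i s) analytic_on S" unfolding analytic_on_def using ** by blast
  thus "(\<lambda>s. \<Sum>\<^sub>\<infinity>i\<in>I. f i s) holomorphic_on S" by (rule analytic_imp_holomorphic)
qed

lemma summable_on_Times_mult:
  fixes f g :: "_ \<Rightarrow> real"
  assumes "f summable_on A" "g summable_on B" "\<And>x. x \<in> A \<Longrightarrow> f x \<ge> 0" "\<And>y. y \<in> B \<Longrightarrow> g y \<ge> 0"
  shows "(\<lambda>(x, y). f x * g y) summable_on A \<times> B"
  by (rule summable_on_SigmaI[where g = "\<lambda>x. f x * infsum g B"])
     (use assms in \<open>auto intro!: has_sum_cmult_right has_sum_infsum summable_on_cmult_left\<close>)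

text \<open>The coefficients of the binomial series \<open>(1 - z) powr (-s)\<close>.\<close>
definition rbin :: "'a :: field_char_0 \<Rightarrow> nat \<Rightarrow> 'a" where
  "rbin s k = pochhammer s k / fact k"

lemma rbin_0 [simp]: "rbin s 0 = 1"
  by (simp add: rbin_def)

lemma rbin_Suc: "rbin s (Suc k) = rbin s k * (s + of_nat k) / of_nat (Suc k)"
  by (simp add: rbin_def pochhammer_Suc)

lemma rbin_conv_gbinomial: "rbin s k = (- s gchoose k) * (-1) ^ k"
  by (simp add: rbin_def gbinomial_pochhammer flip: power_mult_distrib)

lemma rbin_of_real: "rbin (of_real x) k = (of_real (rbin x k) :: complex)"
  by (induction k) (simp_all add: rbin_Suc del: of_nat_Suc)

lemma rbin_nonneg: "R \<ge> 0 \<Longrightarrow> rbin (R :: real) k \<ge> 0"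
  by (induction k) (simp_all add: rbin_Suc)

lemma norm_rbin_le:
  fixes s :: complex
  assumes "norm s \<le> R"
  shows "norm (rbin s k) \<le> rbin R k"
proof (induction k)
  case (Suc k)
  have "norm (s + of_nat k) \<le> R + of_nat k"
    using norm_triangle_ineq[of s "of_nat k"] assms by simp
  moreover have "0 \<le> R" using assms norm_ge_zero order.trans by blast
  ultimately show ?case using Suc rbin_nonneg[of R k] unfolding rbin_Suc norm_mult norm_divide norm_of_nat
    by (intro divide_right_mono mult_mono) auto
qed simp

lemma rbin_sums:
  fixes z :: complex
  assumes "norm z < 1"
  shows "(\<lambda>k. rbin s k * z ^ k) sums (1 - z) powr (- s)"
  using gen_binomial_complex[of "- z" "- s"] assms
  by (simp add: rbin_conv_gbinomial mult.assoc flip: power_mult_distrib)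

lemma rbin_sums_real:
  fixes x :: real
  assumes "\<bar>x\<bar> < 1"
  shows "(\<lambda>k. rbin s k * x ^ k) sums (1 - x) powr (- s)"
  using gen_binomial_real[of "- x" "- s"] assms
  by (simp add: rbin_conv_gbinomial mult.assoc flip: power_mult_distrib)

lemma holomorphic_on_rbin [holomorphic_intros]:
  "f holomorphic_on A \<Longrightarrow> (\<lambda>s. rbin (f s) k) holomorphic_on A"
  unfolding rbin_def pochhammer_prod by (intro holomorphic_intros) auto

section \<open>The pole set and the series that continues the Dirichlet series\<close>

definition csch_poles :: "real \<Rightarrow> complex set" where
  "csch_poles L = {\<i> * of_real (pi * of_int m / L) - 2 * of_nat k | (m :: int) (k :: nat). True}"

text \<open>1/(exp(2L(s+2k)) - 1) is the geometric sum of exp(-2nL(s+2k)) over n >= 1, so for Re s >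
  0 this is the sum of (2 sinh(2nL))^(-s) with binomial expansion and summation over n interchanged.
  L is a free parameter because it is later sent to 0.\<close>

definition csch_series :: "real \<Rightarrow> complex \<Rightarrow> complex" where
  "csch_series L s = (\<Sum>\<^sub>\<infinity>k. rbin s k / (exp (2 * of_real L * (s + 2 * of_nat k)) - 1))"

lemma exp_eq_1_imp_pole_form:
  assumes "L > 0" "exp (2 * of_real L * (s + 2 * of_nat k)) = 1"
  shows "\<exists>m::int. s = \<i> * of_real (pi * of_int m / L) - 2 * of_nat k"
proof -
  define w where "w = 2 * of_real L * (s + 2 * of_nat k)"
  obtain m :: int where "Re w = 0" "Im w = of_int (2 * m) * pi"
    using assms(2) unfolding w_def[symmetric] exp_eq_1 by blast
  hence "w = 2 * of_real L * (\<i> * of_real (pi * of_int m / L))"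
    using assms(1) by (simp add: complex_eq_iff)
  hence "2 * complex_of_real L * (s + 2 * of_nat k) = 2 * of_real L * (\<i> * of_real (pi * of_int m / L))"
    unfolding w_def .
  hence "s + 2 * of_nat k = \<i> * of_real (pi * of_int m / L)"
    by (subst (asm) mult_left_cancel) (use assms(1) in auto)
  hence "s = \<i> * of_real (pi * of_int m / L) - 2 * of_nat k" by (simp only: eq_diff_eq)
  thus ?thesis ..
qed

lemma exp_eq_1_imp_csch_poles:
  assumes "L > 0" "exp (2 * of_real L * (s + 2 * of_nat k)) = 1"
  shows "s \<in> csch_poles L"
  using exp_eq_1_imp_pole_form[OF assms] unfolding csch_poles_def by blast

lemma csch_poles_Re_le_0: "s \<in> csch_poles L \<Longrightarrow> Re s \<le> 0"
  by (auto simp: csch_poles_def)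

lemma countable_csch_poles: "countable (csch_poles L)"
proof -
  have "csch_poles L = (\<lambda>(m::int, k::nat). \<i> * of_real (pi * of_int m / L) - 2 * of_nat k) ` UNIV"
    by (auto simp: csch_poles_def)
  thus ?thesis by auto
qed

text \<open>The points form a grid with spacing 2 horizontally and pi/L vertically. The uniform gap
  makes every subset closed and later isolates each pole.\<close>

lemma csch_poles_dist:
  assumes "L > 0" "x \<in> csch_poles L" "y \<in> csch_poles L" "dist y x < min 2 (pi / L)"
  shows "y = x"
proof -
  obtain m k where x: "x = \<i> * of_real (pi * of_int m / L) - 2 * of_nat k"
    using assms(2) by (auto simp: csch_poles_def)
  obtain n l where y: "y = \<i> * of_real (pi * of_int n / L) - 2 * of_nat l"
    using assms(3) by (auto simp: csch_poles_def)
  have "\<bar>Re (y - x)\<bar> < 2" "\<bar>Im (y - x)\<bar> < pi / L"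
    using assms(4) abs_Re_le_cmod[of "y - x"] abs_Im_le_cmod[of "y - x"] by (auto simp: dist_norm)
  hence "\<bar>2 * (real k - real l)\<bar> < 2" "\<bar>pi / L * of_int (n - m)\<bar> < pi / L * 1"
    by (simp_all add: x y algebra_simps diff_divide_distrib)
  hence "\<bar>real k - real l\<bar> < 1" "pi / L * \<bar>of_int (n - m)\<bar> < pi / L * 1"
    using assms(1) by (auto simp: abs_mult)
  hence "\<bar>real k - real l\<bar> < 1" "\<bar>real_of_int (n - m)\<bar> < 1"
    using assms(1) by (simp_all only: mult_less_cancel_left_pos divide_pos_pos pi_gt_zero)
  hence "k = l" "n = m" by linarith+
  thus ?thesis by (simp add: x y)
qed

lemma closed_subset_csch_poles:
  assumes "L > 0" "P \<subseteq> csch_poles L"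
  shows "closed P"
proof (rule discrete_imp_closed)
  show "0 < min 2 (pi / L)" using assms by simp
  show "\<forall>x\<in>P. \<forall>y\<in>P. dist y x < min 2 (pi / L) \<longrightarrow> y = x"
    using csch_poles_dist[OF assms(1)] assms(2) by blast
qed

lemma closed_csch_poles: "L > 0 \<Longrightarrow> closed (csch_poles L)"
  by (rule closed_subset_csch_poles) auto

lemma norm_exp_minus_1_ge:
  fixes w :: complex
  assumes "Re w \<ge> 1"
  shows "norm (exp w - 1) \<ge> exp (Re w) / 2"
proof -
  have "exp (Re w) \<ge> 2" using exp_ge_add_one_self[of "Re w"] assms by linarith
  moreover have "norm (exp w - 1) \<ge> norm (exp w) - norm (1::complex)" by (rule norm_triangle_ineq2)
  ultimately show ?thesis by simp
qed

text \<open>On |s| <= R only finitely many denominators can vanish or be small: from K on the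
  exponent has real part at least 1, and the denominator is at least half of |exp|. The rest is
  dominated by the binomial series of \<open>rbin R\<close> at exp(-4L) < 1.\<close>

lemma csch_series_term_bound:
  fixes L R :: real
  assumes L: "L > 0" and R: "R \<ge> 0"
  shows "\<exists>F M. finite F \<and> M summable_on (UNIV - F) \<and> (\<forall>k\<in>UNIV - F. \<forall>s::complex. norm s \<le> R \<longrightarrow>
    norm (rbin s k / (exp (2 * of_real L * (s + 2 * of_nat k)) - 1)) \<le> M k)"
proof -
  \<comment> \<open>Chosen so that 2L(2k - R) >= 1 for k >= K; the real part of s is at least
    -R.\<close>
  define K where "K = nat \<lceil>(R + 1 / (2 * L)) / 2\<rceil>"
  define M where "M = (\<lambda>k. 2 * exp (2 * L * R) * (rbin R k * exp (- 4 * L) ^ k))"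
  have "norm (rbin s k / (exp (2 * of_real L * (s + 2 * of_nat k)) - 1)) \<le> M k"
    if k: "k \<notin> {..<K}" and s: "norm s \<le> R" for k and s :: complex
  proof -
    define w where "w = 2 * of_real L * (s + 2 * of_nat k)"
    have "Re s \<ge> - R" using abs_Re_le_cmod[of s] s by linarith
    have w: "Re w = 2 * L * (Re s + 2 * real k)" by (simp add: w_def)
    have "(R + 1 / (2 * L)) / 2 \<le> real K" unfolding K_def by (rule real_nat_ceiling_ge)
    also have "\<dots> \<le> real k" using k by simp
    finally have "(R + 1 / (2 * L)) / 2 \<le> real k" .
    hence "1 / (2 * L) \<le> 2 * real k - R" by simp
    also have "\<dots> \<le> Re s + 2 * real k" using \<open>Re s \<ge> - R\<close> by simp
    finally have "2 * L * (1 / (2 * L)) \<le> Re w" unfolding w using L by (intro mult_left_mono) auto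
    hence "Re w \<ge> 1" using L by simp
    have "exp (2 * L * (2 * real k - R)) / 2 \<le> exp (Re w) / 2"
      unfolding w using L \<open>Re s \<ge> - R\<close> by simp
    also have "\<dots> \<le> norm (exp w - 1)" by (rule norm_exp_minus_1_ge) fact
    finally have "norm (exp w - 1) \<ge> exp (2 * L * (2 * real k - R)) / 2" .
    hence "norm (rbin s k / (exp w - 1)) \<le> rbin R k / (exp (2 * L * (2 * real k - R)) / 2)"
      unfolding norm_divide using norm_rbin_le[OF s, of k] rbin_nonneg[OF R] by (intro frac_le) auto
    also have "exp (2 * L * (2 * real k - R)) = 1 / (exp (2 * L * R) * exp (- 4 * L) ^ k)"
      by (simp add: exp_diff exp_minus field_simps flip: exp_of_nat_mult exp_add)
    finally show ?thesis by (simp add: w_def M_def mult_ac)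
  qed
  moreover have "M summable_on (UNIV - {..<K})"
  proof -
    have "summable (\<lambda>k. norm (M k))"
    proof -
      have "exp (- 4 * L) < 1" using L by simp
      hence "summable M" unfolding M_def
        by (intro summable_mult sums_summable[OF rbin_sums_real]) auto
      thus ?thesis using rbin_nonneg[OF R] by (simp add: M_def abs_mult)
    qed
    hence "M summable_on UNIV" by (rule norm_summable_imp_summable_on)
    thus ?thesis by (rule summable_on_subset_banach) auto
  qed
  ultimately show ?thesis by (intro exI[of _ "{..<K}"] exI[of _ M]) blast
qed

lemma csch_series_holomorphic:
  assumes L: "L > 0"
  shows "csch_series L holomorphic_on - csch_poles L"
    and "s \<notin> csch_poles L \<Longrightarrow> (\<lambda>k. rbin s k / (exp (2 * of_real L * (s + 2 * of_nat k)) - 1)) summable_on UNIV"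
proof -
  have op: "open (- csch_poles L)" using closed_csch_poles[OF L] by auto
  have hol: "(\<lambda>s. rbin s k / (exp (2 * of_real L * (s + 2 * of_nat k)) - 1)) holomorphic_on - csch_poles L" for k
    by (intro holomorphic_intros) (use exp_eq_1_imp_csch_poles[OF L] in auto)
  have bd: "\<exists>r>0. \<exists>F M. cball z r \<subseteq> - csch_poles L \<and> finite F \<and> M summable_on (UNIV - F) \<and>
      (\<forall>k\<in>UNIV - F. \<forall>s\<in>cball z r. norm (rbin s k / (exp (2 * of_real L * (s + 2 * of_nat k)) - 1)) \<le> M k)"
    if z: "z \<in> - csch_poles L" for z
  proof -
    obtain r where r: "r > 0" "cball z r \<subseteq> - csch_poles L" using op z open_contains_cball by blast
    obtain F M where FM: "finite F" "M summable_on (UNIV - F)" "\<And>k s::complex. k \<in> UNIV - F \<Longrightarrow> norm s \<le> norm z + r \<Longrightarrow>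
       norm (rbin s k / (exp (2 * of_real L * (s + 2 * of_nat k)) - 1)) \<le> M k"
      using csch_series_term_bound[OF L, of "norm z + r"] r(1) by (meson add_nonneg_nonneg less_imp_le norm_ge_zero)
    have "norm s \<le> norm z + r" if "s \<in> cball z r" for s
      using that norm_triangle_ineq2[of s z] by (simp add: dist_norm norm_minus_commute)
    hence *: "\<forall>k\<in>UNIV - F. \<forall>s\<in>cball z r.
        norm (rbin s k / (exp (2 * of_real L * (s + 2 * of_nat k)) - 1)) \<le> M k"
      using FM(3) by blast
    show ?thesis by (intro exI[of _ r] conjI exI[of _ F] exI[of _ M] r FM(1,2) *)
  qed
  show "csch_series L holomorphic_on - csch_poles L"
    unfolding csch_series_def by (rule holomorphic_on_infsum[OF op hol bd])
  show "(\<lambda>k. rbin s k / (exp (2 * of_real L * (s + 2 * of_nat k)) - 1)) summable_on UNIV" if "s \<notin> csch_poles L"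
    by (rule holomorphic_on_infsum(2)[OF op hol bd]) (use that in auto)
qed

section \<open>Partial fractions of the Beta function\<close>

text \<open>From k = 3 on the factors s + k are positive and below k - 2, so the quotients telescope
  to cubic decay. The 6 makes the bound equal to 1 at k = 0, in accordance with |s(s+1)(s+2)| <=
  3!.\<close>

lemma rbin_real_bound:
  fixes s :: real
  assumes s: "-3 < s" "s < -2"
  shows "\<bar>rbin s (k + 3)\<bar> \<le> 6 / (real (k + 1) * real (k + 2) * real (k + 3))"
proof (induction k)
  case 0
  have "\<bar>s * (s + 1) * (s + 2)\<bar> \<le> 3 * 2 * 1"
    unfolding abs_mult using s by (intro mult_mono) auto
  thus ?case by (simp add: rbin_def eval_nat_numeral pochhammer_Suc abs_mult divide_simps)
next
  case (Suc k)
  have "rbin s (Suc k + 3) = rbin s (k + 3) * ((s + of_nat (k + 3)) / of_nat (k + 4))"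
    using rbin_Suc[of s "k + 3"] by (simp add: add_ac)
  hence "\<bar>rbin s (Suc k + 3)\<bar> = \<bar>rbin s (k + 3)\<bar> * ((s + real (k + 3)) / real (k + 4))"
    using s by (simp add: abs_mult)
  also have "\<dots> \<le> 6 / (real (k + 1) * real (k + 2) * real (k + 3)) * (real (k + 1) / real (k + 4))"
    using s by (intro mult_mono Suc divide_right_mono) auto
  also have "\<dots> = 6 / (real (Suc k + 1) * real (Suc k + 2) * real (Suc k + 3))"
    by (simp add: divide_simps) (simp add: algebra_simps)
  finally show ?case .
qed

lemma rbin_real_summable:
  fixes s :: real
  assumes s: "-3 < s" "s < -2"
  shows "summable (\<lambda>k. \<bar>rbin s k\<bar> * real (k + 1))"
proof (subst summable_iff_shift[symmetric, of _ 3], rule summable_comparison_test')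
  show "summable (\<lambda>k. 12 * inverse (real (Suc k) ^ 2))"
    using inverse_power_summable[of 2, where 'a = real] by (intro summable_mult) (subst summable_Suc_iff, simp)
  show "norm (\<bar>rbin s (k + 3)\<bar> * real (k + 3 + 1)) \<le> 12 * inverse (real (Suc k) ^ 2)" for k
  proof -
    have "\<bar>rbin s (k + 3)\<bar> * real (k + 4) \<le> 6 / (real (k + 1) * real (k + 2) * real (k + 3)) * (2 * real (k + 3))"
      by (intro mult_mono rbin_real_bound[OF s]) auto
    also have "\<dots> = 12 / (real (k + 1) * real (k + 2))" by (simp add: divide_simps)
    also have "\<dots> \<le> 12 / (real (k + 1) * real (k + 1))" by (intro divide_left_mono mult_left_mono) auto
    finally show ?thesis by (simp add: divide_inverse power2_eq_square add_ac)
  qed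
qed

lemma rbin_real_abs_summable:
  fixes s :: real
  assumes s: "-3 < s" "s < -2"
  shows "summable (\<lambda>k. \<bar>rbin s k\<bar>)"
  by (rule summable_comparison_test'[OF rbin_real_summable[OF s]]) (simp add: mult_le_cancel_left1)

text \<open>The value of (1-u)^(-s) at the boundary point u = 1, which \<open>rbin_sums_real\<close>
  does not reach; the partial sums have a closed form tending to 0. This removes the constant 1/2 of
  the cotangent expansion.\<close>

lemma rbin_real_sums_0:
  fixes s :: real
  assumes s: "-3 < s" "s < -2"
  shows "rbin s sums 0"
proof -
  have partial: "(\<Sum>k<Suc N. rbin s k) = rbin s N * (s + of_nat N) / s" for N
  proof (induction N)
    case (Suc N)
    have "(\<Sum>k<Suc (Suc N). rbin s k) = rbin s N * (s + of_nat N) / s + rbin s (Suc N)"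
      using Suc by simp
    also have "\<dots> = rbin s (Suc N) * (s + of_nat (Suc N)) / s"
      unfolding rbin_Suc using s by (simp add: divide_simps del: of_nat_Suc) (simp add: algebra_simps)
    finally show ?case .
  qed (use s in simp)
  have "summable (\<lambda>k. rbin s k * real (k + 1))" "summable (rbin s)"
    by (rule summable_norm_cancel; simp add: abs_mult rbin_real_summable[OF s, simplified]
          rbin_real_abs_summable[OF s])+
  hence "(\<lambda>N. rbin s N * real (N + 1)) \<longlonglongrightarrow> 0" "rbin s \<longlonglongrightarrow> 0"
    by (auto dest: summable_LIMSEQ_zero)
  hence "(\<lambda>N. (rbin s N * real (N + 1) + rbin s N * (s - 1)) / s) \<longlonglongrightarrow> (0 + 0 * (s - 1)) / s"
    by (intro tendsto_intros) (use s in auto)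
  moreover have "(rbin s N * real (N + 1) + rbin s N * (s - 1)) / s = (\<Sum>k<Suc N. rbin s k)" for N
    unfolding partial using s by (simp add: field_simps)
  ultimately have "(\<lambda>N. \<Sum>k<Suc N. rbin s k) \<longlonglongrightarrow> 0" by simp
  thus ?thesis unfolding sums_def by (rule LIMSEQ_imp_Suc)
qed

text \<open>The binomial series of (1-u)^(-s), multiplied by u^(z-1), is integrated termwise over
  [0,1], which gives a Beta integral. Absolute summability of the coefficients makes the convergence
  uniform up to u = 1, and z > 1 keeps u^(z-1) continuous at 0.\<close>

lemma rbin_partial_fractions_real:
  fixes s z :: real
  assumes s: "-3 < s" "s < -2" and z: "z > 1"
  shows "(\<lambda>k. rbin s k / (z + real k)) sums Beta z (1 - s)"
proof -
  define f where "f = (\<lambda>N u. \<Sum>k<N. rbin s k * u ^ k * u powr (z - 1))"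
  define g where "g = (\<lambda>u. \<Sum>k. rbin s k * u ^ k * u powr (z - 1))"
  have cont: "continuous_on {0..1} (f N)" for N
    unfolding f_def using z
    by (intro continuous_on_sum continuous_on_mult continuous_on_const continuous_on_power continuous_on_id continuous_on_powr') auto
  have bd: "norm (rbin s k * u ^ k * u powr (z - 1)) \<le> \<bar>rbin s k\<bar>" if "u \<in> {0..1}" for u k
  proof -
    have "u ^ k \<le> 1" "u powr (z - 1) \<le> 1" using that z by (auto intro: power_le_one powr_le1)
    hence "u ^ k * u powr (z - 1) \<le> 1" using that by (intro mult_le_one) auto
    thus ?thesis using that by (simp add: abs_mult mult.assoc mult_le_cancel_left2)
  qed
  have unif: "uniform_limit {0..1} f g sequentially"
    unfolding f_def g_def
    by (rule Weierstrass_m_test[OF bd rbin_real_abs_summable[OF s]])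
  obtain I J where I: "\<And>N. (f N has_integral I N) {0..1}" and J: "(g has_integral J) {0..1}" and IJ: "I \<longlonglongrightarrow> J"
    using uniform_limit_integral[OF unif cont] by auto
  have "(f N has_integral (\<Sum>k<N. rbin s k / (z + real k))) {0..1}" for N
  proof -
    have "((\<lambda>u. \<Sum>k<N. rbin s k * u powr (z - 1 + real k)) has_integral
        (\<Sum>k<N. rbin s k * (1 powr (z - 1 + real k + 1) / (z - 1 + real k + 1)))) {0..1}"
      using z by (intro has_integral_sum has_integral_mult_right has_integral_powr_from_0) auto
    moreover have "(\<Sum>k<N. rbin s k * u powr (z - 1 + real k)) = f N u" if "u \<in> {0..1}" for u
      using that by (cases "u = 0") (auto simp: f_def powr_add powr_realpow mult_ac)
    ultimately have "(f N has_integral (\<Sum>k<N. rbin s k * (1 powr (z - 1 + real k + 1) / (z - 1 + real k + 1)))) {0..1}"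
      by (subst has_integral_cong[symmetric]) auto
    thus ?thesis by (simp add: add_ac)
  qed
  hence "I N = (\<Sum>k<N. rbin s k / (z + real k))" for N using I has_integral_unique by blast
  hence "I = (\<lambda>N. \<Sum>k<N. rbin s k / (z + real k))" by blast
  hence sums: "(\<lambda>k. rbin s k / (z + real k)) sums J" using IJ unfolding sums_def by (simp only:)
  have "g u = u powr (z - 1) * (1 - u) powr ((1 - s) - 1)" if "u \<in> {0..1}" for u
  proof -
    have "(\<lambda>k. rbin s k * u ^ k) sums (1 - u) powr (- s)"
      using rbin_sums_real[of u s] rbin_real_sums_0[OF s] that by (cases "u = 1") auto
    from sums_mult2[OF this, of "u powr (z - 1)"] show ?thesis
      unfolding g_def by (simp add: sums_iff mult_ac)
  qed
  hence "((\<lambda>u. u powr (z - 1) * (1 - u) powr ((1 - s) - 1)) has_integral J) {0..1}"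
    using J by (subst has_integral_cong[symmetric]) auto
  moreover have "((\<lambda>u. u powr (z - 1) * (1 - u) powr ((1 - s) - 1)) has_integral Beta z (1 - s)) {0..1}"
    using z s by (intro has_integral_Beta_real) auto
  ultimately have "J = Beta z (1 - s)" by (rule has_integral_unique)
  thus ?thesis using sums by simp
qed

text \<open>The arguments s/2 - iy to which this is applied have negative real part, out of reach of
  the Beta integral. The identity is therefore continued in z from the ray z > 1 to the complement
  of the poles, connected because the removed set is countable.\<close>

lemma rbin_partial_fractions:
  fixes s :: real and z :: complex
  assumes s: "-3 < s" "s < -2" and z: "z \<notin> \<int>\<^sub>\<le>\<^sub>0"
  shows "((\<lambda>k. of_real (rbin s k) / (z + of_nat k)) has_sum
     Gamma (of_real (1 - s)) * Gamma z * rGamma (z + of_real (1 - s))) UNIV"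
proof -
  define S :: "complex set" where "S = - \<int>\<^sub>\<le>\<^sub>0"
  define f where "f = (\<lambda>z. \<Sum>\<^sub>\<infinity>k. of_real (rbin s k) / (z + of_nat k) :: complex)"
  define g where "g = (\<lambda>z::complex. Gamma (of_real (1 - s)) * Gamma z * rGamma (z + of_real (1 - s)))"
  have op: "open S" unfolding S_def by auto
  have nz: "z + of_nat k \<noteq> 0" if "z \<in> S" for z k
    using that by (auto simp: S_def add_eq_0_iff2)
  have hol: "(\<lambda>z. of_real (rbin s k) / (z + of_nat k) :: complex) holomorphic_on S" for k
    using nz by (intro holomorphic_intros) auto
  have bd: "\<exists>r>0. \<exists>F M. cball z r \<subseteq> S \<and> finite F \<and> M summable_on (UNIV - F) \<and>
      (\<forall>k\<in>UNIV - F. \<forall>w\<in>cball z r. norm (of_real (rbin s k) / (w + of_nat k) :: complex) \<le> M k)"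
    if z: "z \<in> S" for z
  proof -
    obtain r where r: "r > 0" "cball z r \<subseteq> S" using op z open_contains_cball by blast
    define K where "K = nat \<lceil>norm z + r + 1\<rceil>"
    have "norm (of_real (rbin s k) / (w + of_nat k) :: complex) \<le> \<bar>rbin s k\<bar>"
      if k: "k \<in> UNIV - {..<K}" and w: "w \<in> cball z r" for k w
    proof -
      have "norm w \<le> norm z + r"
        using w norm_triangle_ineq2[of w z] by (simp add: dist_norm norm_minus_commute)
      moreover have "norm z + r + 1 \<le> real k" using k unfolding K_def by simp linarith
      moreover have "norm (w + of_nat k) \<ge> real k - norm w"
        using norm_diff_ineq[of "of_nat k" w] by (simp add: add.commute)
      ultimately have "norm (w + of_nat k) \<ge> 1" by linarith
      hence "\<bar>rbin s k\<bar> / norm (w + of_nat k) \<le> \<bar>rbin s k\<bar> / 1" by (intro divide_left_mono) auto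
      thus ?thesis by (simp add: norm_divide)
    qed
    moreover have "(\<lambda>k. \<bar>rbin s k\<bar>) summable_on (UNIV - {..<K})"
      by (rule summable_on_subset_banach[of _ UNIV])
         (use rbin_real_abs_summable[OF s] in \<open>auto simp: summable_on_UNIV_nonneg_real_iff\<close>)
    ultimately show ?thesis using r by (intro exI[of _ r] conjI exI[of _ "{..<K}"] exI[of _ "\<lambda>k. \<bar>rbin s k\<bar>"]) auto
  qed
  have fhol: "f holomorphic_on S" unfolding f_def by (rule holomorphic_on_infsum[OF op hol bd])
  have fsum: "(\<lambda>k. of_real (rbin s k) / (z + of_nat k) :: complex) summable_on UNIV" if "z \<in> S" for z
    by (rule holomorphic_on_infsum(2)[OF op hol bd that])
  have ghol: "g holomorphic_on S"
    unfolding g_def by (intro holomorphic_intros) (auto simp: S_def)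
  have fg: "f (of_real x) = g (of_real x)" if "x > 1" for x
  proof -
    have "of_real x \<in> S" using that by (auto simp: S_def elim!: nonpos_Ints_cases simp: complex_eq_iff)
    from fsum[OF this] have "((\<lambda>k. of_real (rbin s k) / (of_real x + of_nat k) :: complex) has_sum f (of_real x)) UNIV"
      unfolding f_def by (rule has_sum_infsum)
    from has_sum_imp_sums[OF this] have "(\<lambda>k. of_real (rbin s k / (x + of_nat k)) :: complex) sums f (of_real x)" by simp
    moreover have "(\<lambda>k. of_real (rbin s k / (x + of_nat k)) :: complex) sums of_real (Beta x (1 - s))"
      unfolding sums_of_real_iff using rbin_partial_fractions_real[OF s that] by simp
    ultimately have "f (of_real x) = of_real (Beta x (1 - s))" by (rule sums_unique2)
    also have "\<dots> = g (of_real x)"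
      unfolding Beta_complex_of_real[symmetric] by (simp add: g_def Beta_altdef mult_ac)
    finally show ?thesis .
  qed
  have "f z - g z = 0"
  proof (rule analytic_continuation[where f = "\<lambda>z. f z - g z" and w = z and S = S and U = "of_real ` {1<..}" and \<xi> = 2])
    show "(\<lambda>z. f z - g z) holomorphic_on S" using fhol ghol by (intro holomorphic_intros)
    show "connected S"
    proof -
      have "S = UNIV - \<int>\<^sub>\<le>\<^sub>0" by (auto simp: S_def)
      moreover have "countable (\<int>\<^sub>\<le>\<^sub>0 :: complex set)"
      proof (rule countable_subset)
        show "\<int>\<^sub>\<le>\<^sub>0 \<subseteq> (range of_int :: complex set)" by (auto elim!: nonpos_Ints_cases)
      qed auto
      ultimately show ?thesis using connected_open_diff_countable[of "UNIV::complex set" "\<int>\<^sub>\<le>\<^sub>0"] by auto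
    qed
    show "of_real ` {1<..} \<subseteq> S" by (auto simp: S_def elim!: nonpos_Ints_cases simp: complex_eq_iff)
    show "2 \<in> S" by (auto simp: S_def elim!: nonpos_Ints_cases simp: complex_eq_iff)
    show "(2::complex) islimpt of_real ` {1<..}"
      unfolding islimpt_approachable
    proof safe
      fix e :: real assume e: "e > 0"
    have "complex_of_real (2 + e / 2) - 2 = of_real (e / 2)" by simp
    hence "norm (complex_of_real (2 + e / 2) - 2) = \<bar>e / 2\<bar>" by (simp only: norm_of_real)
    with e show "\<exists>x'\<in>of_real ` {1<..}. x' \<noteq> (2::complex) \<and> dist x' 2 < e"
      by (intro bexI[of _ "of_real (2 + e / 2)"]) (auto simp: dist_norm complex_eq_iff simp del: of_real_add)
  qed
    show "f w - g w = 0" if "w \<in> of_real ` {1<..}" for w using that fg by auto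
  qed (use op z in \<open>auto simp: S_def\<close>)
  thus ?thesis using has_sum_infsum[OF fsum[of z]] z by (simp add: f_def g_def S_def)
qed

section \<open>The series of Gamma quotients\<close>

text \<open>\<open>rGamma\<close> is entire, so only the poles of the numerator restrict holomorphy
  in s. As \<open>Gamma\<close> takes the value 0 at its poles, this still equals the quotient in
  \<open>term2\<close> for all arguments.\<close>

definition gam_ratio :: "complex \<Rightarrow> real \<Rightarrow> complex" where
  "gam_ratio s y = Gamma (s / 2 - \<i> * of_real y) * rGamma (1 - s / 2 - \<i> * of_real y)"

text \<open>The restriction to this interval makes the binomial coefficients decay cubically, so that the double sum can be
  interchanged by crude bounds; analytic continuation removes it later.\<close>
lemma csch_series_eq_real:
  fixes s L :: real
  assumes s: "-3 < s" "s < -2" and L: "L > 0"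
  defines "y \<equiv> (\<lambda>m::nat. pi * real (Suc m) / (2 * L))"
  shows "csch_series L (of_real s) = Gamma (1 - of_real s) / (4 * of_real L) *
    (gam_ratio (of_real s) 0 + (\<Sum>\<^sub>\<infinity>m. gam_ratio (of_real s) (y m) + gam_ratio (of_real s) (- y m)))"
proof -
  define w where "w = (\<lambda>k::nat. 2 * L * (s + 2 * real k))"
  \<comment> \<open>The n-th partial fraction of 1/(exp(w_k) - 1), weighted by the k-th coefficient.
    Summation over n first yields the exponential series, summation over k first the Gamma
    quotients.\<close>
  define T where "T = (\<lambda>(k::nat) (n::nat). rbin s k * (2 * w k / ((w k)\<^sup>2 + 4 * pi\<^sup>2 * real (Suc n) ^ 2)))"
  \<comment> \<open>If s + 2k were 0, then 2k would be an even integer strictly between 2 and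
    3.\<close>
  have w0: "w k \<noteq> 0" for k
  proof -
    have "s + 2 * real k \<noteq> 0"
    proof
      assume "s + 2 * real k = 0"
      hence "real 2 < real (2 * k)" "real (2 * k) < real 3" using s by simp_all
      hence "2 < 2 * k" "2 * k < 3" by (simp_all only: of_nat_less_iff)
      thus False by presburger
    qed
    thus ?thesis using L by (simp add: w_def)
  qed
  have T_bound: "norm (T k n) \<le> (6 * L * (\<bar>rbin s k\<bar> * real (k + 1))) * inverse (real (Suc n) ^ 2)" for k n
  proof -
    define d where "d = (w k)\<^sup>2 + 4 * pi\<^sup>2 * real (Suc n) ^ 2"
    have "1 * 1 \<le> pi * pi" using pi_ge_two by (intro mult_mono) auto
    hence "1 \<le> pi\<^sup>2" by (simp add: power2_eq_square)
    hence "2 * 1 * real (Suc n) ^ 2 \<le> 4 * pi\<^sup>2 * real (Suc n) ^ 2"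
      by (intro mult_right_mono) auto
    hence d: "d \<ge> 2 * real (Suc n) ^ 2" unfolding d_def by (simp add: add_increasing)
    have n0: "real (Suc n) ^ 2 > 0" by simp
    hence d0: "d > 0" using d by linarith
    have w: "\<bar>w k\<bar> \<le> 6 * L * real (k + 1)"
    proof -
      have "\<bar>s + 2 * real k\<bar> \<le> 3 * real (k + 1)" using s by (simp add: abs_le_iff)
      hence "2 * L * \<bar>s + 2 * real k\<bar> \<le> 2 * L * (3 * real (k + 1))" using L by (intro mult_left_mono) auto
      thus ?thesis using L by (simp add: w_def abs_mult)
    qed
    have "norm (T k n) = \<bar>rbin s k\<bar> * (2 * \<bar>w k\<bar> / d)"
      using d0 by (simp add: T_def d_def[symmetric] abs_mult del: of_nat_Suc)
    also have "\<dots> \<le> \<bar>rbin s k\<bar> * (2 * (6 * L * real (k + 1)) / (2 * real (Suc n) ^ 2))"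
      using w d n0 L by (intro mult_left_mono frac_le mult_mono) auto
    finally show ?thesis by (simp add: field_simps del: of_nat_Suc)
  qed
  have "(\<lambda>(k, n). (6 * L * (\<bar>rbin s k\<bar> * real (k + 1))) * inverse (real (Suc n) ^ 2)) summable_on UNIV \<times> UNIV"
  proof (rule summable_on_Times_mult)
    show "(\<lambda>k. 6 * L * (\<bar>rbin s k\<bar> * real (k + 1))) summable_on UNIV"
      using L by (subst summable_on_UNIV_nonneg_real_iff)
                 (auto intro!: summable_mult rbin_real_summable[OF s, simplified] simp del: of_nat_add)
    show "(\<lambda>n. inverse (real (Suc n) ^ 2)) summable_on UNIV"
      by (subst summable_on_UNIV_nonneg_real_iff, simp, subst summable_Suc_iff)
         (use inverse_power_summable[of 2, where 'a = real] in simp)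
  qed (use L in auto)
  hence "(\<lambda>(k, n). complex_of_real (T k n)) summable_on UNIV \<times> UNIV"
  proof (rule abs_summable_summable[OF Infinite_Sum.abs_summable_on_comparison_test'])
    show "norm (case x of (k, n) \<Rightarrow> complex_of_real (T k n)) \<le>
        (case x of (k, n) \<Rightarrow> 6 * L * (\<bar>rbin s k\<bar> * real (k + 1)) * inverse (real (Suc n) ^ 2))" for x
      by (cases x) (use T_bound[unfolded real_norm_def] in \<open>simp only: prod.case norm_of_real\<close>)
  qed
  hence swap: "(\<Sum>\<^sub>\<infinity>k. \<Sum>\<^sub>\<infinity>n. complex_of_real (T k n)) = (\<Sum>\<^sub>\<infinity>n. \<Sum>\<^sub>\<infinity>k. complex_of_real (T k n))"
    and summ_k: "(\<lambda>k. \<Sum>\<^sub>\<infinity>n. complex_of_real (T k n)) summable_on UNIV"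
    by (rule infsum_swap_banach, intro summable_on_Sigma_banach) auto
  have sum_n: "(\<Sum>\<^sub>\<infinity>n. complex_of_real (T k n)) = of_real (rbin s k * (1 / (exp (w k) - 1) + 1 / 2 - 1 / w k))" for k
  proof -
    have "(\<lambda>n. T k n) sums (rbin s k * (1 / (exp (w k) - 1) + 1 / 2 - 1 / w k))"
      unfolding T_def by (intro sums_mult inverse_exp_minus_1_pfd w0)
    hence "(\<lambda>n. complex_of_real (T k n)) sums of_real (rbin s k * (1 / (exp (w k) - 1) + 1 / 2 - 1 / w k))"
      by (simp only: sums_of_real_iff)
    moreover have "summable (\<lambda>n. norm (complex_of_real (T k n)))"
    proof (rule summable_comparison_test')
      show "summable (\<lambda>n. (6 * L * (\<bar>rbin s k\<bar> * real (k + 1))) * inverse (real (Suc n) ^ 2))"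
        by (intro summable_mult, subst summable_Suc_iff) (use inverse_power_summable[of 2, where 'a = real] in simp)
      show "norm (norm (complex_of_real (T k n))) \<le> (6 * L * (\<bar>rbin s k\<bar> * real (k + 1))) * inverse (real (Suc n) ^ 2)" for n
        using T_bound[of k n] by simp
    qed
    ultimately show ?thesis by (intro infsumI norm_summable_imp_has_sum)
  qed
  have pf: "((\<lambda>k. of_real (rbin s k) / (of_real s / 2 - \<i> * of_real x + of_nat k)) has_sum
     (Gamma (1 - of_real s) * gam_ratio (of_real s) x)) UNIV" for x
  proof -
    have "of_real s / 2 - \<i> * of_real x \<notin> \<int>\<^sub>\<le>\<^sub>0"
    proof
      assume "of_real s / 2 - \<i> * of_real x \<in> \<int>\<^sub>\<le>\<^sub>0"
      then obtain n :: nat where n: "of_real s / 2 - \<i> * of_real x = - of_nat n" by (elim nonpos_Ints_cases')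
      have "s / 2 = - real n" using arg_cong[OF n, of Re] by simp
      hence "real 2 < real (2 * n)" "real (2 * n) < real 3" using s by simp_all
      hence "2 < 2 * n" "2 * n < 3" by (simp_all only: of_nat_less_iff)
      thus False by presburger
    qed
    from rbin_partial_fractions[OF s this] show ?thesis
      by (simp add: gam_ratio_def algebra_simps)
  qed
  have sum_k: "(\<Sum>\<^sub>\<infinity>k. complex_of_real (T k n)) = Gamma (1 - of_real s) / (4 * of_real L) *
     (gam_ratio (of_real s) (y n) + gam_ratio (of_real s) (- y n))" for n
  proof -
    \<comment> \<open>Splits w^2 + 4 pi^2 (n+1)^2 into its conjugate linear factors 4L a and 4L b,
      which belong to the indices m = n+1 and m = -(n+1).\<close>
    have eq: "complex_of_real (T k n) = 1 / (4 * of_real L) *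
       (of_real (rbin s k) / (of_real s / 2 - \<i> * of_real (y n) + of_nat k) +
        of_real (rbin s k) / (of_real s / 2 - \<i> * of_real (- y n) + of_nat k))" for k
    proof -
      define a b where "a = of_real s / 2 - \<i> * of_real (y n) + of_nat k" and
        "b = of_real s / 2 - \<i> * of_real (- y n) + of_nat k"
      have y0: "y n \<noteq> 0" using L by (simp add: y_def)
      have nz: "a \<noteq> 0" "b \<noteq> 0" using y0 by (auto simp: a_def b_def complex_eq_iff)
      have ab: "a + b = of_real (w k / (2 * L))" using L by (simp add: a_def b_def w_def field_simps)
      have prod: "a * b = of_real ((w k)\<^sup>2 + 4 * pi\<^sup>2 * real (Suc n) ^ 2) / (16 * of_real L ^ 2)"
        using L by (simp add: complex_eq_iff a_def b_def y_def w_def field_simps power2_eq_square del: of_nat_Suc)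
      have "1 / (4 * of_real L) * (of_real (rbin s k) / a + of_real (rbin s k) / b) =
          of_real (rbin s k) * (1 / (4 * of_real L) * ((a + b) / (a * b)))"
        using nz L by (simp add: field_simps)
      also have "1 / (4 * of_real L) * ((a + b) / (a * b)) = of_real (2 * w k / ((w k)\<^sup>2 + 4 * pi\<^sup>2 * real (Suc n) ^ 2))"
        unfolding ab prod using L by (simp add: power2_eq_square del: of_nat_Suc)
      finally show ?thesis by (simp add: T_def a_def b_def)
    qed
    have "((\<lambda>k. complex_of_real (T k n)) has_sum (1 / (4 * of_real L) *
       (Gamma (1 - of_real s) * gam_ratio (of_real s) (y n) + Gamma (1 - of_real s) * gam_ratio (of_real s) (- y n)))) UNIV"
      unfolding eq by (intro has_sum_cmult_right has_sum_add pf)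
    thus ?thesis by (simp add: infsumI field_simps)
  qed
  have hs1: "((\<lambda>k. complex_of_real (rbin s k * (1 / (exp (w k) - 1) + 1 / 2 - 1 / w k))) has_sum
     (Gamma (1 - of_real s) / (4 * of_real L) *
     (\<Sum>\<^sub>\<infinity>n. gam_ratio (of_real s) (y n) + gam_ratio (of_real s) (- y n)))) UNIV"
    using has_sum_infsum[OF summ_k] unfolding swap unfolding sum_k unfolding sum_n infsum_cmult_right' .
  \<comment> \<open>The expansion has carried 1/2 - 1/w_k along. The constants sum to 0 by
    \<open>rbin_real_sums_0\<close>, while in \<open>hs3\<close> the terms 1/w_k produce the Gamma
    quotient of index 0.\<close>
  have hs2: "((\<lambda>k. - complex_of_real (rbin s k) / 2) has_sum (- 0) / 2) UNIV"
  proof (intro has_sum_divide_const norm_summable_imp_has_sum)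
    show "summable (\<lambda>n. norm (- complex_of_real (rbin s n)))" using rbin_real_abs_summable[OF s] by simp
    show "(\<lambda>x. - complex_of_real (rbin s x)) sums - 0"
      using rbin_real_sums_0[OF s] sums_of_real_iff[of "rbin s" 0, where ?'a = complex]
      by (intro sums_minus) simp
  qed
  have wc: "complex_of_real (w k) = (of_real s / 2 - \<i> * of_real 0 + of_nat k) * (4 * of_real L)" for k
    by (simp add: w_def algebra_simps)
  have hs3: "((\<lambda>k. complex_of_real (rbin s k) / of_real (w k)) has_sum
     (Gamma (1 - of_real s) * gam_ratio (of_real s) 0 / (4 * of_real L))) UNIV"
    unfolding wc divide_divide_eq_left[symmetric] by (intro has_sum_divide_const pf)
  have "((\<lambda>k. complex_of_real (rbin s k * (1 / (exp (w k) - 1) + 1 / 2 - 1 / w k)) + - complex_of_real (rbin s k) / 2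
       + complex_of_real (rbin s k) / of_real (w k)) has_sum
     (Gamma (1 - of_real s) / (4 * of_real L) *
     (\<Sum>\<^sub>\<infinity>n. gam_ratio (of_real s) (y n) + gam_ratio (of_real s) (- y n)) + (- 0) / 2
     + Gamma (1 - of_real s) * gam_ratio (of_real s) 0 / (4 * of_real L))) UNIV"
    by (intro has_sum_add hs1 hs2 hs3)
  moreover have "complex_of_real (rbin s k * (1 / (exp (w k) - 1) + 1 / 2 - 1 / w k)) + - complex_of_real (rbin s k) / 2
       + complex_of_real (rbin s k) / of_real (w k) = rbin (of_real s) k / (exp (2 * of_real L * (of_real s + 2 * of_nat k)) - 1)" for k
  proof -
    have "exp (2 * of_real L * (of_real s + 2 * of_nat k)) = complex_of_real (exp (w k))"
      by (simp add: w_def exp_of_real[symmetric])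
    thus ?thesis by (simp add: rbin_of_real algebra_simps)
  qed
  ultimately show ?thesis
    unfolding csch_series_def by (simp add: infsumI algebra_simps)
qed

section \<open>Sums over the nonzero integers and their comparison powers\<close>

lemma summable_on_int_powr:
  assumes "a < -1"
  shows "(\<lambda>m::int. \<bar>real_of_int m\<bar> powr a) summable_on (UNIV - {0})"
proof -
  have nat: "(\<lambda>n::nat. real n powr a) summable_on {0<..}"
  proof (rule summable_on_subset_banach)
    show "(\<lambda>n::nat. real n powr a) summable_on UNIV"
      using assms by (subst summable_on_UNIV_nonneg_real_iff) (auto simp: summable_real_powr_iff)
  qed auto
  have bij1: "bij_betw int {0<..} {0<..}" by (rule bij_betwI[of _ _ _ nat]) auto
  have bij2: "bij_betw (\<lambda>n. - int n) {0<..} {..<0}" by (rule bij_betwI[of _ _ _ "\<lambda>m. nat (-m)"]) auto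
  have "(\<lambda>m::int. \<bar>real_of_int m\<bar> powr a) summable_on {0<..}"
    using summable_on_reindex_bij_betw[OF bij1, of "\<lambda>m::int. \<bar>real_of_int m\<bar> powr a"] nat by simp
  moreover have "(\<lambda>m::int. \<bar>real_of_int m\<bar> powr a) summable_on {..<0}"
    using summable_on_reindex_bij_betw[OF bij2, of "\<lambda>m::int. \<bar>real_of_int m\<bar> powr a"] nat by simp
  ultimately have "(\<lambda>m::int. \<bar>real_of_int m\<bar> powr a) summable_on ({0<..} \<union> {..<0})"
    by (intro summable_on_Un_disjoint) auto
  also have "{0<..} \<union> {..<0} = UNIV - {0::int}" by auto
  finally show ?thesis .
qed

lemma infsum_int_nonzero_pairs:
  fixes f :: "int \<Rightarrow> complex"
  assumes "f summable_on (UNIV - {0})"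
  shows "infsum f (UNIV - {0}) = (\<Sum>\<^sub>\<infinity>n::nat. f (int (Suc n)) + f (- int (Suc n)))"
proof -
  have split: "UNIV - {0::int} = {0<..} \<union> {..<0}" by auto
  have bij1: "bij_betw (\<lambda>n. int (Suc n)) UNIV {0<..}" by (rule bij_betwI[of _ _ _ "\<lambda>m. nat (m - 1)"]) auto
  have bij2: "bij_betw (\<lambda>n. - int (Suc n)) UNIV {..<0}" by (rule bij_betwI[of _ _ _ "\<lambda>m. nat (- m - 1)"]) auto
  have s: "f summable_on {0<..}" "f summable_on {..<0}"
    by (rule summable_on_subset_banach[OF assms]; auto)+
  have "infsum f (UNIV - {0}) = infsum f {0<..} + infsum f {..<0}"
    unfolding split using s by (intro infsum_Un_disjoint) auto
  also have "\<dots> = (\<Sum>\<^sub>\<infinity>n. f (int (Suc n))) + (\<Sum>\<^sub>\<infinity>n. f (- int (Suc n)))"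
    using infsum_reindex_bij_betw[OF bij1, of f] infsum_reindex_bij_betw[OF bij2, of f] by simp
  also have "\<dots> = (\<Sum>\<^sub>\<infinity>n::nat. f (int (Suc n)) + f (- int (Suc n)))"
    using s summable_on_reindex_bij_betw[OF bij1, of f] summable_on_reindex_bij_betw[OF bij2, of f]
    by (intro infsum_add[symmetric]) auto
  finally show ?thesis .
qed

definition pow_term :: "complex \<Rightarrow> real \<Rightarrow> complex" where
  "pow_term s y = exp ((s - 1) * Ln (- \<i> * of_real y))"

lemma Ln_minus_i_times:
  assumes "y \<noteq> 0"
  shows "Ln (- \<i> * of_real y) = of_real (ln \<bar>y\<bar>) - \<i> * of_real (pi / 2 * sgn y)"
proof (cases "y > 0")
  case True
  have "Ln (of_real y * (- \<i>)) = of_real (ln y) + Ln (- \<i>)"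
    using True Ln_times_of_real[of y "- \<i>"] by (simp add: Ln_of_real)
  thus ?thesis using True by (simp add: mult.commute)
next
  case False
  hence "Ln (of_real (- y) * \<i>) = of_real (ln (- y)) + Ln \<i>"
    using assms Ln_times_of_real[of "- y" "\<i>"] Ln_of_real[of "- y"] by simp
  thus ?thesis using False assms by (simp add: mult.commute)
qed

text \<open>|(-iy)^(s-1)| is |y|^(Re s - 1) times exp(pi/2 Im s sgn y), and the second factor is
  bounded for |s| <= R. The difference gains two powers of |y| from \<open>Gamma_ratio_asymp\<close>
  with b = (s-1)/2.\<close>

lemma gam_ratio_asymp:
  assumes "R \<ge> 0"
  shows "\<exists>C>0. \<exists>Y\<ge>1. \<forall>s y. norm s \<le> R \<longrightarrow> \<bar>y\<bar> \<ge> Y \<longrightarrow>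
    norm (pow_term s y) \<le> C * \<bar>y\<bar> powr (Re s - 1) \<and>
    norm (gam_ratio s y - pow_term s y) \<le> C * \<bar>y\<bar> powr (Re s - 3)"
proof -
  obtain C Y where C: "C > 0" and Y: "Y \<ge> 1" and bd: "\<And>b y. norm b \<le> R + 1 \<Longrightarrow> \<bar>y\<bar> \<ge> Y \<Longrightarrow>
    norm (Gamma (1/2 + b - \<i> * of_real y) * rGamma (1/2 - b - \<i> * of_real y)
       * exp (- 2 * b * Ln (- \<i> * of_real y)) - 1) \<le> C / y\<^sup>2"
    using Gamma_ratio_asymp[of "R + 1"] assms by auto
  define C' where "C' = exp (pi / 2 * R)"
  have C': "C' > 0" by (simp add: C'_def)
  have main: "norm (pow_term s y) \<le> C' * \<bar>y\<bar> powr (Re s - 1) \<and>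
    norm (gam_ratio s y - pow_term s y) \<le> (C * C') * \<bar>y\<bar> powr (Re s - 3)"
    if s: "norm s \<le> R" and y: "\<bar>y\<bar> \<ge> Y" for s y
  proof
    have y0: "y \<noteq> 0" using y Y by auto
    have "norm (pow_term s y) = exp ((Re s - 1) * ln \<bar>y\<bar> + Im s * (pi / 2 * sgn y))"
      unfolding pow_term_def Ln_minus_i_times[OF y0] by simp
    also have "\<dots> = \<bar>y\<bar> powr (Re s - 1) * exp (Im s * (pi / 2 * sgn y))"
      using y0 by (simp add: exp_add powr_def)
    finally have norm_pt: "norm (pow_term s y) = \<bar>y\<bar> powr (Re s - 1) * exp (Im s * (pi / 2 * sgn y))" .
    have "Im s * (pi / 2 * sgn y) \<le> \<bar>Im s * (pi / 2 * sgn y)\<bar>" by simp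
    also have "\<dots> = pi / 2 * \<bar>Im s\<bar>" using y0 by (simp add: abs_mult)
    also have "\<dots> \<le> pi / 2 * R" using abs_Im_le_cmod[of s] s by (intro mult_left_mono) auto
    finally have "exp (Im s * (pi / 2 * sgn y)) \<le> C'" by (simp add: C'_def)
    from mult_left_mono[OF this, of "\<bar>y\<bar> powr (Re s - 1)"]
    show pt: "norm (pow_term s y) \<le> C' * \<bar>y\<bar> powr (Re s - 1)"
      unfolding norm_pt by (simp add: mult.commute)
    define b where "b = (s - 1) / 2"
    have "norm b \<le> R + 1"
      using norm_triangle_ineq4[of s 1] s assms by (simp add: b_def norm_divide)
    from bd[OF this y] have err: "norm (gam_ratio s y * exp (- (s - 1) * Ln (- \<i> * of_real y)) - 1) \<le> C / y\<^sup>2"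
      by (simp add: b_def gam_ratio_def diff_divide_distrib add_divide_distrib algebra_simps)
    have eq: "gam_ratio s y - pow_term s y = pow_term s y * (gam_ratio s y * exp (- (s - 1) * Ln (- \<i> * of_real y)) - 1)"
    proof -
      have "pow_term s y * exp (- (s - 1) * Ln (- \<i> * of_real y)) = 1"
        unfolding pow_term_def by (simp flip: exp_add add: algebra_simps)
      thus ?thesis by (simp add: algebra_simps)
    qed
    have le: "norm (gam_ratio s y - pow_term s y) \<le> (C' * \<bar>y\<bar> powr (Re s - 1)) * (C / y\<^sup>2)"
      unfolding eq norm_mult using C' by (intro mult_mono pt err) auto
    have "\<bar>y\<bar> powr (Re s - 1) / y\<^sup>2 = \<bar>y\<bar> powr (Re s - 3)"
    proof -
      have "Re s - 3 = Re s - 1 - real 2" by simp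
      thus ?thesis using y0 by (simp only: powr_diff powr_realpow) (simp add: powr_realpow[of "\<bar>y\<bar>" 2, simplified])
    qed
    hence "(C' * \<bar>y\<bar> powr (Re s - 1)) * (C / y\<^sup>2) = (C * C') * \<bar>y\<bar> powr (Re s - 3)"
      by (metis (no_types, lifting) mult.assoc mult.commute times_divide_eq_right)
    with le show "norm (gam_ratio s y - pow_term s y) \<le> (C * C') * \<bar>y\<bar> powr (Re s - 3)" by simp
  qed
  have max: "norm (pow_term s y) \<le> max C' (C * C') * \<bar>y\<bar> powr (Re s - 1) \<and>
      norm (gam_ratio s y - pow_term s y) \<le> max C' (C * C') * \<bar>y\<bar> powr (Re s - 3)"
    if "norm s \<le> R" "\<bar>y\<bar> \<ge> Y" for s y
  proof
    show "norm (pow_term s y) \<le> max C' (C * C') * \<bar>y\<bar> powr (Re s - 1)"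
      by (rule order.trans[OF conjunct1[OF main[OF that]]]) (intro mult_right_mono, auto)
    show "norm (gam_ratio s y - pow_term s y) \<le> max C' (C * C') * \<bar>y\<bar> powr (Re s - 3)"
      by (rule order.trans[OF conjunct2[OF main[OF that]]]) (intro mult_right_mono, auto)
  qed
  show ?thesis
    by (rule exI[of _ "max C' (C * C')"], rule conjI, use C' in simp, rule exI[of _ Y])
       (use Y max in auto)
qed

text \<open>Applied with e = 1 to the bare powers, which gives convergence for Re s < 0, and with e
  = 3 to the differences, which gives it for Re s < 2.\<close>

lemma holomorphic_on_int_series:
  fixes g :: "complex \<Rightarrow> real \<Rightarrow> complex"
  assumes L: "L > 0" and S: "open S" "S \<subseteq> {s. Re s < e - 1}"
    and hol: "\<And>m. m \<noteq> 0 \<Longrightarrow> (\<lambda>s. g s (pi * of_int m / (2 * L))) holomorphic_on S"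
    and bound: "\<And>R. R \<ge> 0 \<Longrightarrow> \<exists>C>0. \<exists>Y\<ge>1. \<forall>s y. norm s \<le> R \<longrightarrow> \<bar>y\<bar> \<ge> Y \<longrightarrow>
       norm (g s y) \<le> C * \<bar>y\<bar> powr (Re s - e)"
  shows "(\<lambda>s. \<Sum>\<^sub>\<infinity>m\<in>UNIV-{0}. g s (pi * of_int m / (2 * L))) holomorphic_on S"
    and "\<And>s. s \<in> S \<Longrightarrow> (\<lambda>m::int. g s (pi * of_int m / (2 * L))) summable_on (UNIV - {0})"
proof -
  have bd: "\<exists>r>0. \<exists>F M. cball z r \<subseteq> S \<and> finite F \<and> M summable_on (UNIV - {0} - F) \<and>
      (\<forall>m\<in>UNIV - {0} - F. \<forall>s\<in>cball z r. norm (g s (pi * of_int m / (2 * L))) \<le> M m)" if z: "z \<in> S" for z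
  proof -
    obtain r where r: "r > 0" "cball z r \<subseteq> S" using S(1) z open_contains_cball by blast
    obtain C Y where C: "C > 0" and Y: "Y \<ge> 1" and CY: "\<And>s y. norm s \<le> norm z + r \<Longrightarrow> \<bar>y\<bar> \<ge> Y \<Longrightarrow>
       norm (g s y) \<le> C * \<bar>y\<bar> powr (Re s - e)"
      using bound[of "norm z + r"] r(1) by (metis add_nonneg_nonneg less_imp_le norm_ge_zero)
    define c where "c = pi / (2 * L)"
    have c: "c > 0" using L by (simp add: c_def)
    define F where "F = {m::int. \<bar>m\<bar> \<le> \<lceil>Y / c\<rceil>}"
    \<comment> \<open>The largest exponent on the closed disc around z. It is below -1 because the
      rightmost point of the disc still lies in S.\<close>
    define a where "a = Re z + r - e"
    have "z + of_real r \<in> cball z r" using r(1) by (simp add: dist_norm)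
    with r(2) S(2) have "z + of_real r \<in> {s. Re s < e - 1}" by blast
    hence a: "a < -1" by (simp add: a_def)
    define M where "M = (\<lambda>m::int. C * c powr a * \<bar>real_of_int m\<bar> powr a)"
    have "finite F" by (rule finite_subset[of _ "{-\<lceil>Y / c\<rceil>..\<lceil>Y / c\<rceil>}"]) (auto simp: F_def)
    moreover have "M summable_on (UNIV - {0} - F)"
      unfolding M_def by (intro summable_on_cmult_right summable_on_subset_banach[OF summable_on_int_powr[OF a]]) auto
    moreover have "norm (g s (pi * of_int m / (2 * L))) \<le> M m"
      if m: "m \<in> UNIV - {0} - F" and s: "s \<in> cball z r" for m s
    proof -
      have y: "pi * of_int m / (2 * L) = c * of_int m" by (simp add: c_def)
      have "\<bar>of_int m\<bar> \<ge> Y / c" using m unfolding F_def by (simp add: ceiling_less_iff) linarith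
      hence yY: "\<bar>c * of_int m\<bar> \<ge> Y" using c by (simp add: abs_mult field_simps)
      have "norm s \<le> norm z + r"
        using s norm_triangle_ineq2[of s z] by (simp add: dist_norm norm_minus_commute)
      from CY[OF this yY] have "norm (g s (c * of_int m)) \<le> C * \<bar>c * of_int m\<bar> powr (Re s - e)" .
      also have "\<dots> \<le> C * \<bar>c * of_int m\<bar> powr a"
      proof (intro mult_left_mono powr_mono)
        have "Re s - Re z \<le> norm (s - z)" using complex_Re_le_cmod[of "s - z"] by simp
        thus "Re s - e \<le> a" using s by (simp add: a_def dist_norm norm_minus_commute)
      qed (use yY Y C in auto)
      also have "\<dots> = M m" using c by (simp add: M_def abs_mult powr_mult)
      finally show ?thesis by (simp only: y)
    qed
    ultimately show ?thesis using r by (intro exI[of _ r] conjI exI[of _ F] exI[of _ M]) auto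
  qed
  show "(\<lambda>s. \<Sum>\<^sub>\<infinity>m\<in>UNIV-{0}. g s (pi * of_int m / (2 * L))) holomorphic_on S"
    by (rule holomorphic_on_infsum[OF S(1) _ bd]) (use hol in auto)
  show "(\<lambda>m::int. g s (pi * of_int m / (2 * L))) summable_on (UNIV - {0})" if "s \<in> S" for s
    by (rule holomorphic_on_infsum(2)[OF S(1) _ bd that]) (use hol in auto)
qed

text \<open>The second claim keeps the real points, above all 0, in the domain of the sums over m
  nonzero: at such points only the omitted quotient of index 0 can be singular.\<close>

lemma gam_ratio_pole_in_csch_poles:
  assumes L: "L > 0" and "s / 2 - \<i> * of_real (pi * of_int m / (2 * L)) \<in> \<int>\<^sub>\<le>\<^sub>0"
  shows "s \<in> csch_poles L" and "m \<noteq> 0 \<Longrightarrow> s \<notin> \<real>"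
proof -
  obtain k :: nat where k: "s / 2 - \<i> * of_real (pi * of_int m / (2 * L)) = - of_nat k"
    using assms(2) by (elim nonpos_Ints_cases')
  hence "s / 2 = \<i> * of_real (pi * of_int m / (2 * L)) - of_nat k" by (simp add: algebra_simps)
  hence "s = 2 * (\<i> * of_real (pi * of_int m / (2 * L)) - of_nat k)"
    by (metis nonzero_mult_div_cancel_left times_divide_eq_right zero_neq_numeral)
  also have "\<dots> = \<i> * of_real (pi * of_int m / L) - 2 * of_nat k"
    by (simp add: algebra_simps)
  finally have s: "s = \<i> * of_real (pi * of_int m / L) - 2 * of_nat k" .
  thus "s \<in> csch_poles L" unfolding csch_poles_def by blast
  show "s \<notin> \<real>" if "m \<noteq> 0" using that L by (simp add: s complex_is_Real_iff)
qed

lemma holomorphic_on_gam_ratio: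
  assumes "L > 0"
  shows "(\<lambda>s. gam_ratio s (pi * of_int m / (2 * L))) holomorphic_on - csch_poles L"
    and "m \<noteq> 0 \<Longrightarrow> (\<lambda>s. gam_ratio s (pi * of_int m / (2 * L))) holomorphic_on - (csch_poles L - \<real>)"
  unfolding gam_ratio_def using gam_ratio_pole_in_csch_poles[OF assms]
  by (intro holomorphic_intros; blast)+

lemma holomorphic_on_pow_term: "(\<lambda>s. pow_term s y) holomorphic_on A"
  unfolding pow_term_def by (intro holomorphic_intros)

lemma open_Re_less_Diff_csch_poles:
  assumes "L > 0"
  shows "open ({s. Re s < c} - csch_poles L)"
  using closed_csch_poles[OF assms] by (intro open_Diff open_halfspace_Re_lt)

definition gam_tail :: "real \<Rightarrow> complex \<Rightarrow> complex" where
  "gam_tail L s = (\<Sum>\<^sub>\<infinity>m\<in>UNIV-{0}. gam_ratio s (pi * of_int m / (2 * L)) - pow_term s (pi * of_int m / (2 * L)))"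

text \<open>The subtraction lowers the decay exponent by 2 and moves the border of convergence from
  Re s = 0 to Re s = 2. Holomorphy at the real points of the pole set is used at s = 0.\<close>

lemma
  assumes L: "L > 0"
  shows holomorphic_on_gam_tail: "gam_tail L holomorphic_on {s. Re s < 2} - (csch_poles L - \<real>)"
    and summable_gam_tail: "\<And>s. Re s < 2 \<Longrightarrow> s \<notin> csch_poles L \<Longrightarrow>
      (\<lambda>m::int. gam_ratio s (pi * of_int m / (2 * L)) - pow_term s (pi * of_int m / (2 * L))) summable_on (UNIV - {0})"
proof -
  let ?g = "\<lambda>s y. gam_ratio s y - pow_term s y"
  let ?S = "{s. Re s < 2} - (csch_poles L - \<real>)"
  have op: "open ?S"
    by (intro open_Diff open_halfspace_Re_lt closed_subset_csch_poles[OF L]) auto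
  have 1: "?S \<subseteq> {s. Re s < 3 - 1}" by auto
  have 2: "(\<lambda>s. ?g s (pi * of_int m / (2 * L))) holomorphic_on ?S" if "m \<noteq> 0" for m
    using that by (intro holomorphic_intros holomorphic_on_pow_term holomorphic_on_subset[OF holomorphic_on_gam_ratio(2)[OF L]]) auto
  have 3: "\<exists>C>0. \<exists>Y\<ge>1. \<forall>s y. norm s \<le> R \<longrightarrow> \<bar>y\<bar> \<ge> Y \<longrightarrow> norm (?g s y) \<le> C * \<bar>y\<bar> powr (Re s - 3)"
    if "R \<ge> 0" for R
    using gam_ratio_asymp[OF that] by meson
  show "gam_tail L holomorphic_on ?S"
    unfolding gam_tail_def
    by (rule holomorphic_on_int_series(1)[where g = ?g and e = 3, OF L op 1 2 3])
  show "(\<lambda>m::int. ?g s (pi * of_int m / (2 * L))) summable_on (UNIV - {0})" if "Re s < 2" "s \<notin> csch_poles L" for s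
    by (rule holomorphic_on_int_series(2)[where g = ?g and e = 3, OF L op 1 2 3])
       (use that in auto)
qed

lemma
  assumes L: "L > 0"
  shows holomorphic_on_pow_term_sum:
      "(\<lambda>s. \<Sum>\<^sub>\<infinity>m\<in>UNIV-{0}. pow_term s (pi * of_int m / (2 * L))) holomorphic_on {s. Re s < 0}"
    and summable_pow_term: "\<And>s. Re s < 0 \<Longrightarrow>
      (\<lambda>m::int. pow_term s (pi * of_int m / (2 * L))) summable_on (UNIV - {0})"
proof -
  let ?S = "{s. Re s < 0}"
  have 1: "?S \<subseteq> {s. Re s < 1 - 1}" by auto
  have 2: "\<exists>C>0. \<exists>Y\<ge>1. \<forall>s y. norm s \<le> R \<longrightarrow> \<bar>y\<bar> \<ge> Y \<longrightarrow> norm (pow_term s y) \<le> C * \<bar>y\<bar> powr (Re s - 1)"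
    if "R \<ge> 0" for R
    using gam_ratio_asymp[OF that] by meson
  show "(\<lambda>s. \<Sum>\<^sub>\<infinity>m\<in>UNIV-{0}. pow_term s (pi * of_int m / (2 * L))) holomorphic_on ?S"
    by (rule holomorphic_on_int_series(1)[where g = pow_term and e = 1,
          OF L open_halfspace_Re_lt 1 holomorphic_on_pow_term 2])
  show "(\<lambda>m::int. pow_term s (pi * of_int m / (2 * L))) summable_on (UNIV - {0})" if "Re s < 0" for s
    by (rule holomorphic_on_int_series(2)[where g = pow_term and e = 1,
          OF L open_halfspace_Re_lt 1 holomorphic_on_pow_term 2]) (use that in auto)
qed

lemma
  assumes L: "L > 0" and s: "Re s < 0" "s \<notin> csch_poles L"
  shows summable_gam_ratio: "(\<lambda>m::int. gam_ratio s (pi * of_int m / (2 * L))) summable_on (UNIV - {0})"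
    and infsum_gam_ratio: "(\<Sum>\<^sub>\<infinity>m\<in>UNIV-{0}. gam_ratio s (pi * of_int m / (2 * L))) =
       gam_tail L s + (\<Sum>\<^sub>\<infinity>m\<in>UNIV-{0}. pow_term s (pi * of_int m / (2 * L)))"
proof -
  have "Re s < 2" using s by simp
  note summ = summable_gam_tail[OF L this s(2)] summable_pow_term[OF L s(1)]
  show "(\<lambda>m::int. gam_ratio s (pi * of_int m / (2 * L))) summable_on (UNIV - {0})"
    using summable_on_add[OF summ] by simp
  show "(\<Sum>\<^sub>\<infinity>m\<in>UNIV-{0}. gam_ratio s (pi * of_int m / (2 * L))) =
       gam_tail L s + (\<Sum>\<^sub>\<infinity>m\<in>UNIV-{0}. pow_term s (pi * of_int m / (2 * L)))"
    using infsum_add[OF summ] by (simp add: gam_tail_def)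
qed

section \<open>Extension of the Gamma series identity to the left half plane\<close>

lemma connected_halfplane_Diff:
  assumes "countable C"
  shows "connected ({s. Re s < c} - C)"
  using assms by (intro connected_open_diff_countable open_halfspace_Re_lt convex_connected convex_halfspace_Re_lt) auto

lemma one_minus_notin_nonpos_Ints:
  assumes "Re s < 2" "s \<noteq> 1"
  shows "1 - s \<notin> \<int>\<^sub>\<le>\<^sub>0"
proof
  assume "1 - s \<in> \<int>\<^sub>\<le>\<^sub>0"
  then obtain k :: nat where k: "1 - s = - of_nat k" by (elim nonpos_Ints_cases')
  from arg_cong[OF this, of Re] assms(1) have "real k < 1" by simp
  hence "k = 0" by simp
  with k assms(2) show False by simp
qed

text \<open>Both sides are holomorphic on the left half plane without the pole set, which is
  connected because only countably many points are removed. They agree on the interval (-3, -2),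
  where the double sum could be interchanged.\<close>

lemma csch_series_eq_left:
  assumes L: "L > 0" and s: "Re s < 0" "s \<notin> csch_poles L"
  shows "csch_series L s = Gamma (1 - s) / (4 * of_real L) *
    (gam_ratio s 0 + (\<Sum>\<^sub>\<infinity>m\<in>UNIV-{0}. gam_ratio s (pi * of_int m / (2 * L))))"
proof -
  define S where "S = {s. Re s < 0} - csch_poles L"
  \<comment> \<open>The sum of Gamma quotients is written as \<open>gam_tail\<close> plus the sum of
    powers, two functions already known to be holomorphic.\<close>
  define g where "g = (\<lambda>s. Gamma (1 - s) / (4 * of_real L) *
    (gam_ratio s 0 + (gam_tail L s + (\<Sum>\<^sub>\<infinity>m\<in>UNIV-{0}. pow_term s (pi * of_int m / (2 * L))))))"
  have geq: "g s = Gamma (1 - s) / (4 * of_real L) *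
    (gam_ratio s 0 + (\<Sum>\<^sub>\<infinity>m\<in>UNIV-{0}. gam_ratio s (pi * of_int m / (2 * L))))" if "s \<in> S" for s
    using that unfolding g_def S_def by (subst infsum_gam_ratio[OF L]) auto
  have op: "open S" unfolding S_def by (rule open_Re_less_Diff_csch_poles[OF L])
  have nonpos: "1 - s \<notin> \<int>\<^sub>\<le>\<^sub>0" if "Re s < 0" for s
    using that by (intro one_minus_notin_nonpos_Ints) auto
  have g0: "(\<lambda>s. gam_ratio s 0) holomorphic_on S"
    using holomorphic_on_subset[OF holomorphic_on_gam_ratio(1)[OF L, of 0]] by (auto simp: S_def)
  have "g holomorphic_on S"
    unfolding g_def
    by (intro holomorphic_intros g0 holomorphic_on_subset[OF holomorphic_on_gam_tail[OF L]]
          holomorphic_on_subset[OF holomorphic_on_pow_term_sum[OF L]])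
       (use nonpos L in \<open>auto simp: S_def\<close>)
  moreover have "csch_series L holomorphic_on S"
    by (rule holomorphic_on_subset[OF csch_series_holomorphic(1)[OF L]]) (auto simp: S_def)
  ultimately have hol: "(\<lambda>s. csch_series L s - g s) holomorphic_on S" by (intro holomorphic_intros)
  have not_pole: "of_real x \<notin> csch_poles L" if "-3 < x" "x < -2" for x
  proof
    assume "of_real x \<in> csch_poles L"
    then obtain m k where "of_real x = \<i> * of_real (pi * of_int m / L) - 2 * of_nat k"
      by (auto simp: csch_poles_def)
    from arg_cong[OF this, of Re] have "x = - 2 * real k" by simp
    hence "real 2 < real (2 * k)" "real (2 * k) < real 3" using that by simp_all
    hence "2 < 2 * k" "2 * k < 3" by (simp_all only: of_nat_less_iff)
    thus False by presburger
  qed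
  have real: "csch_series L (of_real x) - g (of_real x) = 0" if x: "-3 < x" "x < -2" for x
  proof -
    have xS: "of_real x \<in> S" using not_pole[OF x] x by (simp add: S_def)
    have "(\<Sum>\<^sub>\<infinity>m\<in>UNIV-{0}. gam_ratio (of_real x) (pi * of_int m / (2 * L))) =
      (\<Sum>\<^sub>\<infinity>n::nat. gam_ratio (of_real x) (pi * of_int (int (Suc n)) / (2 * L)) +
          gam_ratio (of_real x) (pi * of_int (- int (Suc n)) / (2 * L)))"
      using xS by (intro infsum_int_nonzero_pairs summable_gam_ratio[OF L]) (auto simp: S_def)
    also have "\<dots> = (\<Sum>\<^sub>\<infinity>n::nat. gam_ratio (of_real x) (pi * real (Suc n) / (2 * L)) +
          gam_ratio (of_real x) (- (pi * real (Suc n) / (2 * L))))"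
      by (simp del: of_nat_Suc)
    finally show ?thesis unfolding geq[OF xS] csch_series_eq_real[OF x L] by simp
  qed
  have "csch_series L s - g s = 0"
  proof (rule analytic_continuation[where f = "\<lambda>s. csch_series L s - g s" and w = s and S = S
        and U = "of_real ` {-3<..<-2}" and \<xi> = "of_real (-5/2)"])
    show "connected S" unfolding S_def by (intro connected_halfplane_Diff countable_csch_poles)
    show "of_real ` {-3<..<-2} \<subseteq> S" using not_pole by (auto simp: S_def)
    show "of_real (-5/2) \<in> S" using not_pole[of "-5/2"] by (simp add: S_def)
    show "complex_of_real (-5/2) islimpt of_real ` {-3<..<-2}"
      unfolding islimpt_approachable
    proof safe
      fix e :: real assume e: "e > 0"
      define d where "d = min (e / 2) (1 / 4)"
      have d: "d > 0" "d < e" "d \<le> 1 / 4" using e by (auto simp: d_def)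
      have "complex_of_real (-5/2 + d) - of_real (-5/2) = of_real d" by simp
      hence "norm (complex_of_real (-5/2 + d) - of_real (-5/2)) = \<bar>d\<bar>" by (simp only: norm_of_real)
      hence "dist (complex_of_real (-5/2 + d)) (of_real (-5/2)) < e" using d by (simp only: dist_norm)
      moreover have "complex_of_real (-5/2 + d) \<noteq> of_real (-5/2)" using d by (simp only: of_real_eq_iff)
      moreover have "-5/2 + d \<in> {-3<..<-2}" using d by simp
      ultimately show "\<exists>x'\<in>of_real ` {-3<..<-2}. x' \<noteq> complex_of_real (-5/2) \<and> dist x' (of_real (-5/2)) < e"
        by blast
    qed
    show "csch_series L w - g w = 0" if "w \<in> of_real ` {-3<..<-2}" for w using that real by auto
  qed (use op s hol in \<open>auto simp: S_def\<close>)
  thus ?thesis using geq[of s] s by (simp add: S_def)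
qed

text \<open>The functional equation in disguise: on the left half plane zeta is given by \<open>zeta_left\<close>, and there by
  \<open>zeta_via L\<close> for every \<open>L\<close>.\<close>
definition zeta_left :: "complex \<Rightarrow> complex" where
  "zeta_left s = Gamma (1 - s) * (\<Sum>\<^sub>\<infinity>m::int\<in>UNIV-{0}. pow_term s (2 * pi * of_int m))"

text \<open>The identity claimed for 1 < Re s < 2, without the factor q^(s/2), solved for its zeta
  term.\<close>

definition zeta_via :: "real \<Rightarrow> complex \<Rightarrow> complex" where
  "zeta_via L s = of_real (4 * L) powr s *
     (csch_series L s - Gamma (1 - s) / (4 * of_real L) * (gam_ratio s 0 + gam_tail L s))"

lemma holomorphic_on_zeta_left: "zeta_left holomorphic_on {s. Re s < 0}"
proof -
  have "1 - s \<notin> \<int>\<^sub>\<le>\<^sub>0" if "Re s < 0" for s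
    using that by (intro one_minus_notin_nonpos_Ints) auto
  thus ?thesis
    using holomorphic_on_pow_term_sum[of "1/4"] unfolding zeta_left_def
    by (intro holomorphic_intros) (auto simp: mult_ac)
qed

lemma holomorphic_on_zeta_via:
  assumes L: "L > 0"
  shows "zeta_via L holomorphic_on {s. Re s < 2} - insert 1 (csch_poles L)"
proof -
  have "(\<lambda>s. gam_ratio s 0) holomorphic_on {s. Re s < 2} - insert 1 (csch_poles L)"
    by (rule holomorphic_on_subset[of _ "- csch_poles L"]) (use holomorphic_on_gam_ratio(1)[OF L, of 0] in auto)
  thus ?thesis unfolding zeta_via_def
    by (intro holomorphic_intros holomorphic_on_subset[OF holomorphic_on_gam_tail[OF L]]
          holomorphic_on_subset[OF csch_series_holomorphic(1)[OF L]])
       (use one_minus_notin_nonpos_Ints L in auto)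
qed

text \<open>Only the powers survive the subtraction, and (4L)^(s-1) (-i pi m/(2L))^(s-1) = (-2 pi i
  m)^(s-1). Scaling by a positive number respects the principal branch, so L disappears.\<close>

lemma zeta_via_eq_zeta_left:
  assumes L: "L > 0" and s: "Re s < 0" "s \<notin> csch_poles L"
  shows "zeta_via L s = zeta_left s"
proof -
  have pt: "of_real (4 * L) powr s / (4 * of_real L) * pow_term s (pi * of_int m / (2 * L)) = pow_term s (2 * pi * of_int m)"
    if "m \<noteq> 0" for m :: int
  proof -
    define x where "x = 2 * pi * of_int m"
    have x: "x \<noteq> 0" using that by (simp add: x_def)
    have y: "pi * of_int m / (2 * L) = x / (4 * L)" using L by (simp add: x_def field_simps)
    have ln: "ln \<bar>x / (4 * L)\<bar> = ln \<bar>x\<bar> - ln (4 * L)" using x L by (simp add: abs_mult ln_div)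
    have sgn: "sgn (x / (4 * L)) = sgn x" using L by (simp add: sgn_mult sgn_divide)
    have p1: "pow_term s x = exp ((s - 1) * (of_real (ln \<bar>x\<bar>) - \<i> * of_real (pi / 2 * sgn x)))"
      unfolding pow_term_def Ln_minus_i_times[OF x] ..
    have y0: "x / (4 * L) \<noteq> 0" using x L by simp
    have p2: "pow_term s (x / (4 * L)) = exp ((s - 1) * (of_real (ln \<bar>x\<bar>) - of_real (ln (4 * L)) - \<i> * of_real (pi / 2 * sgn x)))"
      unfolding pow_term_def Ln_minus_i_times[OF y0] ln sgn by simp
    have "of_real (4 * L) powr s / (4 * of_real L) = of_real (4 * L) powr (s - 1)"
      using L by (simp add: powr_diff)
    also have "\<dots> = exp ((s - 1) * of_real (ln (4 * L)))"
      using L Ln_of_real[of "4 * L"] by (simp add: powr_def del: of_real_mult)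
    finally show ?thesis unfolding y x_def[symmetric] p1 p2
      by (simp add: algebra_simps flip: exp_add)
  qed
  have "zeta_via L s = of_real (4 * L) powr s * (Gamma (1 - s) / (4 * of_real L) *
     (\<Sum>\<^sub>\<infinity>m\<in>UNIV-{0}. pow_term s (pi * of_int m / (2 * L))))"
    unfolding zeta_via_def csch_series_eq_left[OF L s] infsum_gam_ratio[OF L s]
    by (simp add: algebra_simps add_divide_distrib)
  also have "\<dots> = Gamma (1 - s) * (\<Sum>\<^sub>\<infinity>m\<in>UNIV-{0}. of_real (4 * L) powr s / (4 * of_real L) * pow_term s (pi * of_int m / (2 * L)))"
    unfolding infsum_cmult_right' by simp
  also have "\<dots> = zeta_left s"
    unfolding zeta_left_def using pt by (intro arg_cong[of _ _ "\<lambda>x. _ * x"] infsum_cong) auto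
  finally show ?thesis .
qed

text \<open>Identity theorem: both functions equal \<open>zeta_left\<close> off countably many
  points of the left half plane, and removing countably many points leaves the larger half plane
  connected.\<close>

lemma zeta_via_unique:
  assumes "L > 0" "L' > 0" and s: "Re s < 2" "s \<noteq> 1" "s \<notin> csch_poles L" "s \<notin> csch_poles L'"
  shows "zeta_via L s = zeta_via L' s"
proof -
  define P where "P = csch_poles L \<union> csch_poles L'"
  have P: "closed P" "countable P"
    using closed_csch_poles assms countable_csch_poles by (auto simp: P_def)
  define S where "S = {s. Re s < 2} - insert 1 P"
  define U where "U = {s. Re s < 0} - P"
  have "open S" unfolding S_def using P by (intro open_Diff open_halfspace_Re_lt closed_insert) auto
  moreover have "open U" unfolding U_def using P by (intro open_Diff open_halfspace_Re_lt)
  moreover have "connected S" unfolding S_def by (intro connected_halfplane_Diff) (use P in auto)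
  moreover have "U \<noteq> {}"
  proof
    assume "U = {}"
    hence "{s. Re s < 0} \<subseteq> P" by (auto simp: U_def)
    hence "countable {s. Re s < 0}" using P countable_subset by blast
    moreover have "ball (-1) 1 \<subseteq> {s. Re s < 0}"
    proof
      fix s :: complex assume "s \<in> ball (-1) 1"
      hence "norm (s + 1) < 1" by (simp add: dist_norm norm_minus_commute add.commute)
      thus "s \<in> {s. Re s < 0}" using complex_Re_le_cmod[of "s + 1"] by simp
    qed
    ultimately have "countable (ball (-1) 1 :: complex set)" by (rule countable_subset[rotated])
    thus False using uncountable_ball[of 1 "-1 :: complex"] by simp
  qed
  moreover have "U \<subseteq> S" by (auto simp: U_def S_def)
  moreover have "zeta_via L holomorphic_on S" "zeta_via L' holomorphic_on S"
    by (rule holomorphic_on_subset[OF holomorphic_on_zeta_via]; use assms in \<open>auto simp: S_def P_def\<close>)+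
  moreover have "zeta_via L z = zeta_via L' z" if "z \<in> U" for z
    using that assms(1,2) by (simp add: zeta_via_eq_zeta_left U_def P_def)
  moreover have "s \<in> S" using s by (simp add: S_def P_def)
  ultimately show ?thesis
    using analytic_continuation_open[of U S "zeta_via L" "zeta_via L'" s] by blast
qed

section \<open>The Dirichlet series and the local behaviour at the poles\<close>

lemma sinh_ge_self:
  fixes x :: real
  assumes "x \<ge> 0"
  shows "x \<le> sinh x"
proof -
  have "sinh 0 - 0 \<le> sinh x - x"
    by (rule DERIV_nonneg_imp_nondecreasing[OF assms])
       (auto intro!: exI derivative_eq_intros simp: cosh_real_ge_1)
  thus ?thesis by simp
qed

lemma two_sinh_powr:
  fixes x :: real and s :: complex
  assumes "x > 0"
  shows "of_real (2 * sinh x) powr (- s) = exp (- s * of_real x) * (1 - of_real (exp (- 2 * x))) powr (- s)"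
proof -
  have e: "exp (- 2 * x) < 1" using assms by simp
  have eq: "2 * sinh x = exp x * (1 - exp (- 2 * x))"
    by (simp add: sinh_def algebra_simps flip: exp_add)
  have "of_real (2 * sinh x) powr (- s) = exp (- s * of_real (ln (2 * sinh x)))"
    using assms Ln_of_real[of "2 * sinh x"] by (simp add: powr_def del: of_real_mult)
  also have "ln (2 * sinh x) = x + ln (1 - exp (- 2 * x))"
    unfolding eq using e by (subst ln_mult) auto
  also have "exp (- s * of_real (x + ln (1 - exp (- 2 * x)))) =
      exp (- s * of_real x) * exp (- s * of_real (ln (1 - exp (- 2 * x))))"
    by (simp add: algebra_simps flip: exp_add)
  also have "exp (- s * of_real (ln (1 - exp (- 2 * x)))) = of_real (1 - exp (- 2 * x)) powr (- s)"
    using e Ln_of_real[of "1 - exp (- 2 * x)"] by (simp add: powr_def del: of_real_diff)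
  finally show ?thesis by simp
qed

lemma csch_series_eq_dirichlet:
  assumes L: "L > 0" and s: "Re s > 0"
  shows "((\<lambda>n. of_real (2 * sinh (2 * real (Suc n) * L)) powr (- s)) has_sum csch_series L s) UNIV"
proof -
  define x where "x = (\<lambda>n::nat. 2 * real (Suc n) * L)"
  define F where "F = (\<lambda>n k. rbin s k * exp (- (s + 2 * of_nat k) * of_real (x n)))"
  define R where "R = norm s"
  have R: "R \<ge> 0" by (simp add: R_def)
  have x: "x n \<ge> 2 * L" "x n > 0" for n
    using L mult_left_mono[of 1 "real (Suc n)" "2 * L"] by (simp_all add: x_def mult_ac)
  \<comment> \<open>Using x_n >= 2L in the factor that depends on k decouples the indices: the
    double series is dominated by a geometric series times a binomial series.\<close>
  have F_bound: "norm (F n k) \<le> exp (- 2 * Re s * L) ^ Suc n * (rbin R k * exp (- 4 * L) ^ k)" for n k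
  proof -
    have "norm (exp (- (s + 2 * of_nat k) * of_real (x n))) = exp (- Re s * x n) * exp (- 2 * real k * x n)"
      by (simp add: algebra_simps flip: exp_add)
    also have "exp (- Re s * x n) = exp (- 2 * Re s * L) ^ Suc n"
      unfolding exp_of_nat_mult[symmetric] by (simp add: x_def algebra_simps)
    also have "exp (- 2 * real k * x n) \<le> exp (- 4 * L) ^ k"
    proof -
      have "real k * (2 * (2 * L)) \<le> real k * (2 * x n)" using x(1)[of n] by (intro mult_left_mono) auto
      thus ?thesis by (simp add: mult_ac flip: exp_of_nat_mult)
    qed
    finally have "norm (exp (- (s + 2 * of_nat k) * of_real (x n))) \<le> exp (- 2 * Re s * L) ^ Suc n * exp (- 4 * L) ^ k"
      by (simp add: mult_left_mono)
    hence "norm (F n k) \<le> rbin R k * (exp (- 2 * Re s * L) ^ Suc n * exp (- 4 * L) ^ k)"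
      unfolding F_def norm_mult using norm_rbin_le[of s R k] rbin_nonneg[OF R, of k]
      by (intro mult_mono) (auto simp: R_def)
    thus ?thesis by (simp only: mult_ac)
  qed
  have s1: "summable (\<lambda>n. exp (- 2 * Re s * L) ^ Suc n)"
  proof -
    have "exp (- 2 * Re s * L) < 1" using L s by simp
    thus ?thesis by (subst summable_Suc_iff) (intro summable_geometric, simp)
  qed
  have s2: "summable (\<lambda>k. rbin R k * exp (- 4 * L) ^ k)"
  proof -
    have "exp (- 4 * L) < 1" using L by simp
    thus ?thesis by (intro sums_summable[OF rbin_sums_real]) auto
  qed
  have "(\<lambda>(n, k). exp (- 2 * Re s * L) ^ Suc n * (rbin R k * exp (- 4 * L) ^ k)) summable_on UNIV \<times> UNIV"
  proof (rule summable_on_Times_mult)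
    show "(\<lambda>n. exp (- 2 * Re s * L) ^ Suc n) summable_on UNIV"
      using s1 by (subst summable_on_UNIV_nonneg_real_iff) auto
    show "(\<lambda>k. rbin R k * exp (- 4 * L) ^ k) summable_on UNIV"
      using s2 rbin_nonneg[OF R] by (subst summable_on_UNIV_nonneg_real_iff) auto
  qed (use rbin_nonneg[OF R] in auto)
  hence summ: "(\<lambda>(n, k). F n k) summable_on UNIV \<times> UNIV"
  proof (rule abs_summable_summable[OF Infinite_Sum.abs_summable_on_comparison_test'])
    show "norm (case z of (n, k) \<Rightarrow> F n k) \<le>
       (case z of (n, k) \<Rightarrow> exp (- 2 * Re s * L) ^ Suc n * (rbin R k * exp (- 4 * L) ^ k))" for z
      by (cases z) (use F_bound in \<open>simp only: prod.case\<close>)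
  qed
  have sum_k: "(\<Sum>\<^sub>\<infinity>k. F n k) = of_real (2 * sinh (x n)) powr (- s)" for n
  proof (rule infsumI, rule norm_summable_imp_has_sum)
    show "summable (\<lambda>k. norm (F n k))"
      by (rule summable_comparison_test'[OF summable_mult[OF s2, of "exp (- 2 * Re s * L) ^ Suc n"]])
         (use F_bound[of n] in simp)
    have "(\<lambda>k. rbin s k * of_real (exp (- 2 * x n)) ^ k) sums (1 - of_real (exp (- 2 * x n))) powr (- s)"
      using x[of n] by (intro rbin_sums) (simp del: exp_of_real)
    from sums_mult[OF this, of "exp (- s * of_real (x n))"]
    have "(\<lambda>k. exp (- s * of_real (x n)) * (rbin s k * of_real (exp (- 2 * x n)) ^ k)) sums
       of_real (2 * sinh (x n)) powr (- s)"
      unfolding two_sinh_powr[OF x(2)] .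
    moreover have "exp (- s * of_real (x n)) * (rbin s k * of_real (exp (- 2 * x n)) ^ k) = F n k" for k
    proof -
      have "of_real (exp (- 2 * x n)) ^ k = exp (- 2 * of_nat k * complex_of_real (x n))"
        by (simp add: mult_ac flip: exp_of_nat_mult exp_of_real)
      thus ?thesis by (simp add: F_def algebra_simps flip: exp_add)
    qed
    ultimately show "F n sums of_real (2 * sinh (x n)) powr (- s)" by simp
  qed
  have sum_n: "(\<Sum>\<^sub>\<infinity>n. F n k) = rbin s k / (exp (2 * of_real L * (s + 2 * of_nat k)) - 1)" for k
  proof (rule infsumI, rule norm_summable_imp_has_sum)
    show "summable (\<lambda>n. norm (F n k))"
      by (rule summable_comparison_test'[OF summable_mult2[OF s1, of "rbin R k * exp (- 4 * L) ^ k"]])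
         (use F_bound[of _ k] in simp)
    define w where "w = 2 * of_real L * (s + 2 * of_nat k)"
    have "Re w > 0" using L s by (simp add: w_def add_pos_nonneg)
    hence "norm (exp (- w)) < 1" by simp
    from sums_mult[OF geometric_sums[OF this], of "rbin s k * exp (- w)"]
    have "(\<lambda>n. rbin s k * exp (- w) * exp (- w) ^ n) sums (rbin s k * exp (- w) * (1 / (1 - exp (- w))))" .
    moreover have "rbin s k * exp (- w) * exp (- w) ^ n = F n k" for n
      by (simp add: F_def w_def x_def algebra_simps flip: exp_of_nat_mult exp_add)
    moreover have "rbin s k * exp (- w) * (1 / (1 - exp (- w))) = rbin s k / (exp w - 1)"
    proof -
      have "exp w * (1 - exp (- w)) = exp w - 1" by (simp add: exp_minus algebra_simps)
      thus ?thesis by (simp add: exp_minus field_simps)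
    qed
    ultimately show "(\<lambda>n. F n k) sums (rbin s k / (exp w - 1))" by simp
  qed
  have "(\<lambda>n. \<Sum>\<^sub>\<infinity>k. F n k) summable_on UNIV"
    using summ by (intro summable_on_Sigma_banach) auto
  hence "((\<lambda>n. \<Sum>\<^sub>\<infinity>k. F n k) has_sum (\<Sum>\<^sub>\<infinity>n. \<Sum>\<^sub>\<infinity>k. F n k)) UNIV" by (rule has_sum_infsum)
  also have "(\<Sum>\<^sub>\<infinity>n. \<Sum>\<^sub>\<infinity>k. F n k) = csch_series L s"
    unfolding csch_series_def sum_n[symmetric] using summ by (intro infsum_swap_banach) auto
  finally show ?thesis unfolding sum_k x_def .
qed

text \<open>Within the grid spacing p is the only pole, and only the summand k0 is singular there;
  the others add up to a holomorphic function. The simple zero of the denominator then gives the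
  residue \<open>g p\<close>.\<close>

lemma csch_series_near_pole:
  assumes L: "L > 0" and p: "p = \<i> * of_real (pi * of_int m / L) - 2 * of_nat k0"
  shows "\<exists>r>0. \<exists>g. g holomorphic_on ball p r \<and> g p = rbin p k0 / (2 * of_real L) \<and> g p \<noteq> 0 \<and>
    (\<forall>s\<in>ball p r - {p}. s \<notin> csch_poles L \<and> csch_series L s = g s / (s - p))"
proof -
  define r where "r = min 2 (pi / L)"
  have r: "r > 0" using L by (simp add: r_def)
  have pP: "p \<in> csch_poles L" unfolding csch_poles_def p by blast
  have not_pole: "s \<notin> csch_poles L" if "s \<in> ball p r - {p}" for s
    using csch_poles_dist[OF L pP, of s] that by (auto simp: r_def dist_commute)
  define t where "t = (\<lambda>k (s::complex). rbin s k / (exp (2 * of_real L * (s + 2 * of_nat k)) - 1))"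
  have nz: "exp (2 * of_real L * (s + 2 * of_nat k)) \<noteq> 1" if s: "s \<in> ball p r" and k: "k \<noteq> k0" for s k
  proof
    assume e: "exp (2 * of_real L * (s + 2 * of_nat k)) = 1"
    from exp_eq_1_imp_csch_poles[OF L e] not_pole s have "s = p" by blast
    with exp_eq_1_imp_pole_form[OF L e] obtain n :: int
      where "p = \<i> * of_real (pi * of_int n / L) - 2 * of_nat k" by blast
    from arg_cong[OF this, of Re] have "real k0 = real k" by (simp add: p)
    with k show False by simp
  qed
  have hol: "t k holomorphic_on ball p r" if "k \<in> UNIV - {k0}" for k
    using nz that unfolding t_def by (intro holomorphic_intros) auto
  have bd: "\<exists>e>0. \<exists>F M. cball z e \<subseteq> ball p r \<and> finite F \<and> M summable_on (UNIV - {k0} - F) \<and>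
      (\<forall>k\<in>UNIV - {k0} - F. \<forall>s\<in>cball z e. norm (t k s) \<le> M k)" if z: "z \<in> ball p r" for z
  proof -
    obtain e where e: "e > 0" "cball z e \<subseteq> ball p r" using z open_contains_cball[of "ball p r"] by (metis open_ball)
    obtain F M where FM: "finite F" "M summable_on (UNIV - F)" "\<And>k s::complex. k \<in> UNIV - F \<Longrightarrow> norm s \<le> norm z + e \<Longrightarrow>
       norm (rbin s k / (exp (2 * of_real L * (s + 2 * of_nat k)) - 1)) \<le> M k"
      using csch_series_term_bound[OF L, of "norm z + e"] e(1) by (meson add_nonneg_nonneg less_imp_le norm_ge_zero)
    have "norm s \<le> norm z + e" if "s \<in> cball z e" for s
      using that norm_triangle_ineq2[of s z] by (simp add: dist_norm norm_minus_commute)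
    hence *: "\<forall>k\<in>UNIV - {k0} - F. \<forall>s\<in>cball z e. norm (t k s) \<le> M k"
      using FM(3) unfolding t_def by blast
    have "M summable_on (UNIV - {k0} - F)" by (rule summable_on_subset_banach[OF FM(2)]) auto
    thus ?thesis by (intro exI[of _ e] conjI exI[of _ F] exI[of _ M] e FM(1) *)
  qed
  define h where "h = (\<lambda>s. \<Sum>\<^sub>\<infinity>k\<in>UNIV-{k0}. t k s)"
  have h: "h holomorphic_on ball p r" unfolding h_def by (rule holomorphic_on_infsum(1)[OF open_ball hol bd])
  have h_summable: "(\<lambda>k. t k s) summable_on (UNIV - {k0})" if "s \<in> ball p r" for s
    by (rule holomorphic_on_infsum(2)[OF open_ball hol bd that])
  define E where "E = (\<lambda>s. exp (2 * of_real L * (s - p)) - 1)"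
  have E_eq: "exp (2 * of_real L * (s + 2 * of_nat k0)) - 1 = E s" for s
  proof -
    have "2 * complex_of_real L * (s + 2 * of_nat k0) = 2 * of_real L * (s - p) + 2 * of_int m * of_real pi * \<i>"
      using L by (simp add: p field_simps)
    hence "exp (2 * of_real L * (s + 2 * of_nat k0)) = exp (2 * of_real L * (s - p)) * exp (of_real (2 * of_int m * pi) * \<i>)"
      by (simp add: exp_add)
    also have "exp (of_real (2 * of_int m * pi) * \<i>) = 1"
      using exp_integer_2pi[of "of_int m"] by (simp add: mult_ac)
    finally show ?thesis by (simp add: E_def)
  qed
  have dE: "deriv E p = 2 * of_real L"
    unfolding E_def by (rule DERIV_imp_deriv) (auto intro!: derivative_eq_intros)
  have E0: "E s \<noteq> 0" if "s \<in> ball p r - {p}" for s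
    using not_pole[OF that] exp_eq_1_imp_csch_poles[OF L, of s k0] by (auto simp flip: E_eq)
  \<comment> \<open>E(s)/(s-p) with its removable singularity filled in. It has no zero in the disc,
    so 1/Q is holomorphic.\<close>
  define Q where "Q = (\<lambda>s. if s = p then deriv E p else E s / (s - p) - E p / (s - p))"
  have Q: "Q holomorphic_on ball p r"
    unfolding Q_def by (rule pole_theorem_open) (auto simp: E_def intro!: holomorphic_intros)
  have Qp: "Q p = 2 * of_real L" by (simp add: Q_def dE)
  have Qs: "Q s = E s / (s - p)" if "s \<noteq> p" for s
    using that by (simp add: Q_def) (simp add: E_def)
  have Q0: "Q s \<noteq> 0" if "s \<in> ball p r" for s
    using E0[of s] that L by (cases "s = p") (simp_all add: Qp Qs)
  define g where "g = (\<lambda>s. rbin s k0 / Q s + (s - p) * h s)"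
  have "g holomorphic_on ball p r"
    unfolding g_def using Q0 by (intro holomorphic_intros h Q) auto
  moreover have gp: "g p = rbin p k0 / (2 * of_real L)"
    by (simp add: g_def Qp)
  \<comment> \<open>The factors of the rising factorial are p + j with j < k0, and Re p = -2 k0, so
    none of them vanishes.\<close>
  moreover have "rbin p k0 \<noteq> 0"
  proof
    assume "rbin p k0 = 0"
    then obtain j where j: "j < k0" "p = - of_nat j" by (auto simp: rbin_def pochhammer_eq_0_iff)
    from arg_cong[OF j(2), of Re] have "real j = real (2 * k0)" by (simp add: p)
    hence "j = 2 * k0" by (simp only: of_nat_eq_iff)
    with j(1) show False by simp
  qed
  hence "g p \<noteq> 0" using L gp by simp
  moreover have "csch_series L s = g s / (s - p)" if s: "s \<in> ball p r - {p}" for s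
  proof -
    have "csch_series L s = infsum (\<lambda>k. t k s) (insert k0 (UNIV - {k0}))"
      by (simp add: csch_series_def t_def insert_absorb)
    also have "\<dots> = t k0 s + h s"
      unfolding h_def using s by (intro infsum_insert h_summable) auto
    also have "t k0 s = rbin s k0 / E s" by (simp add: t_def E_eq)
    also have "rbin s k0 / E s + h s = g s / (s - p)"
      using s E0[OF s] by (simp add: g_def Qs field_simps)
    finally show ?thesis .
  qed
  ultimately show ?thesis using r not_pole by blast
qed

section \<open>Identification with the Riemann zeta function\<close>

lemma rescaled_sinh_tendsto:
  fixes c :: real
  assumes "c > 0"
  shows "((\<lambda>L. 2 * sinh (2 * c * L) / (4 * L)) \<longlongrightarrow> c) (at_right 0)"
proof -
  have "((\<lambda>L. sinh (2 * c * L)) has_real_derivative 2 * c) (at 0)"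
    by (auto intro!: derivative_eq_intros)
  hence "((\<lambda>L. sinh (2 * c * L) / L) \<longlongrightarrow> 2 * c) (at 0)"
    by (simp add: has_field_derivative_iff)
  hence "((\<lambda>L. sinh (2 * c * L) / L / 2) \<longlongrightarrow> 2 * c / 2) (at_right 0)"
    by (intro tendsto_divide tendsto_const) (auto intro: filterlim_mono at_le)
  thus ?thesis by (simp add: mult.commute)
qed

lemma of_real_powr_complex:
  fixes x :: real and s :: complex
  assumes "x > 0"
  shows "of_real x powr s = exp (s * of_real (ln x))"
  using assms Ln_of_real[of x] by (simp add: powr_def)

text \<open>Tannery's theorem: (4L)^s is absorbed into each term, whose base 2 sinh(2(n+1)L)/(4L)
  tends to n+1 and, by sinh x >= x, never falls below it. Hence the majorant (n+1)^(-Re s).\<close>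

lemma csch_dirichlet_tendsto:
  assumes s: "Re s > 1"
  shows "((\<lambda>L. of_real (4 * L) powr s * csch_series L s) \<longlongrightarrow> (\<Sum>n. of_real (real (Suc n)) powr (- s))) (at_right 0)"
proof -
  define r where "r = (\<lambda>(n::nat) (L::real). 2 * sinh (2 * real (Suc n) * L) / (4 * L))"
  define M where "M = (\<lambda>n. real (Suc n) powr (- Re s))"
  have r_ge: "r n L \<ge> real (Suc n)" if "L > 0" for n L
    using sinh_ge_self[of "2 * real (Suc n) * L"] that by (simp add: r_def field_simps)
  have bound: "norm (of_real (r n L) powr (- s)) \<le> M n" if "L > 0" for n L
  proof -
    have r: "r n L > 0" using r_ge[OF that, of n] by linarith
    have "norm (of_real (r n L) powr (- s)) = r n L powr (- Re s)"
      using r by (simp add: norm_powr_real_powr)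
    also have "\<dots> \<le> M n" unfolding M_def using r_ge[OF that, of n] s by (intro powr_mono2') auto
    finally show ?thesis .
  qed
  have "summable (\<lambda>n. real n powr (- Re s))" using s by (simp add: summable_real_powr_iff)
  hence M: "summable M" unfolding M_def by (subst (asm) summable_Suc_iff[symmetric])
  have pos: "eventually (\<lambda>L::real. L > 0) (at_right 0)" by (simp add: eventually_at_right_less)
  have "((\<lambda>L. \<Sum>n. of_real (r n L) powr (- s)) \<longlongrightarrow> (\<Sum>n. of_real (real (Suc n)) powr (- s))) (at_right 0)"
  proof (rule tannerys_theorem[THEN conjunct2, THEN conjunct2])
    show "((\<lambda>L. of_real (r n L) powr (- s)) \<longlongrightarrow> of_real (real (Suc n)) powr (- s)) (at_right 0)" for n
    proof -
      have lim: "((\<lambda>L. exp (- s * of_real (ln (r n L)))) \<longlongrightarrow> exp (- s * of_real (ln (real (Suc n))))) (at_right 0)"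
        unfolding r_def by (intro tendsto_intros rescaled_sinh_tendsto) auto
      have ev: "eventually (\<lambda>L. exp (- s * of_real (ln (r n L))) = of_real (r n L) powr (- s)) (at_right 0)"
        using pos
      proof eventually_elim
        case (elim L)
        have "r n L > 0" using r_ge[OF elim, of n] by linarith
        thus ?case by (simp only: of_real_powr_complex)
      qed
      have "exp (- s * of_real (ln (real (Suc n)))) = of_real (real (Suc n)) powr (- s)"
        by (rule of_real_powr_complex[symmetric]) simp
      with Lim_transform_eventually[OF lim ev] show ?thesis by (simp only:)
    qed
    show "\<forall>\<^sub>F (n, L) in sequentially \<times>\<^sub>F at_right 0. norm (of_real (r n L) powr (- s)) \<le> M n"
      unfolding eventually_prod_filter
      by (intro exI[of _ "\<lambda>_. True"] exI[of _ "\<lambda>L. L > 0"]) (use pos bound in auto)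
  qed (use M in auto)
  moreover have "eventually (\<lambda>L. (\<Sum>n. of_real (r n L) powr (- s)) = of_real (4 * L) powr s * csch_series L s) (at_right 0)"
    using pos
  proof eventually_elim
    case (elim L)
    have trm: "of_real (r n L) powr (- s) = of_real (4 * L) powr s * of_real (2 * sinh (2 * real (Suc n) * L)) powr (- s)" for n
    proof -
      have r: "r n L > 0" using r_ge[OF elim, of n] by linarith
      have sh: "2 * sinh (2 * real (Suc n) * L) > 0" using elim by (simp add: add_pos_nonneg)
      have "ln (r n L) = ln (2 * sinh (2 * real (Suc n) * L)) - ln (4 * L)"
        unfolding r_def using sh elim by (intro ln_divide_pos) auto
      hence "of_real (r n L) powr (- s) = exp (- s * (of_real (ln (2 * sinh (2 * real (Suc n) * L))) - of_real (ln (4 * L))))"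
        using of_real_powr_complex[OF r, of "- s"] by simp
      also have "\<dots> = exp (s * of_real (ln (4 * L))) * exp (- s * of_real (ln (2 * sinh (2 * real (Suc n) * L))))"
        by (simp add: algebra_simps flip: exp_add)
      finally show ?thesis using elim by (simp only: of_real_powr_complex[OF sh] of_real_powr_complex[of "4 * L"])
    qed
    have "(\<lambda>n. of_real (2 * sinh (2 * real (Suc n) * L)) powr (- s)) sums csch_series L s"
      using csch_series_eq_dirichlet[OF elim, of s] s by (intro has_sum_imp_sums) auto
    from sums_mult[OF this, of "of_real (4 * L) powr s"] show ?case
      unfolding trm by (rule sums_unique[symmetric])
  qed
  ultimately show ?thesis by (rule Lim_transform_eventually)
qed

text \<open>A value that does not depend on L equals its limit for L tending to 0. After scaling,
  the term of index 0 is O(L^(Re s - 1)) and the tail is O(L^2), so only the Dirichlet series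
  survives.\<close>

lemma zeta_via_eq_dirichlet:
  assumes L: "L > 0" and s: "1 < Re s" "Re s < 2"
  shows "zeta_via L s = (\<Sum>n. of_real (real (Suc n)) powr (- s))"
proof -
  have notpole: "s \<notin> csch_poles l" for l using csch_poles_Re_le_0[of s l] s by auto
  define \<sigma> where "\<sigma> = Re s"
  obtain C Y where C: "C > 0" and Y: "Y \<ge> 1" and CY: "\<And>y. \<bar>y\<bar> \<ge> Y \<Longrightarrow>
    norm (gam_ratio s y - pow_term s y) \<le> C * \<bar>y\<bar> powr (\<sigma> - 3)"
    using gam_ratio_asymp[of "norm s"] unfolding \<sigma>_def by (meson norm_ge_zero order.refl)
  define B where "B = (\<Sum>\<^sub>\<infinity>m\<in>UNIV-{0::int}. \<bar>real_of_int m\<bar> powr (\<sigma> - 3))"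
  have B: "((\<lambda>m::int. \<bar>real_of_int m\<bar> powr (\<sigma> - 3)) has_sum B) (UNIV - {0})"
    unfolding B_def using s by (intro has_sum_infsum summable_on_int_powr) (simp add: \<sigma>_def)
  have pos: "eventually (\<lambda>l::real. l > 0) (at_right 0)" by (simp add: eventually_at_right_less)
  \<comment> \<open>For l < pi/(2Y) all arguments pi m/(2l) with m nonzero lie in the range |y| >= Y
    of the asymptotic estimate.\<close>
  have small: "eventually (\<lambda>l::real. l < pi / (2 * Y)) (at_right 0)"
    using Y by (intro eventually_at_rightI[of 0 "pi / (2 * Y)"]) auto
  have lim_tail: "((\<lambda>l. of_real (4 * l) powr s / (4 * of_real l) * gam_tail l s) \<longlongrightarrow> 0) (at_right 0)"
  proof (rule Lim_null_comparison)
    show "eventually (\<lambda>l. norm (of_real (4 * l) powr s / (4 * of_real l) * gam_tail l s) \<le>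
       C * B * (2 * pi) powr (\<sigma> - 3) * (4 * l)\<^sup>2) (at_right 0)"
      using pos small
    proof eventually_elim
      case (elim l)
      define c where "c = pi / (2 * l)"
      have c: "c > 0" "c \<ge> Y" using elim Y by (auto simp: c_def field_simps)
      have "norm (gam_tail l s) \<le> C * c powr (\<sigma> - 3) * B"
      proof (rule norm_infsum_le)
        show "((\<lambda>m. gam_ratio s (pi * of_int m / (2 * l)) - pow_term s (pi * of_int m / (2 * l))) has_sum gam_tail l s) (UNIV - {0})"
          unfolding gam_tail_def using s notpole elim by (intro has_sum_infsum summable_gam_tail) auto
        show "((\<lambda>m::int. C * c powr (\<sigma> - 3) * \<bar>real_of_int m\<bar> powr (\<sigma> - 3)) has_sum (C * c powr (\<sigma> - 3) * B)) (UNIV - {0})"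
          by (intro has_sum_cmult_right B)
        fix m :: int assume "m \<in> UNIV - {0}"
        hence m: "\<bar>real_of_int m\<bar> \<ge> 1" by auto
        have y: "pi * of_int m / (2 * l) = c * of_int m" by (simp add: c_def)
        have "Y * 1 \<le> c * \<bar>real_of_int m\<bar>" using c m Y by (intro mult_mono) auto
        hence "\<bar>c * of_int m\<bar> \<ge> Y" using c by (simp add: abs_mult)
        from CY[OF this] show "norm (gam_ratio s (pi * of_int m / (2 * l)) - pow_term s (pi * of_int m / (2 * l))) \<le>
            C * c powr (\<sigma> - 3) * \<bar>real_of_int m\<bar> powr (\<sigma> - 3)"
          unfolding y using c by (simp add: abs_mult powr_mult)
      qed
      moreover have "norm (of_real (4 * l) powr s / (4 * of_real l)) = (4 * l) powr (\<sigma> - 1)"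
      proof -
        have "norm (of_real (4 * l) powr s) = (4 * l) powr \<sigma>"
          using elim by (subst norm_powr_real_powr) (auto simp: \<sigma>_def)
        thus ?thesis using elim by (simp add: norm_divide norm_mult powr_diff)
      qed
      ultimately have "norm (of_real (4 * l) powr s / (4 * of_real l) * gam_tail l s) \<le>
          (4 * l) powr (\<sigma> - 1) * (C * c powr (\<sigma> - 3) * B)"
        unfolding norm_mult by (intro mult_mono) auto
      also have "c powr (\<sigma> - 3) = (2 * pi) powr (\<sigma> - 3) * (4 * l) powr (3 - \<sigma>)"
      proof -
        have "c = 2 * pi / (4 * l)" by (simp add: c_def)
        hence "c powr (\<sigma> - 3) = (2 * pi) powr (\<sigma> - 3) / (4 * l) powr (\<sigma> - 3)"
          using elim by (simp only: powr_divide)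
        also have "(4 * l) powr (\<sigma> - 3) = inverse ((4 * l) powr (3 - \<sigma>))"
          by (simp flip: powr_minus)
        finally show ?thesis by (simp only: divide_inverse inverse_inverse_eq)
      qed
      also have "(4 * l) powr (\<sigma> - 1) * (C * ((2 * pi) powr (\<sigma> - 3) * (4 * l) powr (3 - \<sigma>)) * B) =
         C * B * (2 * pi) powr (\<sigma> - 3) * ((4 * l) powr (\<sigma> - 1) * (4 * l) powr (3 - \<sigma>))" by (simp only: mult_ac)
      also have "(4 * l) powr (\<sigma> - 1) * (4 * l) powr (3 - \<sigma>) = (4 * l)\<^sup>2"
      proof -
        have "(4 * l) powr (\<sigma> - 1) * (4 * l) powr (3 - \<sigma>) = (4 * l) powr (real 2)" by (simp flip: powr_add)
        also have "\<dots> = (4 * l)\<^sup>2" using elim by (subst powr_realpow) auto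
        finally show ?thesis .
      qed
      finally show ?case .
    qed
    show "((\<lambda>l. C * B * (2 * pi) powr (\<sigma> - 3) * (4 * l)\<^sup>2) \<longlongrightarrow> 0) (at_right 0)"
      by (auto intro!: tendsto_eq_intros)
  qed
  have lim_0: "((\<lambda>l. of_real (4 * l) powr s / (4 * of_real l) :: complex) \<longlongrightarrow> 0) (at_right 0)"
  proof (rule Lim_null_comparison)
    show "eventually (\<lambda>l. norm (of_real (4 * l) powr s / (4 * of_real l) :: complex) \<le> (4 * l) powr (\<sigma> - 1)) (at_right 0)"
      using pos
    proof eventually_elim
      case (elim l)
      have "norm (of_real (4 * l) powr s) = (4 * l) powr \<sigma>"
        using elim by (subst norm_powr_real_powr) (auto simp: \<sigma>_def)
      thus ?case using elim by (simp add: norm_divide norm_mult powr_diff)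
    qed
    have "((\<lambda>l. (4 * l) powr (\<sigma> - 1)) \<longlongrightarrow> (4 * 0) powr (\<sigma> - 1)) (at_right 0)"
      using s pos by (intro tendsto_powr2 tendsto_intros) (auto simp: \<sigma>_def elim: eventually_mono)
    thus "((\<lambda>l. (4 * l) powr (\<sigma> - 1)) \<longlongrightarrow> 0) (at_right 0)" by simp
  qed
  have "((\<lambda>l. of_real (4 * l) powr s * csch_series l s - Gamma (1 - s) *
      (of_real (4 * l) powr s / (4 * of_real l) * gam_ratio s 0 + of_real (4 * l) powr s / (4 * of_real l) * gam_tail l s))
      \<longlongrightarrow> (\<Sum>n. of_real (real (Suc n)) powr (- s)) - Gamma (1 - s) * (0 * gam_ratio s 0 + 0)) (at_right 0)"
    using s by (intro tendsto_intros lim_0 lim_tail csch_dirichlet_tendsto)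
  moreover have "eventually (\<lambda>l. of_real (4 * l) powr s * csch_series l s - Gamma (1 - s) *
      (of_real (4 * l) powr s / (4 * of_real l) * gam_ratio s 0 + of_real (4 * l) powr s / (4 * of_real l) * gam_tail l s)
      = zeta_via L s) (at_right 0)"
    using pos
  proof eventually_elim
    case (elim l)
    have "zeta_via L s = zeta_via l s" using s notpole L elim by (intro zeta_via_unique) auto
    thus ?case by (simp add: zeta_via_def algebra_simps add_divide_distrib)
  qed
  ultimately have "((\<lambda>l::real. zeta_via L s) \<longlongrightarrow> (\<Sum>n. of_real (real (Suc n)) powr (- s))) (at_right 0)"
    by (simp add: Lim_transform_eventually)
  thus ?thesis by (simp add: tendsto_const_iff)
qed

section \<open>Gluing the continuation of zeta across the strip\<close>

lemma holomorphic_on_dirichlet_zeta: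
  "(\<lambda>s. \<Sum>n. of_real (real (Suc n)) powr (- s)) holomorphic_on {s. 1 < Re s}"
proof -
  define f where "f = (\<lambda>(n::nat) s. of_real (real (Suc n)) powr (- s) :: complex)"
  let ?S = "{s. 1 < Re s}"
  have op: "open ?S" by (rule open_halfspace_Re_gt)
  have hol: "f n holomorphic_on ?S" for n
    unfolding f_def of_real_powr_complex[of "real (Suc n)", simplified of_nat_0_less_iff, OF zero_less_Suc]
    by (intro holomorphic_intros)
  have bd: "\<exists>r>0. \<exists>F M. cball z r \<subseteq> ?S \<and> finite F \<and> M summable_on (UNIV - F) \<and>
      (\<forall>n\<in>UNIV - F. \<forall>s\<in>cball z r. norm (f n s) \<le> M n)" if z: "z \<in> ?S" for z
  proof -
    obtain r where r: "r > 0" "cball z r \<subseteq> ?S" using op z open_contains_cball by blast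
    have "z - of_real r \<in> cball z r" using r(1) by (simp add: dist_norm)
    with r(2) have "z - of_real r \<in> ?S" by blast
    hence a: "Re z - r > 1" by simp
    define M where "M = (\<lambda>n. real (Suc n) powr (- (Re z - r)))"
    have "summable (\<lambda>n. real n powr (- (Re z - r)))" using a by (simp add: summable_real_powr_iff)
    hence "summable M" unfolding M_def by (subst (asm) summable_Suc_iff[symmetric])
    hence "M summable_on UNIV" by (subst summable_on_UNIV_nonneg_real_iff) (auto simp: M_def)
    hence M: "M summable_on (UNIV - {})" by simp
    have "norm (f n s) \<le> M n" if "s \<in> cball z r" for n s
    proof -
      have "Re z - Re s \<le> norm (z - s)" using complex_Re_le_cmod[of "z - s"] by simp
      hence "Re z - r \<le> Re s" using that by (simp add: dist_norm)
      hence "real (Suc n) powr (- Re s) \<le> real (Suc n) powr (- (Re z - r))" by (intro powr_mono) auto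
      thus ?thesis unfolding f_def M_def by (subst norm_powr_real_powr) (auto simp del: of_nat_Suc)
    qed
    hence *: "\<forall>n\<in>UNIV - {}. \<forall>s\<in>cball z r. norm (f n s) \<le> M n" by blast
    show ?thesis by (intro exI[of _ r] conjI exI[of _ "{}"] exI[of _ M] r M *) auto
  qed
  have "(\<lambda>s. \<Sum>\<^sub>\<infinity>n. f n s) holomorphic_on ?S" by (rule holomorphic_on_infsum(1)[OF op hol bd])
  moreover have "(\<Sum>\<^sub>\<infinity>n. f n s) = (\<Sum>n. of_real (real (Suc n)) powr (- s))" if "s \<in> ?S" for s
  proof -
    have "(\<lambda>n. f n s) summable_on UNIV" by (rule holomorphic_on_infsum(2)[OF op hol bd that])
    from has_sum_imp_sums[OF has_sum_infsum[OF this]] show ?thesis unfolding f_def by (rule sums_unique)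
  qed
  ultimately show ?thesis by (rule holomorphic_transform)
qed

text \<open>The indices m = k = 0 put 0 into the pole set of every L, so no choice of L avoids it.
  The singularity is removable because the residue 1/2 of \<open>csch_series 1\<close> cancels the
  residue 2/4 of Gamma(s/2)/4.\<close>

lemma zeta_via_extends_to_0:
  "\<exists>g. g holomorphic_on ball 0 1 \<and> (\<forall>z\<in>ball 0 1 - {0}. g z = zeta_via 1 z)"
proof -
  have in_P: "0 \<in> csch_poles 1"
    unfolding csch_poles_def mem_Collect_eq by (intro exI[of _ 0]) simp
  have no_pole: "s \<notin> csch_poles 1" if "s \<in> ball 0 1 - {0}" for s
    using csch_poles_dist[OF _ in_P, of s] that pi_ge_two by (auto simp: dist_commute)
  have sub: "ball 0 1 - {0} \<subseteq> {s. Re s < 2} - insert 1 (csch_poles 1)"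
  proof
    fix s :: complex assume s: "s \<in> ball 0 1 - {0}"
    hence "norm s < 1" by simp
    hence "Re s < 2" "s \<noteq> 1" using complex_Re_le_cmod[of s] by auto
    with no_pole[OF s] show "s \<in> {s. Re s < 2} - insert 1 (csch_poles 1)" by simp
  qed
  have hol: "zeta_via 1 holomorphic_on ball 0 1 - {0}"
    by (rule holomorphic_on_subset[OF holomorphic_on_zeta_via sub]) simp
  obtain r g where r: "r > 0" and g: "g holomorphic_on ball 0 r" and g0: "g 0 = 1 / 2"
    and gs: "\<And>s. s \<in> ball 0 r - {0} \<Longrightarrow> csch_series 1 s = g s / s"
    using csch_series_near_pole[of 1 0 0 0] by auto
  have contg: "isCont g 0"
    using holomorphic_on_imp_continuous_on[OF g] r by (simp add: continuous_on_eq_continuous_at)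
  have contT: "isCont (gam_tail 1) 0"
  proof -
    have "open ({s. Re s < 2} - (csch_poles 1 - \<real>))"
      by (intro open_Diff open_halfspace_Re_lt closed_subset_csch_poles[of 1]) auto
    thus ?thesis
      using holomorphic_on_imp_continuous_on[OF holomorphic_on_gam_tail[of 1]]
      by (simp add: continuous_on_eq_continuous_at)
  qed
  have contR: "isCont (\<lambda>z::complex. rGamma (1 - z / 2)) 0"
  proof -
    have "(\<lambda>z::complex. rGamma (1 - z / 2)) holomorphic_on UNIV" by (intro holomorphic_intros) auto
    thus ?thesis using holomorphic_on_imp_continuous_on continuous_on_eq_continuous_at by blast
  qed
  \<comment> \<open>Away from 0 this is z times \<open>zeta_via 1 z\<close>, with z Gamma(z/2)
    replaced by 2 Gamma(z/2 + 1), which is regular at 0. There h vanishes since 1/2 - 2/4 =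
    0.\<close>
  define h where "h = (\<lambda>z. of_real (4 * 1) powr z * (g z - Gamma (1 - z) / (4 * of_real 1) *
      (2 * Gamma (z / 2 + 1) * rGamma (1 - z / 2) + z * gam_tail 1 z)))"
  have "(h \<longlongrightarrow> of_real (4 * 1) powr 0 * (g 0 - Gamma (1 - 0) / (4 * of_real 1) *
      (2 * Gamma (0 / 2 + 1) * rGamma (1 - 0 / 2) + 0 * gam_tail 1 0))) (at 0)"
    unfolding h_def using isContD[OF contg] isContD[OF contT] isContD[OF contR]
    by (intro tendsto_mult tendsto_diff tendsto_add tendsto_divide tendsto_intros) auto
  hence "(h \<longlongrightarrow> 0) (at 0)" by (simp add: g0)
  moreover have "eventually (\<lambda>z. h z = (z - 0) * zeta_via 1 z) (at 0)"
  proof -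
    have "eventually (\<lambda>z. z \<in> ball 0 (min r 1) - {0}) (at (0::complex))"
      using r by (intro eventually_at_in_open) auto
    thus ?thesis
    proof eventually_elim
      case (elim z)
      have z: "z \<noteq> 0" "z \<in> ball 0 r - {0}" "norm z < 1" using elim by auto
      have "z / 2 \<notin> \<int>\<^sub>\<le>\<^sub>0"
      proof
        assume "z / 2 \<in> \<int>\<^sub>\<le>\<^sub>0"
        then obtain n :: nat where n: "z / 2 = - of_nat n" by (elim nonpos_Ints_cases')
        have "norm (z / 2) = real n" unfolding n by simp
        hence "n = 0" using z(3) by (simp add: norm_divide)
        with n z(1) show False by simp
      qed
      hence "Gamma (z / 2 + 1) = z / 2 * Gamma (z / 2)" by (rule Gamma_plus1)
      hence G: "2 * Gamma (z / 2 + 1) = z * Gamma (z / 2)" by (simp add: mult.commute)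
      show ?case
        unfolding h_def zeta_via_def gam_ratio_def gs[OF z(2)] G using z(1) by (simp add: algebra_simps)
    qed
  qed
  ultimately have "((\<lambda>z. (z - 0) * zeta_via 1 z) \<longlongrightarrow> 0) (at 0)" by (rule Lim_transform_eventually)
  thus ?thesis
    using holomorphic_on_extend_lim[OF hol] by simp
qed

text \<open>This L makes the vertical spacing pi (1 + |Im s|) exceed |Im s|, so s could only be a
  point with m = 0, that is -2k, and Re s >= 0 leaves only 0.\<close>

lemma not_csch_pole_small_L:
  assumes "0 \<le> Re s" "s \<noteq> 0"
  shows "s \<notin> csch_poles (1 / (1 + \<bar>Im s\<bar>))"
proof
  assume "s \<in> csch_poles (1 / (1 + \<bar>Im s\<bar>))"
  then obtain m k where s: "s = \<i> * of_real (pi * of_int m / (1 / (1 + \<bar>Im s\<bar>))) - 2 * of_nat k"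
    unfolding csch_poles_def by blast
  have im: "Im s = pi * of_int m * (1 + \<bar>Im s\<bar>)" using arg_cong[OF s, of Im] by simp
  have re: "Re s = - 2 * real k" using arg_cong[OF s, of Re] by simp
  show False
  proof (cases "m = 0")
    case True
    with im re assms show False by (simp add: complex_eq_iff)
  next
    case False
    hence "1 \<le> \<bar>real_of_int m\<bar>" by linarith
    moreover have "1 \<le> pi" using pi_ge_two by linarith
    ultimately have "1 * 1 * (1 + \<bar>Im s\<bar>) \<le> pi * \<bar>real_of_int m\<bar> * (1 + \<bar>Im s\<bar>)"
      by (intro mult_right_mono mult_mono) auto
    also have "\<dots> = \<bar>Im s\<bar>" using arg_cong[OF im, of abs] by (simp add: abs_mult)
    finally show False by simp
  qed
qed

text \<open>Near a point of the closed strip 0 <= Re s <= 1 other than 0 and 1 the representation through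
  \<^term>\<open>zeta_via L\<close> has no singularity once L is small; the point 0 lies in every pole set and is
  handled by a removable singularity.\<close>
lemma riemann_zeta_aux:
  obtains f where "f holomorphic_on (UNIV - {1})" "f 1 = 0"
    "\<And>s. 1 < Re s \<Longrightarrow> f s = (\<Sum>n. of_real (real (Suc n)) powr (- s))"
    "\<And>L s. L > 0 \<Longrightarrow> Re s < 2 \<Longrightarrow> s \<noteq> 1 \<Longrightarrow> s \<notin> csch_poles L \<Longrightarrow> f s = zeta_via L s"
proof -
  obtain g where g: "g holomorphic_on ball 0 1" and g_eq: "\<And>z. z \<in> ball 0 1 - {0} \<Longrightarrow> g z = zeta_via 1 z"
    using zeta_via_extends_to_0 by blast
  \<comment> \<open>In the strip L varies with s. Holomorphy near a point comes from freezing L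
    there, since by \<open>f_via\<close> f agrees with \<open>zeta_via\<close> for every admissible
    L. The value 0 at 1 is the convention of \<open>riemann_zeta\<close>.\<close>
  define f where "f = (\<lambda>s. if Re s < 0 then zeta_left s
    else if 1 < Re s then (\<Sum>n. of_real (real (Suc n)) powr (- s))
    else if s = 1 then 0 else if s = 0 then g 0 else zeta_via (1 / (1 + \<bar>Im s\<bar>)) s)"
  have zero_pole: "0 \<in> csch_poles L" for L
    unfolding csch_poles_def mem_Collect_eq by (intro exI[of _ 0]) simp
  have f_via: "f s = zeta_via L s" if L: "L > 0" and s: "Re s < 2" "s \<noteq> 1" "s \<notin> csch_poles L" for L s
  proof -
    have "s \<noteq> 0" using s(3) zero_pole by blast
    consider "Re s < 0" | "1 < Re s" | "0 \<le> Re s" "Re s \<le> 1" by linarith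
    thus ?thesis
    proof cases
      case 1
      thus ?thesis using zeta_via_eq_zeta_left[OF L 1 s(3)] by (simp add: f_def)
    next
      case 2
      thus ?thesis using zeta_via_eq_dirichlet[OF L 2 s(1)] by (simp add: f_def)
    next
      case 3
      have "f s = zeta_via (1 / (1 + \<bar>Im s\<bar>)) s" using 3 s \<open>s \<noteq> 0\<close> by (simp add: f_def)
      also have "\<dots> = zeta_via L s"
        by (rule zeta_via_unique) (use L s not_csch_pole_small_L[OF 3(1) \<open>s \<noteq> 0\<close>] in \<open>auto intro: add_pos_nonneg\<close>)
      finally show ?thesis .
    qed
  qed
  have local_hol: "\<exists>U. open U \<and> s \<in> U \<and> f holomorphic_on U" if "s \<noteq> 1" for s
  proof -
    consider "Re s < 0" | "1 < Re s" | "s = 0" | "0 \<le> Re s" "Re s \<le> 1" "s \<noteq> 0" by linarith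
    thus ?thesis
    proof cases
      case 1
      have "f holomorphic_on {s. Re s < 0}"
        by (rule holomorphic_transform[OF holomorphic_on_zeta_left]) (simp add: f_def)
      thus ?thesis using 1 by (intro exI[of _ "{s. Re s < 0}"]) (auto simp: open_halfspace_Re_lt)
    next
      case 2
      have "f holomorphic_on {s. 1 < Re s}"
        by (rule holomorphic_transform[OF holomorphic_on_dirichlet_zeta]) (simp add: f_def)
      thus ?thesis using 2 by (intro exI[of _ "{s. 1 < Re s}"]) (auto simp: open_halfspace_Re_gt)
    next
      case 3
      have "f holomorphic_on ball 0 1"
      proof (rule holomorphic_transform[OF g])
        fix z :: complex assume z: "z \<in> ball 0 1"
        show "g z = f z"
        proof (cases "z = 0")
          case True
          thus ?thesis by (simp add: f_def)
        next
          case False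
          have "norm z < 1" using z by simp
          hence "Re z < 2" "z \<noteq> 1" using complex_Re_le_cmod[of z] by auto
          moreover have "z \<notin> csch_poles 1"
            using csch_poles_dist[of 1 0 z] zero_pole False z pi_ge_two by (auto simp: dist_commute)
          ultimately show ?thesis using g_eq[of z] f_via[of 1 z] z False by simp
        qed
      qed
      thus ?thesis using 3 by (intro exI[of _ "ball 0 1"]) auto
    next
      case 4
      define L where "L = 1 / (1 + \<bar>Im s\<bar>)"
      have L: "L > 0" by (simp add: L_def add_pos_nonneg)
      let ?U = "{s. Re s < 2} - insert 1 (csch_poles L)"
      have "open ?U" by (intro open_Diff open_halfspace_Re_lt closed_insert closed_csch_poles L)
      moreover have "s \<in> ?U" using 4 that not_csch_pole_small_L[OF 4(1,3)] by (simp add: L_def)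
      moreover have "f holomorphic_on ?U"
        by (rule holomorphic_transform[OF holomorphic_on_zeta_via[OF L]]) (use f_via[OF L] in auto)
      ultimately show ?thesis by blast
    qed
  qed
  have "f analytic_on (UNIV - {1})"
    unfolding analytic_on_analytic_at[of f "UNIV - {1}"] analytic_at using local_hol by blast
  hence "f holomorphic_on (UNIV - {1})" by (rule analytic_imp_holomorphic)
  thus ?thesis by (rule that) (use f_via in \<open>auto simp: f_def\<close>)
qed

text \<open>The description defining \<open>riemann_zeta\<close> denotes: existence is
  \<open>riemann_zeta_aux\<close>, and uniqueness is the identity theorem from Re s > 1 to the
  connected set C - {1}.\<close>

lemma riemann_zeta_eq_zeta_via:
  assumes "L > 0" "Re s < 2" "s \<noteq> 1" "s \<notin> csch_poles L"
  shows "riemann_zeta s = zeta_via L s"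
proof -
  obtain f where f: "f holomorphic_on (UNIV - {1})" "f 1 = 0"
    "\<And>s. 1 < Re s \<Longrightarrow> f s = (\<Sum>n. of_real (real (Suc n)) powr (- s))"
    and f_via: "\<And>L s. L > 0 \<Longrightarrow> Re s < 2 \<Longrightarrow> s \<noteq> 1 \<Longrightarrow> s \<notin> csch_poles L \<Longrightarrow> f s = zeta_via L s"
    using riemann_zeta_aux by blast
  have "riemann_zeta = f"
    unfolding riemann_zeta_def
  proof (rule the_equality)
    show "f holomorphic_on (UNIV - {1}) \<and> f 1 = 0 \<and>
      (\<forall>s. 1 < Re s \<longrightarrow> f s = (\<Sum>n. of_real (real (Suc n)) powr (- s)))"
      using f by blast
    fix h assume h: "h holomorphic_on (UNIV - {1}) \<and> h 1 = 0 \<and>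
      (\<forall>s. 1 < Re s \<longrightarrow> h s = (\<Sum>n. of_real (real (Suc n)) powr (- s)))"
    show "h = f"
    proof
      fix s :: complex
      show "h s = f s"
      proof (cases "s = 1")
        case False
        have "connected (UNIV - {1::complex})"
          by (rule connected_open_diff_countable) auto
        moreover have "{s. 1 < Re s} \<noteq> {}" by (auto intro!: exI[of _ 2])
        moreover have "{s. 1 < Re s} \<subseteq> UNIV - {1}" by auto
        moreover have "h z = f z" if "z \<in> {s. 1 < Re s}" for z using that f(3) h by simp
        ultimately show ?thesis
          using analytic_continuation_open[of "{s. 1 < Re s}" "UNIV - {1}" h f s] f(1) h False
          by (simp add: open_halfspace_Re_gt open_delete)
      qed (use f h in simp)
    qed
  qed
  thus ?thesis using f_via assms by simp
qed

section \<open>The main theorem\<close>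

lemma poleSet_eq_csch_poles: "poleSet D = csch_poles (ln (fund_unit D))"
  by (simp add: poleSet_def csch_poles_def)

text \<open>With |y| = 2 pi |m|/(4L), the power (-iy)^(s-1) splits into the phase exp(pi i (1-s)
  sgn(m)/2), a power of 2 pi |m|, and 4L/(4L)^s. The spare 4L cancels against the prefactor.\<close>

lemma term1_eq:
  assumes L: "ln (fund_unit D) > 0" and m: "m \<noteq> 0"
  shows "term1 D s m = Gamma (1 - s) / (4 * of_real (ln (fund_unit D))) *
    (gam_ratio s (pi * of_int m / (2 * ln (fund_unit D))) - pow_term s (pi * of_int m / (2 * ln (fund_unit D))))"
proof -
  define L where "L = ln (fund_unit D)"
  have L: "L > 0" using assms by (simp add: L_def)
  define x where "x = 2 * pi * \<bar>real_of_int m\<bar>"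
  define y where "y = pi * of_int m / (2 * L)"
  have x: "x > 0" using m by (simp add: x_def)
  have y0: "y \<noteq> 0" using m L by (simp add: y_def)
  have "\<bar>y\<bar> = x / (4 * L)" using L by (simp add: y_def x_def abs_mult)
  hence ln: "ln \<bar>y\<bar> = ln x - ln (4 * L)" using x L by (simp only: ln_divide_pos)
  have sgn: "complex_of_real (sgn y) = sgn_int m"
    using m L by (auto simp: y_def sgn_int_def sgn_if zero_less_divide_iff zero_less_mult_iff)
  have "pow_term s y = exp ((s - 1) * (of_real (ln x) - of_real (ln (4 * L)) - \<i> * of_real (pi / 2) * sgn_int m))"
    unfolding pow_term_def Ln_minus_i_times[OF y0] ln sgn[symmetric] by (simp add: mult.assoc)
  also have "(s - 1) * (of_real (ln x) - of_real (ln (4 * L)) - \<i> * of_real (pi / 2) * sgn_int m) =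
     of_real (pi / 2) * \<i> * (1 - s) * sgn_int m - (1 - s) * of_real (ln x) - s * of_real (ln (4 * L)) + of_real (ln (4 * L))"
    by algebra
  also have "exp \<dots> = exp (of_real (pi / 2) * \<i> * (1 - s) * sgn_int m) /
      (of_real x powr (1 - s) * of_real (4 * L) powr s) * of_real (4 * L)"
  proof -
    have "exp (complex_of_real (ln (4 * L))) = of_real (4 * L)"
      using L by (subst exp_of_real) simp
    thus ?thesis unfolding of_real_powr_complex[OF x] of_real_powr_complex[of "4 * L", simplified, OF L]
      using L by (simp add: exp_add exp_diff of_real_powr_complex[of "4 * L"] del: of_real_mult)
  qed
  finally have pt: "pow_term s y = exp (of_real (pi / 2) * \<i> * (1 - s) * sgn_int m) /
      (of_real x powr (1 - s) * of_real (4 * L) powr s) * of_real (4 * L)" .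
  have gr: "gam_ratio s y = Gamma (s / 2 - \<i> * of_real y) / Gamma (1 - s / 2 - \<i> * of_real y)"
    by (simp only: gam_ratio_def rGamma_inverse_Gamma divide_inverse)
  show ?thesis
    unfolding L_def[symmetric] y_def[symmetric] gr pt
    unfolding term1_def Let_def L_def[symmetric] y_def[symmetric] x_def[symmetric]
    using L by (simp add: right_diff_distrib)
qed

lemma term2_eq:
  "term2 D s m = gam_ratio s (pi * of_int m / (2 * ln (fund_unit D)))"
  by (simp only: term2_def Let_def gam_ratio_def rGamma_inverse_Gamma divide_inverse)

lemma csch_series_pole:
  assumes L: "L > 0" and p: "p \<in> csch_poles L" and c: "c holomorphic_on UNIV" "c p \<noteq> 0"
  shows "is_pole (\<lambda>s. c s * csch_series L s) p" "zorder (\<lambda>s. c s * csch_series L s) p = -1"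
proof -
  obtain m k where pk: "p = \<i> * of_real (pi * of_int m / L) - 2 * of_nat k"
    using p by (auto simp: csch_poles_def)
  obtain r g where r: "r > 0" and g: "g holomorphic_on ball p r" "g p \<noteq> 0"
    and gs: "\<And>s. s \<in> ball p r - {p} \<Longrightarrow> csch_series L s = g s / (s - p)"
    using csch_series_near_pole[OF L pk] by blast
  define h where "h = (\<lambda>s. c s * g s)"
  have h: "h holomorphic_on ball p r" "h p \<noteq> 0"
    unfolding h_def using c g by (auto intro!: holomorphic_intros intro: holomorphic_on_subset)
  have eq: "c s * csch_series L s = h s / (s - p)" if "s \<in> ball p r - {p}" for s
    by (simp add: h_def gs[OF that])
  show "zorder (\<lambda>s. c s * csch_series L s) p = -1"
    by (rule zorder_eqI[OF open_ball _ h]) (use r eq in \<open>auto simp: power_int_minus field_simps\<close>)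
  have "is_pole (\<lambda>s. h s / (s - p) ^ 1) p"
    using r by (intro is_pole_basic[OF h(1) open_ball _ h(2)]) auto
  moreover have "eventually (\<lambda>s. s \<in> ball p r - {p}) (at p)"
    using r by (intro eventually_at_in_open) auto
  hence "eventually (\<lambda>s. h s / (s - p) ^ 1 = c s * csch_series L s) (at p)"
    by eventually_elim (simp add: eq)
  ultimately show "is_pole (\<lambda>s. c s * csch_series L s) p"
    by (rule is_pole_transform) simp
qed

theorem mainTheorem8:
  fixes D :: int
  assumes "D > 1" and "squarefree D"
    and "OD_norm D (fund_unit D) = -1"
  shows "(\<forall>s. 0 < Re s \<longrightarrow> summable (ZevenTerm D s)) \<and>
    (\<exists>Z. Z holomorphic_on (- poleSet D) \<and>
         (\<forall>s. 0 < Re s \<longrightarrow> Z s = Zeven D s) \<and>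
         (\<forall>s. 1 < Re s \<and> Re s < 2 \<longrightarrow> Z s = rhs1 D s) \<and>
         (\<forall>s. Re s < 2 \<and> s \<notin> poleSet D \<and> s \<noteq> 1 \<longrightarrow>
              term1 D s summable_on (UNIV - {0}) \<and> Z s = rhs1 D s) \<and>
         (\<forall>s. Re s < 0 \<and> s \<notin> poleSet D \<longrightarrow>
              term2 D s summable_on UNIV \<and> Z s = rhs2 D s) \<and>
         (\<forall>p \<in> poleSet D. is_pole Z p \<and> zorder Z p = -1))"
proof -
  define e where "e = fund_unit D"
  define L where "L = ln e"
  define q where "q = real_of_int (qD D)"
  define c where "c = (\<lambda>s. complex_of_real q powr (s / 2))"
  define Z where "Z = (\<lambda>s. c s * csch_series L s)"
  have e: "e > 1" unfolding e_def using assms by (intro fund_unit_gt_1)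
  have L: "L > 0" using e by (simp add: L_def)
  have q: "q > 0" using assms(1) by (simp add: q_def qD_def)
  have P: "poleSet D = csch_poles L" by (simp add: poleSet_eq_csch_poles L_def e_def)
  have c_exp: "c s = exp (s / 2 * of_real (ln q))" for s
    unfolding c_def by (rule of_real_powr_complex[OF q])
  have c_hol: "c holomorphic_on A" for A unfolding c_exp[abs_def] by (intro holomorphic_intros) auto
  have c0: "c s \<noteq> 0" for s by (simp add: c_exp)
  \<comment> \<open>The norm determines the conjugate as -1/e; the sign disappears in the even
    powers, which leaves twice a hyperbolic sine.\<close>
  have "e * OD_conj D e = -1" using assms(3) by (simp add: OD_norm_def e_def)
  hence conj: "OD_conj D e = - inverse e" using e by (simp add: field_simps)
  have FD: "FD D (2 * (n + 1)) = 2 * sinh (2 * real (Suc n) * L) / sqrt q" for n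
  proof -
    define x where "x = 2 * real (Suc n) * L"
    have "e = exp L" using e by (simp add: L_def)
    hence "e ^ (2 * (n + 1)) = exp (real (2 * (n + 1)) * L)" by (simp only: exp_of_nat_mult)
    also have "real (2 * (n + 1)) * L = x" by (simp add: x_def)
    finally have "e ^ (2 * (n + 1)) = exp x" .
    moreover have "(- inverse e) ^ (2 * (n + 1)) = inverse (e ^ (2 * (n + 1)))"
      by (simp only: power_mult power2_minus power_inverse)
    ultimately have "FD D (2 * (n + 1)) = (exp x - inverse (exp x)) / sqrt q"
      unfolding FD_def e_def[symmetric] q_def[symmetric] conj by (simp only:)
    also have "exp x - inverse (exp x) = 2 * sinh x" by (simp add: sinh_field_def exp_minus)
    finally show ?thesis by (simp only: x_def)
  qed
  have trm: "ZevenTerm D s n = c s * of_real (2 * sinh (2 * real (Suc n) * L)) powr (- s)" for s n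
  proof -
    define S where "S = 2 * sinh (2 * real (Suc n) * L)"
    have S: "S > 0" using L by (simp add: S_def add_pos_nonneg)
    have "ln (S / sqrt q) = ln S - ln q / 2" using S q by (simp add: ln_divide_pos ln_sqrt)
    hence "of_real (S / sqrt q) powr (- s) = exp (- s * (of_real (ln S) - of_real (ln q) / 2))"
      using S q of_real_powr_complex[of "S / sqrt q" "- s"] by simp
    also have "\<dots> = c s * of_real S powr (- s)"
      unfolding c_exp of_real_powr_complex[OF S] by (simp add: algebra_simps flip: exp_add)
    finally show ?thesis unfolding ZevenTerm_def FD S_def .
  qed
  have sums: "ZevenTerm D s sums Z s" if "Re s > 0" for s
    unfolding trm Z_def by (intro sums_mult has_sum_imp_sums csch_series_eq_dirichlet L that)
  have rhs1: "term1 D s summable_on (UNIV - {0}) \<and> Z s = rhs1 D s"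
    if s: "Re s < 2" "s \<notin> poleSet D" "s \<noteq> 1" for s
  proof -
    have eq: "term1 D s m = Gamma (1 - s) / (4 * of_real L) *
      (gam_ratio s (pi * of_int m / (2 * L)) - pow_term s (pi * of_int m / (2 * L)))" if "m \<in> UNIV - {0}" for m
      using term1_eq[of D m s] that L by (simp add: L_def e_def)
    have summ: "(\<lambda>m::int. gam_ratio s (pi * of_int m / (2 * L)) - pow_term s (pi * of_int m / (2 * L))) summable_on (UNIV - {0})"
      using s by (intro summable_gam_tail L) (auto simp: P)
    have "term1 D s summable_on (UNIV - {0})"
      by (subst summable_on_cong[OF eq], assumption) (intro summable_on_cmult_right summ)
    moreover have "infsum (term1 D s) (UNIV - {0}) = Gamma (1 - s) / (4 * of_real L) * gam_tail L s"
      unfolding gam_tail_def infsum_cmult_right'[symmetric] by (rule infsum_cong[OF eq])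
    moreover have "riemann_zeta s = zeta_via L s"
      using s L by (intro riemann_zeta_eq_zeta_via) (auto simp: P)
    \<comment> \<open>The definition of \<open>zeta_via\<close> solved back for
      \<open>csch_series\<close>.\<close>
    hence "csch_series L s = riemann_zeta s / of_real (4 * L) powr s +
        Gamma (1 - s) / (4 * of_real L) * (gam_ratio s 0 + gam_tail L s)"
      using L by (simp add: zeta_via_def)
    moreover have "gam_ratio s 0 = Gamma (s / 2) * rGamma (1 - s / 2)"
      by (simp add: gam_ratio_def)
    hence "gam_ratio s 0 = Gamma (s / 2) / Gamma (1 - s / 2)"
      by (simp only: rGamma_inverse_Gamma divide_inverse)
    ultimately show ?thesis
      unfolding rhs1_def Let_def Z_def c_def e_def[symmetric] L_def[symmetric] q_def[symmetric]
      by (simp add: distrib_left mult_ac)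
  qed
  have rhs2: "term2 D s summable_on UNIV \<and> Z s = rhs2 D s"
    if s: "Re s < 0" "s \<notin> poleSet D" for s
  proof -
    have eq: "term2 D s = (\<lambda>m. gam_ratio s (pi * of_int m / (2 * L)))"
      unfolding L_def e_def by (rule ext) (rule term2_eq)
    have summ: "term2 D s summable_on (UNIV - {0})"
      unfolding eq using s by (intro summable_gam_ratio L) (auto simp: P)
    have U: "UNIV = insert 0 (UNIV - {0::int})" by auto
    have "term2 D s summable_on UNIV"
      by (subst U, subst summable_on_insert_iff) (use summ in auto)
    moreover have "infsum (term2 D s) UNIV = gam_ratio s 0 + infsum (term2 D s) (UNIV - {0})"
      by (subst U, subst infsum_insert[OF summ]) (auto simp: eq)
    ultimately show ?thesis
      unfolding rhs2_def Z_def csch_series_eq_left[OF L s(1) s(2)[unfolded P]]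
      unfolding c_def e_def[symmetric] L_def[symmetric] q_def[symmetric] eq
      by simp
  qed
  have "Z holomorphic_on - poleSet D"
    unfolding Z_def P by (intro holomorphic_on_mult c_hol csch_series_holomorphic L)
  moreover have "\<forall>p\<in>poleSet D. is_pole Z p \<and> zorder Z p = -1"
    unfolding Z_def P using csch_series_pole[OF L _ c_hol c0] by blast
  \<comment> \<open>All poles have real part at most 0, so the strip 1 < Re s < 2 is an instance of
    \<open>rhs1\<close>.\<close>
  moreover have "s \<notin> poleSet D \<and> s \<noteq> 1" if "1 < Re s" for s
    using that csch_poles_Re_le_0[of s L] by (auto simp: P)
  ultimately show ?thesis
    using sums rhs1 rhs2 by (intro conjI exI[of _ Z]) (auto simp: Zeven_def sums_iff)
qed

end
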